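(* Suppose that $P[W=0]=0$ and that $E[W^q]<+\infty$ for every real $q$. Then, for any $\beta\in(-\tau'(q_{\max}),-\tau'(q_{\min}))$, $$\dim(E_\beta)=\tau^*(\beta)\quad\text{almost surely.}$$
   Context: Let $\ell\ge 2$ be an integer. For $n\ge 1$ let $\mathcal{M}_n$ be the set of words $\varepsilon=\varepsilon_1\cdots\varepsilon_n$ of length $n$ with letters in $\{0,\dots,\ell-1\}$, let $\mathcal{M}=\bigcup_{n\ge 1}\mathcal{M}_n$, and let $I_{\varepsilon_1\cdots\varepsilon_n}=\left[\sum_{k=1}^n\frac{\varepsilon_k}{\ell^k},\ \sum_{k=1}^n\frac{\varepsilon_k}{\ell^k}+\frac1{\ell^n}\right)$. Let $W$ be a non-negative random variable with $E[W]=1$, and let $(W_\varepsilon)_{\varepsilon\in\mathcal{M}}$ be independent copies of $W$. Let $\lambda$ be the Lebesgue measure on $[0,1]$ and $m_n=f_n\lambda$ with $f_n=\sum_{\varepsilon_1\cdots\varepsilon_n\in\mathcal{M}_n}W_{\varepsilon_1}W_{\varepsilon_1\varepsilon_2}\cdots W_{\varepsilon_1\cdots\varepsilon_n}\mathbf 1_{I_{\varepsilon_1\cdots\varepsilon_n}}$. Almost surely $(m_n)$ converges weakly (against continuous functions on $[0,1]$) to a finite random Borel measure $m$ on $[0,1]$, called the Mandelbrot cascade associated to the weight $W$. The structure function is $\tau(q)=\log_\ell(E[W^q])-(q-1)$, $q\in\mathbb{R}$; it is convex and $C^\infty$ under the moment hypotheses. Its Legendre transform is $\tau^*(\beta)=\inf_{q\in\mathbb{R}}(q\beta+\tau(q))$.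 The (possibly infinite) numbers $q_{\min}<q_{\max}$ are defined by $(q_{\min},q_{\max})=\{q\in\mathbb{R}\ ;\ \tau^*(-\tau'(q))>0\}$; when $q_{\min}=-\infty$ or $q_{\max}=+\infty$, $\tau'(q_{\min})$ or $\tau'(q_{\max})$ is understood as the corresponding limit of $\tau'$. For $x\in[0,1)$, $I_n(x)$ is the interval $I_{\varepsilon}$, $\varepsilon\in\mathcal{M}_n$, containing $x$, $|I|$ is the length of $I$, and $$E_\beta=\left\{x\in[0,1)\ ;\ \lim_{n\to\infty}\frac{\log m(I_n(x))}{\log|I_n(x)|}=\beta\right\}.$$ $\dim$ denotes Hausdorff dimension.
   Formalization: The formal theorem additionally assumes that the cascade m is not almost surely zero; without this the claim fails (e.g. log-normal W with large variance, where m = 0 a.s. and every E_β is empty although τ*(β) > 0). *)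

theory Defs
  imports "HOL-Probability.Probability"
begin

section \<open>Hausdorff dimension\<close>

text \<open>
  The guards are there because \<open>0 powr 0 = 0\<close> in HOL: every nonempty set has \<open>0\<close>-size \<open>1\<close>
  (so that the \<open>0\<close>-dimensional measure counts points) and the empty set has size \<open>0\<close>.
\<close>

definition hausdorff_size :: "real \<Rightarrow> 'a::metric_space set \<Rightarrow> ennreal" where
  "hausdorff_size s U =
     (if U = {} then 0 else if s = 0 then 1 else ennreal (diameter U powr s))"

text \<open>\<open>diameter\<close> is meaningful for bounded sets only, hence the boundedness requirement.\<close>

definition hausdorff_premeasure :: "real \<Rightarrow> real \<Rightarrow> 'a::metric_space set \<Rightarrow> ennreal" where
  "hausdorff_premeasure s \<delta> A =
     (INF U \<in> {U :: nat \<Rightarrow> 'a set. A \<subseteq> (\<Union>i. U i) \<and> (\<forall>i. bounded (U i) \<and> diameter (U i) \<le> \<delta>)}.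
        (\<Sum>i. hausdorff_size s (U i)))"

definition hausdorff_measure :: "real \<Rightarrow> 'a::metric_space set \<Rightarrow> ennreal" where
  "hausdorff_measure s A = (SUP \<delta> \<in> {0<..}. hausdorff_premeasure s \<delta> A)"

definition hausdorff_dim :: "'a::metric_space set \<Rightarrow> ereal" where
  "hausdorff_dim A = (INF s \<in> {s. 0 \<le> s \<and> hausdorff_measure s A = 0}. ereal s)"


section \<open>Words and \<open>\<ell>\<close>-adic intervals\<close>

definition words_of_length :: "nat \<Rightarrow> nat \<Rightarrow> nat list set" where
  "words_of_length l n = {\<epsilon>. length \<epsilon> = n \<and> set \<epsilon> \<subseteq> {..<l}}"

definition words :: "nat \<Rightarrow> nat list set" where
  "words l = (\<Union>n\<in>{1..}. words_of_length l n)"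

text \<open>List positions start at \<open>0\<close>, so the \<open>k\<close>-th letter of the word is \<open>\<epsilon> ! (k - 1)\<close>.\<close>

definition ladic_interval :: "nat \<Rightarrow> nat list \<Rightarrow> real set" where
  "ladic_interval l \<epsilon> =
     (let a = (\<Sum>k = 1..length \<epsilon>. real (\<epsilon> ! (k - 1)) / real l ^ k)
      in {a ..< a + 1 / real l ^ length \<epsilon>})"

definition ladic_interval_at :: "nat \<Rightarrow> nat \<Rightarrow> real \<Rightarrow> real set" where
  "ladic_interval_at l n x = (THE I. x \<in> I \<and> I \<in> ladic_interval l ` words_of_length l n)"


section \<open>Mandelbrot cascades\<close>

definition cascade_density ::
    "nat \<Rightarrow> (nat list \<Rightarrow> 'a \<Rightarrow> real) \<Rightarrow> nat \<Rightarrow> 'a \<Rightarrow> real \<Rightarrow> real" where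
  "cascade_density l Ws n \<omega> x =
     (\<Sum>\<epsilon>\<in>words_of_length l n.
        (\<Prod>k = 1..n. Ws (take k \<epsilon>) \<omega>) * indicator (ladic_interval l \<epsilon>) x)"

definition cascade_approx ::
    "nat \<Rightarrow> (nat list \<Rightarrow> 'a \<Rightarrow> real) \<Rightarrow> nat \<Rightarrow> 'a \<Rightarrow> real measure" where
  "cascade_approx l Ws n \<omega> =
     density (restrict_space lborel {0..1}) (\<lambda>x. ennreal (cascade_density l Ws n \<omega> x))"

definition converges_weakly_01 :: "(nat \<Rightarrow> real measure) \<Rightarrow> real measure \<Rightarrow> bool" where
  "converges_weakly_01 \<mu> \<nu> \<longleftrightarrow>
     (\<forall>g :: real \<Rightarrow> real. continuous_on {0..1} g \<longrightarrow>
        (\<lambda>n. \<integral>x. g x \<partial>\<mu> n) \<longlonglongrightarrow> (\<integral>x. g x \<partial>\<nu>))"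

definition finite_random_measure_01 :: "'a measure \<Rightarrow> ('a \<Rightarrow> real measure) \<Rightarrow> bool" where
  "finite_random_measure_01 M m \<longleftrightarrow>
     (\<forall>\<omega>\<in>space M. finite_measure (m \<omega>) \<and> sets (m \<omega>) = sets (restrict_space borel {0..1})) \<and>
     (\<forall>B\<in>sets (restrict_space borel {0..1}). (\<lambda>\<omega>. emeasure (m \<omega>) B) \<in> borel_measurable M)"

text \<open>The cascade is the almost sure weak limit, so it is determined up to a null event.\<close>

definition mandelbrot_cascade ::
    "'a measure \<Rightarrow> nat \<Rightarrow> (nat list \<Rightarrow> 'a \<Rightarrow> real) \<Rightarrow> ('a \<Rightarrow> real measure) \<Rightarrow> bool" where
  "mandelbrot_cascade M l Ws m \<longleftrightarrow>
     finite_random_measure_01 M m \<and>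
     (AE \<omega> in M. converges_weakly_01 (\<lambda>n. cascade_approx l Ws n \<omega>) (m \<omega>))"


section \<open>Structure function and level sets\<close>

definition structure_function :: "'a measure \<Rightarrow> nat \<Rightarrow> ('a \<Rightarrow> real) \<Rightarrow> real \<Rightarrow> real" where
  "structure_function M l W q = log (real l) (\<integral>\<omega>. W \<omega> powr q \<partial>M) - (q - 1)"

definition legendre :: "(real \<Rightarrow> real) \<Rightarrow> real \<Rightarrow> ereal" where
  "legendre \<tau> \<beta> = (INF q. ereal (q * \<beta> + \<tau> q))"

text \<open>For a structure function the set below is an open interval containing \<open>0\<close>; \<open>q_min\<close> and
  \<open>q_max\<close> are its endpoints.\<close>

definition q_range :: "(real \<Rightarrow> real) \<Rightarrow> real set" where
  "q_range \<tau> = {q. legendre \<tau> (- deriv \<tau> q) > 0}"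

definition q_min :: "(real \<Rightarrow> real) \<Rightarrow> ereal" where
  "q_min \<tau> = (INF q\<in>q_range \<tau>. ereal q)"

definition q_max :: "(real \<Rightarrow> real) \<Rightarrow> ereal" where
  "q_max \<tau> = (SUP q\<in>q_range \<tau>. ereal q)"

definition deriv_ext :: "(real \<Rightarrow> real) \<Rightarrow> ereal \<Rightarrow> ereal" where
  "deriv_ext \<tau> q =
     (case q of
        ereal r \<Rightarrow> ereal (deriv \<tau> r)
      | PInfty \<Rightarrow> Lim at_top (\<lambda>r. ereal (deriv \<tau> r))
      | MInfty \<Rightarrow> Lim at_bot (\<lambda>r. ereal (deriv \<tau> r)))"

text \<open>With \<open>log 0 = -\<infinity>\<close>, a finite limit forces \<open>\<mu> (I\<^sub>n(x)) > 0\<close> for large \<open>n\<close>. In HOL \<open>ln 0 = 0\<close>,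
  so this is required explicitly.\<close>

definition level_set :: "nat \<Rightarrow> real measure \<Rightarrow> real \<Rightarrow> real set" where
  "level_set l \<mu> \<beta> =
     {x \<in> {0..<1}.
        (\<forall>\<^sub>F n in sequentially. 0 < measure \<mu> (ladic_interval_at l n x)) \<and>
        (\<lambda>n. ln (measure \<mu> (ladic_interval_at l n x)) / ln (measure lborel (ladic_interval_at l n x)))
          \<longlonglongrightarrow> \<beta>}"

end

theory Submission
  imports Defs "HOL-Library.Sublist"
begin

text \<open>
  The measure \<open>m\<close> gives the interval of a word \<open>u\<close> of length \<open>n\<close> the mass
  \<open>l\<^sup>-\<^sup>n Q(u) Z(u)\<close>, where \<open>Q(u)\<close> is the product of the weights along \<open>u\<close> and \<open>Z(u)\<close> is a copy of the
  total mass that is independent of \<open>Q(u)\<close>. Hence the \<open>n\<close>-th level sum of the \<open>q\<close>-th powers of the masses has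
  expectation \<open>l powr (n * \<tau> q)\<close> times a moment of \<open>Z\<close>, and everything rests on controlling such level sums: a
  geometric bound on their expectations makes them summable over \<open>n\<close>, almost surely.

  The hypothesis on \<open>\<beta>\<close> provides \<open>q\<close> with \<open>\<beta> = - \<tau>' q\<close>, so that the Legendre transform at \<open>\<beta>\<close> is
  \<open>d = \<tau> q + q * \<beta> > 0\<close> (\<open>slope_attained\<close>).

  Upper bound. On the level set the \<open>q\<close>-th power of the mass of the \<open>n\<close>-th interval is eventually at least
  \<open>l powr (- n * (q * \<beta> + \<eta>))\<close>. Counting the intervals with this property by the level sum of \<open>q\<close>-th powers
  gives a cover that annihilates the \<open>s\<close>-dimensional Hausdorff measure for every \<open>s > d\<close>. This needs a finite moment
  \<open>E Z\<^sup>q\<close>. For \<open>q > 1\<close> it follows from \<open>\<tau> < 0\<close> on \<open>(1, q]\<close> (\<open>negative_beyond_1\<close>,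
  \<open>bounded_moment_iterate\<close>); for \<open>q < 0\<close> it follows from the fact that \<open>Z\<close> dominates a multiple of the geometric
  mean of two independent products of a weight with a copy of \<open>Z\<close> (\<open>bounded_negative_moment\<close>).

  Lower bound. The weights \<open>X\<^sup>q / E X\<^sup>q\<close> define a second cascade on the same tree. Because \<open>d > 0\<close>, some moment of
  order \<open>p > 1\<close> of its total masses is contracted from one level to the next, so a von Bahr--Esseen estimate makes them
  converge almost surely and in the mean, to a limit that does not vanish (\<open>nondegenerateI\<close>, \<open>not_extinct\<close>). The
  limit is a flow on the tree of words. Moment bounds show that, apart from words of summable flow, a
  word of length \<open>n\<close> carries flow at most \<open>l powr (- n * s)\<close>, for a given \<open>s < d\<close>, and \<open>m\<close>-mass close to
  \<open>l powr (- n * \<beta>)\<close>. A mass distribution principle for flows (\<open>flow_mass_distribution\<close>) then shows that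
  the level set has positive \<open>s\<close>-dimensional measure.

  The intervals are half-open and \<open>m\<close> is known only as a weak limit. Fatou's lemma shows that \<open>m\<close> almost surely has no
  mass at a given point, and the identification of the masses of the intervals follows (\<open>AE_stage_mass_limit\<close>). This
  also yields the convergence of the masses of all subtrees of the original cascade, and the hypothesis that \<open>m\<close>
  is not almost surely zero makes their limits positive.
\<close>

section \<open>Words\<close>

lemma words_of_length_Suc:
  "words_of_length l (Suc n) = (\<lambda>(u, j). u @ [j]) ` (words_of_length l n \<times> {..<l})"
proof (intro set_eqI iffI)
  fix w assume "w \<in> words_of_length l (Suc n)"
  then have w: "length w = Suc n" "set w \<subseteq> {..<l}" by (auto simp: words_of_length_def)
  then obtain u j where "w = u @ [j]" by (metis length_0_conv nat.distinct(1) rev_exhaust)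
  with w show "w \<in> (\<lambda>(u, j). u @ [j]) ` (words_of_length l n \<times> {..<l})"
    by (auto simp: words_of_length_def image_iff)
qed (auto simp: words_of_length_def)

lemma words_of_length_0: "words_of_length l 0 = {[]}"
  by (auto simp: words_of_length_def)

lemma finite_words_of_length [simp]: "finite (words_of_length l n)"
  by (induction n) (auto simp: words_of_length_Suc words_of_length_0)

lemma sum_words_of_length_Suc:
  fixes f :: "nat list \<Rightarrow> 'b::comm_monoid_add"
  shows "(\<Sum>w\<in>words_of_length l (Suc n). f w) = (\<Sum>u\<in>words_of_length l n. \<Sum>j<l. f (u @ [j]))"
proof -
  have "inj_on (\<lambda>(u, j). u @ [j]) (words_of_length l n \<times> {..<l})" by (auto simp: inj_on_def)
  then have "(\<Sum>w\<in>words_of_length l (Suc n). f w)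
      = (\<Sum>x\<in>words_of_length l n \<times> {..<l}. f (case x of (u, j) \<Rightarrow> u @ [j]))"
    unfolding words_of_length_Suc by (subst sum.reindex) (auto simp: o_def)
  also have "\<dots> = (\<Sum>u\<in>words_of_length l n. \<Sum>j<l. f (u @ [j]))"
    by (simp add: sum.cartesian_product case_prod_beta)
  finally show ?thesis .
qed

lemma card_words_of_length: "card (words_of_length l n) = l ^ n"
  using sum_words_of_length_Suc[of "\<lambda>_. 1::nat"]
  by (induction n) (auto simp: words_of_length_0)

section \<open>The l-adic intervals\<close>

text \<open>
  The left endpoint of the interval of \<open>u\<close> is \<open>word_index l u / l ^ length u\<close>, so that questions about these
  intervals become questions about integer parts.
\<close>

definition word_index :: "nat \<Rightarrow> nat list \<Rightarrow> nat" where
  "word_index l u = foldl (\<lambda>a j. l * a + j) 0 u"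

lemma word_index_Nil [simp]: "word_index l [] = 0"
  and word_index_snoc [simp]: "word_index l (u @ [j]) = l * word_index l u + j"
  by (simp_all add: word_index_def)

lemma word_index_less: "set u \<subseteq> {..<l} \<Longrightarrow> word_index l u < l ^ length u"
proof (induction u rule: rev_induct)
  case (snoc j u)
  then have "word_index l u + 1 \<le> l ^ length u" "j < l" by auto
  then have "l * (word_index l u + 1) \<le> l * l ^ length u" by (intro mult_le_mono) auto
  with \<open>j < l\<close> show ?case by (simp add: algebra_simps)
qed simp

text \<open>
  Division with remainder by \<open>l\<close> recovers the last letter, hence injectivity; both sets have \<open>l ^ n\<close> elements.
\<close>

lemma bij_betw_word_index:
  assumes "0 < l"
  shows "bij_betw (word_index l) (words_of_length l n) {..<l ^ n}"
proof -
  have "inj_on (word_index l) (words_of_length l n)"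
  proof (induction n)
    case (Suc n)
    have "u = v \<and> i = j" if "u \<in> words_of_length l n" "v \<in> words_of_length l n" "i < l" "j < l"
      "l * word_index l u + i = l * word_index l v + j" for u v i j
    proof -
      have 1: "(l * word_index l u + i) div l = word_index l u" "(l * word_index l u + i) mod l = i"
        using that(3) by auto
      have 2: "(l * word_index l v + j) div l = word_index l v" "(l * word_index l v + j) mod l = j"
        using that(4) by auto
      have "word_index l u = word_index l v" "i = j" using 1 2 unfolding that(5) by simp_all
      then show ?thesis using Suc that by (auto simp: inj_on_def)
    qed
    then show ?case by (auto simp: inj_on_def words_of_length_Suc)
  qed (auto simp: words_of_length_0)
  moreover have "word_index l ` words_of_length l n \<subseteq> {..<l ^ n}"
    using word_index_less by (auto simp: words_of_length_def)
  ultimately show ?thesis unfolding bij_betw_def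
    by (intro conjI card_subset_eq) (simp_all add: card_image card_words_of_length)
qed

lemma ladic_interval_eq:
  assumes "0 < l"
  shows "ladic_interval l u = {real (word_index l u) / real l ^ length u ..<
           (real (word_index l u) + 1) / real l ^ length u}"
proof -
  have "(\<Sum>k = 1..length u. real (u ! (k - 1)) / real l ^ k) = real (word_index l u) / real l ^ length u"
  proof (induction u rule: rev_induct)
    case (snoc j u)
    have "(\<Sum>k = 1..length u. real ((u @ [j]) ! (k - 1)) / real l ^ k)
        = (\<Sum>k = 1..length u. real (u ! (k - 1)) / real l ^ k)"
      by (intro sum.cong) (auto simp: nth_append)
    then show ?case using snoc assms by (simp add: field_simps)
  qed simp
  then show ?thesis by (simp add: ladic_interval_def Let_def add_divide_distrib)
qed

lemma mem_ladic_interval_iff: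
  assumes "0 < l"
  shows "x \<in> ladic_interval l u \<longleftrightarrow> \<lfloor>x * real l ^ length u\<rfloor> = int (word_index l u)"
proof -
  have "real l ^ length u > 0" using assms by simp
  then show ?thesis unfolding ladic_interval_eq[OF assms] by (simp add: floor_eq_iff field_simps)
qed

lemma ladic_interval_unique:
  assumes "0 < l" "u \<in> words_of_length l n" "v \<in> words_of_length l n"
    "x \<in> ladic_interval l u" "x \<in> ladic_interval l v"
  shows "u = v"
  using assms bij_betw_word_index[OF assms(1), of n]
  by (auto simp: mem_ladic_interval_iff words_of_length_def bij_betw_def inj_on_def)

lemma ladic_interval_exists:
  assumes "0 < l" "x \<in> {0..<1::real}"
  obtains u where "u \<in> words_of_length l n" "x \<in> ladic_interval l u"
proof -
  define i where "i = nat \<lfloor>x * real l ^ n\<rfloor>"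
  have p: "real l ^ n > 0" using assms by simp
  have "0 \<le> x * real l ^ n" "x * real l ^ n < real l ^ n" using assms p by auto
  then have i: "int i = \<lfloor>x * real l ^ n\<rfloor>" unfolding i_def by simp
  have "real i \<le> x * real l ^ n" using i by (metis of_int_floor_le of_int_of_nat_eq)
  then have "real i < real (l ^ n)" using \<open>x * real l ^ n < real l ^ n\<close> unfolding of_nat_power by (rule le_less_trans)
  then have "i < l ^ n" by (simp only: of_nat_less_iff)
  then obtain u where "u \<in> words_of_length l n" "word_index l u = i"
    using bij_betw_word_index[OF assms(1), of n] by (metis bij_betw_iff_bijections lessThan_iff)
  moreover have "length u = n" using \<open>u \<in> words_of_length l n\<close> by (simp add: words_of_length_def)
  ultimately show ?thesis using i by (intro that[of u]) (simp_all add: mem_ladic_interval_iff[OF assms(1)])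
qed

lemma ladic_interval_at_eq:
  assumes "0 < l" "u \<in> words_of_length l n" "x \<in> ladic_interval l u"
  shows "ladic_interval_at l n x = ladic_interval l u"
  unfolding ladic_interval_at_def
  using assms ladic_interval_unique[OF assms(1,2)] by (intro the_equality) blast+

lemma ladic_interval_subset_unit:
  assumes "0 < l" "u \<in> words_of_length l n"
  shows "ladic_interval l u \<subseteq> {0..<1}"
proof -
  have "word_index l u < l ^ length u" using assms word_index_less by (auto simp: words_of_length_def)
  then have "word_index l u + 1 \<le> l ^ length u" by simp
  then have "real (word_index l u) + 1 \<le> real l ^ length u"
    by (metis of_nat_1 of_nat_add of_nat_le_iff of_nat_power)
  then have "(real (word_index l u) + 1) / real l ^ length u \<le> 1" using assms by simp
  moreover have "0 \<le> real (word_index l u) / real l ^ length u" by simp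
  ultimately show ?thesis unfolding ladic_interval_eq[OF assms(1)]
    by (auto intro: order_trans less_le_trans)
qed

lemma ladic_interval_snoc_subset:
  assumes "0 < l" "j < l"
  shows "ladic_interval l (u @ [j]) \<subseteq> ladic_interval l u"
proof -
  have p: "real l ^ length u > 0" "real l > 0" using assms by auto
  have "real j + 1 \<le> real l" using assms by linarith
  have "real (l * word_index l u) / (real l * real l ^ length u) = real (word_index l u) / real l ^ length u"
    using p by simp
  moreover have "(real (l * word_index l u) + real l) / (real l * real l ^ length u) = (real (word_index l u) + 1) / real l ^ length u"
    using p by (simp add: field_simps)
  moreover have "real (l * word_index l u) / (real l * real l ^ length u) \<le> real (l * word_index l u + j) / (real l * real l ^ length u)"
    using p by (intro divide_right_mono) auto
  moreover have "(real (l * word_index l u + j) + 1) / (real l * real l ^ length u) \<le> (real (l * word_index l u) + real l) / (real l * real l ^ length u)"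
    using p \<open>real j + 1 \<le> real l\<close> by (intro divide_right_mono) auto
  ultimately show ?thesis
    unfolding ladic_interval_eq[OF assms(1)] by auto
qed

lemma measure_ladic_interval:
  assumes "0 < l"
  shows "measure lborel (ladic_interval l u) = 1 / real l ^ length u"
proof -
  have "real (word_index l u) / real l ^ length u \<le> (real (word_index l u) + 1) / real l ^ length u"
    by (intro divide_right_mono) auto
  then show ?thesis unfolding ladic_interval_eq[OF assms] by (simp add: diff_divide_distrib[symmetric])
qed

text \<open>
  For two points of \<open>U\<close>, the products with \<open>l ^ n\<close> differ by at most \<open>1\<close>, so all the indices lie among three
  consecutive integers.
\<close>

lemma card_ladic_intervals_meeting:
  fixes U :: "real set"
  assumes "0 < l" "bounded U" "diameter U \<le> 1 / real l ^ n"
  shows "card {u \<in> words_of_length l n. ladic_interval l u \<inter> U \<noteq> {}} \<le> 3"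
proof (cases "U = {}")
  case False
  then obtain x0 where x0: "x0 \<in> U" by auto
  define f where "f = \<lfloor>x0 * real l ^ n\<rfloor>"
  let ?S = "{u \<in> words_of_length l n. ladic_interval l u \<inter> U \<noteq> {}}"
  have "int (word_index l u) \<in> {f - 1..f + 1}" if u: "u \<in> ?S" for u
  proof -
    obtain x where x: "x \<in> U" "x \<in> ladic_interval l u" using u by auto
    have len: "length u = n" using u by (auto simp: words_of_length_def)
    have "\<bar>x - x0\<bar> \<le> 1 / real l ^ n"
      using diameter_bounded_bound[OF assms(2) x(1) x0] assms(3) by (simp add: dist_real_def)
    then have "\<bar>x - x0\<bar> * real l ^ n \<le> 1" using assms(1) by (simp add: field_simps)
    then have "\<bar>x * real l ^ n - x0 * real l ^ n\<bar> \<le> 1"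
      by (simp add: left_diff_distrib[symmetric] abs_mult)
    moreover have "int (word_index l u) = \<lfloor>x * real l ^ n\<rfloor>"
      using x(2) len by (simp add: mem_ladic_interval_iff[OF assms(1)])
    ultimately show ?thesis unfolding f_def atLeastAtMost_iff by linarith
  qed
  then have sub: "(\<lambda>u. int (word_index l u)) ` ?S \<subseteq> {f - 1..f + 1}" by (rule image_subsetI)
  have "inj_on (\<lambda>u. int (word_index l u)) ?S"
    using bij_betw_word_index[OF assms(1), of n] by (auto simp: bij_betw_def inj_on_def)
  then have "card ?S = card ((\<lambda>u. int (word_index l u)) ` ?S)" by (simp add: card_image)
  also have "\<dots> \<le> card {f - 1..f + 1}" by (intro card_mono sub) auto
  finally show ?thesis by simp
qed auto

text \<open>
  The point is the supremum of the left endpoints. It could coincide with a right endpoint, which does not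
  belong to the interval, only if all later digits were \<open>l - 1\<close>.
\<close>

lemma path_point:
  assumes l: "0 < l" and x: "\<And>i. x i < l" and nontail: "\<And>n. \<exists>i\<ge>n. x i \<noteq> l - 1"
  obtains y where "\<And>n. y \<in> ladic_interval l (map x [0..<n])"
proof -
  define w where "w n = map x [0..<n]" for n
  have w_Suc: "w (Suc n) = w n @ [x n]" and len: "length (w n) = n" for n by (auto simp: w_def)
  define a where "a n = real (word_index l (w n)) / real l ^ n" for n
  define b where "b n = (real (word_index l (w n)) + 1) / real l ^ n" for n
  have p: "real l ^ n > 0" for n using l by simp
  have a_Suc: "a (Suc n) = a n + real (x n) / real l ^ Suc n" for n
    using l by (simp add: a_def w_Suc field_simps)
  have b_Suc: "b (Suc n) = b n - (real l - 1 - real (x n)) / real l ^ Suc n" for n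
    using l by (simp add: b_def w_Suc field_simps)
  have x': "real (x n) + 1 \<le> real l" for n using x[of n] by linarith
  have "incseq a" by (rule incseq_SucI) (simp add: a_Suc)
  moreover have db: "decseq b" by (rule decseq_SucI) (use x' l in \<open>simp add: b_Suc algebra_simps\<close>)
  moreover have ab: "a n < b n" for n unfolding a_def b_def using p by (intro divide_strict_right_mono) auto
  ultimately have abnm: "a n \<le> b k" for n k
  proof -
    have "a n \<le> a (max n k)" using \<open>incseq a\<close> by (simp add: incseqD)
    also have "\<dots> \<le> b (max n k)" using ab less_imp_le by blast
    also have "\<dots> \<le> b k" using db by (simp add: decseqD)
    finally show ?thesis .
  qed
  then have bdd: "bdd_above (range a)" by (intro bdd_aboveI2[where M="b 0"])
  define y where "y = (SUP n. a n)"
  have "a n \<le> y" for n unfolding y_def by (intro cSUP_upper bdd) auto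
  moreover have "y < b n" for n
  proof -
    obtain i where i: "i \<ge> n" "x i \<noteq> l - 1" using nontail by blast
    have "real (x i) + 1 < real l" using i(2) x[of i] by linarith
    then have "b (Suc i) < b i" unfolding b_Suc using p[of "Suc i"] by simp
    moreover have "y \<le> b (Suc i)" unfolding y_def by (intro cSUP_least abnm) auto
    moreover have "b i \<le> b n" using db i by (simp add: decseqD)
    ultimately show ?thesis by linarith
  qed
  ultimately have "y \<in> ladic_interval l (w n)" for n
    unfolding ladic_interval_eq[OF l] len by (simp add: a_def b_def)
  then show ?thesis using that unfolding w_def by blast
qed

section \<open>Flows on the tree of words\<close>

text \<open>
  A greedy choice. Let \<open>c u\<close> be the total flow of the words of \<open>C\<close> that extend \<open>u\<close>. If \<open>c u < \<Theta> u\<close>, then the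
  same holds for some child of \<open>u\<close>, since \<open>\<Theta>\<close> is additive and \<open>c\<close> is superadditive; and a word of \<open>C\<close> never
  satisfies this inequality.
\<close>

lemma flow_path_avoiding:
  fixes \<Theta> :: "nat list \<Rightarrow> real"
  assumes nonneg: "\<And>u. 0 \<le> \<Theta> u"
    and flow: "\<And>u. set u \<subseteq> {..<l} \<Longrightarrow> \<Theta> u = (\<Sum>j<l. \<Theta> (u @ [j]))"
    and small: "(\<integral>\<^sup>+u. ennreal (\<Theta> u) * indicator C u \<partial>count_space UNIV) < ennreal (\<Theta> [])"
  obtains x where "\<And>i. x i < l" "\<And>n. map x [0..<n] \<notin> C"
proof -
  define c where "c u = (\<integral>\<^sup>+w. ennreal (\<Theta> w) * indicator (C \<inter> {w. prefix u w}) w \<partial>count_space UNIV)" for u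
  have c_ge: "ennreal (\<Theta> u) \<le> c u" if "u \<in> C" for u
  proof -
    have "ennreal (\<Theta> u) * indicator (C \<inter> {w. prefix u w}) u \<le> c u"
      unfolding c_def by (rule nn_integral_ge_point) simp
    then show ?thesis using that by simp
  qed
  have c_sum: "(\<Sum>j<l. c (u @ [j])) \<le> c u" for u
  proof -
    have "(\<Sum>j<l. c (u @ [j])) = (\<integral>\<^sup>+w. (\<Sum>j<l. ennreal (\<Theta> w) * indicator (C \<inter> {w. prefix (u @ [j]) w}) w) \<partial>count_space UNIV)"
      unfolding c_def by (subst nn_integral_sum) auto
    also have "\<dots> \<le> c u" unfolding c_def
    proof (rule nn_integral_mono)
      fix w :: "nat list"
      have dj: "disjoint_family_on (\<lambda>j. C \<inter> {w. prefix (u @ [j]) w}) {..<l}"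
        unfolding disjoint_family_on_def by (auto simp: prefix_def)
      have "(\<Sum>j<l. ennreal (\<Theta> w) * indicator (C \<inter> {w. prefix (u @ [j]) w}) w)
          = ennreal (\<Theta> w) * indicator (\<Union>j<l. C \<inter> {w. prefix (u @ [j]) w}) w"
        by (subst indicator_UN_disjoint[OF _ dj]) (auto simp: sum_distrib_left)
      also have "\<dots> \<le> ennreal (\<Theta> w) * indicator (C \<inter> {w. prefix u w}) w"
        by (intro mult_left_mono) (auto simp: indicator_def dest: append_prefixD)
      finally show "(\<Sum>j<l. ennreal (\<Theta> w) * indicator (C \<inter> {w. prefix (u @ [j]) w}) w)
         \<le> ennreal (\<Theta> w) * indicator (C \<inter> {w. prefix u w}) w" .
    qed
    finally show ?thesis .
  qed
  define P where "P u \<longleftrightarrow> set u \<subseteq> {..<l} \<and> c u < ennreal (\<Theta> u)" for u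
  have P_step: "\<exists>j. j < l \<and> P (u @ [j])" if "P u" for u
  proof (rule ccontr)
    assume no: "\<not> ?thesis"
    have "ennreal (\<Theta> u) = (\<Sum>j<l. ennreal (\<Theta> (u @ [j])))"
      using flow[of u] that nonneg by (simp add: P_def)
    also have "\<dots> \<le> (\<Sum>j<l. c (u @ [j]))"
    proof (rule sum_mono)
      fix j assume "j \<in> {..<l}"
      then have "\<not> P (u @ [j])" using no by auto
      then show "ennreal (\<Theta> (u @ [j])) \<le> c (u @ [j])"
        using that \<open>j \<in> {..<l}\<close> unfolding P_def by (simp add: not_less)
    qed
    also have "\<dots> \<le> c u" by (rule c_sum)
    finally show False using that by (auto simp: P_def)
  qed
  define f where "f = rec_nat [] (\<lambda>_ u. u @ [SOME j. j < l \<and> P (u @ [j])])"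
  define x where "x n = (SOME j. j < l \<and> P (f n @ [j]))" for n
  have f0: "f 0 = []" and fS: "f (Suc n) = f n @ [x n]" for n by (auto simp: f_def x_def)
  have "c [] = (\<integral>\<^sup>+u. ennreal (\<Theta> u) * indicator C u \<partial>count_space UNIV)" by (simp add: c_def)
  then have P0: "P (f 0)" using small by (simp add: P_def f0)
  have x: "x n < l \<and> P (f n @ [x n])" if "P (f n)" for n
    unfolding x_def using someI_ex[OF P_step[OF that]] .
  have Pf: "P (f n)" for n by (induction n) (use P0 x fS in auto)
  have "map x [0..<n] = f n" for n by (induction n) (auto simp: f0 fS)
  then show ?thesis using that[of x] x Pf c_ge by (metis P_def leD)
qed

lemma nn_integral_words_le:
  fixes g :: "nat list \<Rightarrow> real"
  assumes "\<And>u. 0 \<le> g u" "C \<subseteq> (\<Union>n. words_of_length l n)"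
    and "\<And>n. (\<Sum>u\<in>words_of_length l n \<inter> C. g u) \<le> s n" "summable s"
  shows "(\<integral>\<^sup>+u. ennreal (g u) * indicator C u \<partial>count_space UNIV) \<le> ennreal (suminf s)"
proof -
  have dj: "disjoint_family (\<lambda>n. words_of_length l n \<inter> C)"
    unfolding disjoint_family_on_def words_of_length_def by auto
  have C: "C = (\<Union>n. words_of_length l n \<inter> C)" using assms(2) by auto
  have s: "0 \<le> s n" for n by (rule order_trans[OF sum_nonneg assms(3)[of n]]) (rule assms(1))
  have "(\<integral>\<^sup>+u. ennreal (g u) * indicator C u \<partial>count_space UNIV)
      = (\<integral>\<^sup>+u. (\<Sum>n. ennreal (g u) * indicator (words_of_length l n \<inter> C) u) \<partial>count_space UNIV)"
    by (simp only: ennreal_suminf_cmult suminf_indicator[OF dj] C[symmetric])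
  also have "\<dots> = (\<Sum>n. \<integral>\<^sup>+u. ennreal (g u) * indicator (words_of_length l n \<inter> C) u \<partial>count_space UNIV)"
    by (rule nn_integral_suminf) auto
  also have "\<dots> = (\<Sum>n. ennreal (\<Sum>u\<in>words_of_length l n \<inter> C. g u))"
  proof (intro suminf_cong)
    fix n
    have "(\<integral>\<^sup>+u. ennreal (g u) * indicator (words_of_length l n \<inter> C) u \<partial>count_space UNIV)
       = (\<Sum>u\<in>words_of_length l n \<inter> C. ennreal (g u) * indicator (words_of_length l n \<inter> C) u)"
      by (subst nn_integral_count_space'[of "words_of_length l n \<inter> C"]) (auto split: split_indicator)
    then show "(\<integral>\<^sup>+u. ennreal (g u) * indicator (words_of_length l n \<inter> C) u \<partial>count_space UNIV)
       = ennreal (\<Sum>u\<in>words_of_length l n \<inter> C. g u)"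
      using assms(1) by simp
  qed
  also have "\<dots> \<le> (\<Sum>n. ennreal (s n))" using assms(3) by (intro suminf_le) (auto intro: ennreal_leI)
  also have "\<dots> = ennreal (suminf s)" using assms(4) s by (intro suminf_ennreal2) auto
  finally show ?thesis .
qed

lemma nn_integral_long_words_small:
  fixes g :: "nat list \<Rightarrow> real"
  assumes "\<And>u. 0 \<le> g u" "summable (\<lambda>n. \<Sum>u\<in>words_of_length l n \<inter> B. g u)" "0 < e"
  obtains N where "\<And>M. N \<le> M \<Longrightarrow> (\<integral>\<^sup>+u. ennreal (g u) * indicator {u \<in> B. set u \<subseteq> {..<l} \<and> M \<le> length u} u \<partial>count_space UNIV) \<le> ennreal e"
proof -
  define s where "s n = (\<Sum>u\<in>words_of_length l n \<inter> B. g u)" for n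
  have s0: "0 \<le> s n" for n unfolding s_def using assms(1) by (simp add: sum_nonneg)
  have sm: "summable s" using assms(2) by (simp add: s_def[abs_def])
  obtain N where N: "norm (\<Sum>i. s (i + n)) < e" if "n \<ge> N" for n
    using suminf_exist_split[OF assms(3) sm] by blast
  show ?thesis
  proof (rule that[of N])
    fix M assume M: "N \<le> M"
    let ?C = "{u \<in> B. set u \<subseteq> {..<l} \<and> M \<le> length u}"
    let ?t = "\<lambda>n. if n < M then 0 else s n"
    have t: "summable ?t" using sm by (rule summable_comparison_test'[where N=0]) (simp add: s0)
    have "(\<integral>\<^sup>+u. ennreal (g u) * indicator ?C u \<partial>count_space UNIV) \<le> ennreal (suminf ?t)"
    proof (rule nn_integral_words_le[OF assms(1) _ _ t])
      show "?C \<subseteq> (\<Union>n. words_of_length l n)" by (auto simp: words_of_length_def)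
      fix n
      show "sum g (words_of_length l n \<inter> ?C) \<le> ?t n"
      proof (cases "n < M")
        case True
        then have "words_of_length l n \<inter> ?C = {}" by (auto simp: words_of_length_def)
        then show ?thesis using True by simp
      next
        case False
        then show ?thesis unfolding s_def using assms(1) by (auto intro!: sum_mono2)
      qed
    qed
    also have "suminf ?t = (\<Sum>i. ?t (i + M)) + (\<Sum>i<M. ?t i)" by (rule suminf_split_initial_segment[OF t])
    also have "\<dots> = (\<Sum>i. s (i + M))" by simp
    also have "\<dots> \<le> e" using N[OF M] by simp
    finally show "(\<integral>\<^sup>+u. ennreal (g u) * indicator ?C u \<partial>count_space UNIV) \<le> ennreal e"
      by (simp add: ennreal_leI)
  qed
qed


section \<open>Hausdorff measure of sets coded by words\<close>

lemma powr_inverse_power: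
  fixes l :: nat
  assumes "0 < l"
  shows "(1 / real l ^ n) powr s = ((1 / real l) powr s) ^ n"
proof -
  have "((1 / real l) ^ n) powr s = ((1 / real l) powr s) ^ n"
  proof (induction n)
    case (Suc n)
    have "((1 / real l) ^ Suc n) powr s = (1 / real l) powr s * ((1 / real l) ^ n) powr s"
      unfolding power_Suc by (rule powr_mult)
    then show ?case using Suc by simp
  qed (use assms in auto)
  then show ?thesis by (simp only: power_one_over)
qed

lemma diameter_ladic_interval_le:
  assumes "0 < l"
  shows "bounded (ladic_interval l u)" "diameter (ladic_interval l u) \<le> 1 / real l ^ length u"
    "0 \<le> diameter (ladic_interval l u)"
proof -
  show b: "bounded (ladic_interval l u)" unfolding ladic_interval_eq[OF assms]
    by (rule bounded_subset[OF bounded_closed_interval[of "real (word_index l u) / real l ^ length u"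
        "(real (word_index l u) + 1) / real l ^ length u"]]) auto
  show "diameter (ladic_interval l u) \<le> 1 / real l ^ length u"
  proof (rule diameter_le)
    fix x y assume "x \<in> ladic_interval l u" "y \<in> ladic_interval l u"
    then show "norm (x - y) \<le> 1 / real l ^ length u"
      unfolding ladic_interval_eq[OF assms] by (auto simp: add_divide_distrib)
  qed (use assms in auto)
  show "0 \<le> diameter (ladic_interval l u)" using b by (rule diameter_ge_0)
qed

text \<open>
  The intervals of the words of \<open>G\<close> of length at least \<open>N\<close> cover \<open>E\<close> for every \<open>N\<close>, and the sum of their sizes
  is a tail of a convergent series.
\<close>

lemma hausdorff_measure_eq_0:
  fixes G :: "nat list set" and E :: "real set"
  assumes l: "2 \<le> l" and s: "0 < s" and E: "E \<subseteq> {0..<1}"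
    and ev: "\<And>x. x \<in> E \<Longrightarrow> \<exists>n0. \<forall>n\<ge>n0. \<forall>u\<in>words_of_length l n. x \<in> ladic_interval l u \<longrightarrow> u \<in> G"
    and sm: "summable (\<lambda>n. \<Sum>u\<in>words_of_length l n \<inter> G. ((1 / real l) powr s) ^ n)"
  shows "hausdorff_measure s E = 0"
proof -
  define r where "r = (1 / real l) powr s"
  have l0: "0 < l" using l by simp
  have r: "0 \<le> r" by (simp add: r_def)
  have pre: "hausdorff_premeasure s \<delta> E \<le> ennreal e" if "0 < \<delta>" "0 < e" for \<delta> e
  proof -
    have "(\<Sum>u\<in>words_of_length l n \<inter> G. r ^ length u) = (\<Sum>u\<in>words_of_length l n \<inter> G. r ^ n)" for n
      by (intro sum.cong) (auto simp: words_of_length_def)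
    then have sm': "summable (\<lambda>n. \<Sum>u\<in>words_of_length l n \<inter> G. r ^ length u)"
      using sm by (simp add: r_def)
    obtain N where N: "\<And>M. N \<le> M \<Longrightarrow> (\<integral>\<^sup>+u. ennreal (r ^ length u) * indicator {u \<in> G. set u \<subseteq> {..<l} \<and> M \<le> length u} u \<partial>count_space UNIV) \<le> ennreal e"
      using nn_integral_long_words_small[OF zero_le_power[OF r] sm' \<open>0 < e\<close>] by blast
    obtain M0 where M0: "(1 / real l) ^ M0 < \<delta>"
      using real_arch_pow_inv[OF \<open>0 < \<delta>\<close>, of "1 / real l"] l by auto
    define M where "M = max N M0"
    define C where "C = {u \<in> G. set u \<subseteq> {..<l} \<and> M \<le> length u}"
    define U where "U i = (if list_decode i \<in> C then ladic_interval l (list_decode i) else {})" for i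
    have dm: "diameter (U i) \<le> \<delta>" for i
    proof (cases "list_decode i \<in> C")
      case True
      have "diameter (U i) \<le> 1 / real l ^ length (list_decode i)"
        using True diameter_ladic_interval_le(2)[OF l0] by (simp add: U_def)
      also have "\<dots> = (1 / real l) ^ length (list_decode i)" by (simp add: power_one_over)
      also have "\<dots> \<le> (1 / real l) ^ M0"
        using True l by (intro power_decreasing) (auto simp: C_def M_def)
      finally show ?thesis using M0 by simp
    qed (use \<open>0 < \<delta>\<close> in \<open>simp add: U_def\<close>)
    have bd: "bounded (U i)" for i using diameter_ladic_interval_le(1)[OF l0] by (simp add: U_def)
    have cov: "E \<subseteq> (\<Union>i. U i)"
    proof
      fix x assume x: "x \<in> E"
      obtain n0 where n0: "\<forall>n\<ge>n0. \<forall>u\<in>words_of_length l n. x \<in> ladic_interval l u \<longrightarrow> u \<in> G" using ev[OF x] by blast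
      obtain u where u: "u \<in> words_of_length l (max n0 M)" "x \<in> ladic_interval l u"
        using ladic_interval_exists[OF l0 subsetD[OF E x], of "max n0 M"] by blast
      have "u \<in> G" using n0 u by (meson max.cobounded1)
      then have "u \<in> C" using u by (auto simp: C_def words_of_length_def)
      then have "x \<in> U (list_encode u)" using u by (simp add: U_def)
      then show "x \<in> (\<Union>i. U i)" by blast
    qed
    have sz: "hausdorff_size s (U i) \<le> ennreal (r ^ length (list_decode i)) * indicator C (list_decode i)" for i
    proof (cases "list_decode i \<in> C")
      case True
      have "diameter (ladic_interval l (list_decode i)) powr s \<le> (1 / real l ^ length (list_decode i)) powr s"
        using diameter_ladic_interval_le[OF l0] s by (intro powr_mono2) auto
      then show ?thesis using True s by (simp add: hausdorff_size_def U_def r_def powr_inverse_power[OF l0] ennreal_leI)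
    qed (simp add: hausdorff_size_def U_def)
    have "hausdorff_premeasure s \<delta> E \<le> (\<Sum>i. hausdorff_size s (U i))"
      unfolding hausdorff_premeasure_def by (rule INF_lower) (use cov bd dm in auto)
    also have "\<dots> \<le> (\<Sum>i. ennreal (r ^ length (list_decode i)) * indicator C (list_decode i))"
      by (intro suminf_le sz) auto
    also have "\<dots> = (\<integral>\<^sup>+i. ennreal (r ^ length (list_decode i)) * indicator C (list_decode i) \<partial>count_space UNIV)"
      by (rule nn_integral_count_space_nat[symmetric])
    also have "\<dots> = (\<integral>\<^sup>+u. ennreal (r ^ length u) * indicator C u \<partial>count_space UNIV)"
      by (rule nn_integral_bij_count_space[OF bij_list_decode])
    also have "\<dots> \<le> ennreal e" unfolding C_def by (rule N) (simp add: M_def)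
    finally show ?thesis .
  qed
  have "hausdorff_premeasure s \<delta> E \<le> 0" if "0 < \<delta>" for \<delta>
  proof (rule ennreal_le_epsilon)
    fix e :: real assume "0 < e"
    then show "hausdorff_premeasure s \<delta> E \<le> 0 + ennreal e"
      using pre[OF that] by simp
  qed
  then show ?thesis unfolding hausdorff_measure_def
    by (intro antisym SUP_least) auto
qed

lemma l_adic_scale:
  assumes "2 \<le> (l::nat)" "0 < d" "d \<le> 1 / real l ^ N"
  obtains n where "N \<le> n" "d \<le> 1 / real l ^ n" "1 / real l ^ Suc n < d"
proof -
  obtain k where k: "(1 / real l) ^ k < d"
    using real_arch_pow_inv[OF assms(2), of "1 / real l"] assms(1) by auto
  define P where "P k \<longleftrightarrow> (1 / real l) ^ k < d" for k
  have notP: "\<not> P m" if "m \<le> N" for m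
  proof -
    have "(1 / real l) ^ N \<le> (1 / real l) ^ m" using assms(1) that by (intro power_decreasing) auto
    then show ?thesis using assms(3) by (simp add: P_def power_one_over)
  qed
  define m where "m = (LEAST k. P k)"
  have "P m" using k unfolding m_def P_def by (rule LeastI)
  then have "N < m" using notP by (meson not_le)
  then obtain n where n: "m = Suc n" by (cases m) auto
  have "\<not> P n" using not_less_Least[of n P] n unfolding m_def by auto
  then show ?thesis using that[of n] \<open>P m\<close> \<open>N < m\<close> n by (auto simp: P_def power_one_over not_less)
qed

text \<open>
  The mass distribution principle, stated for flows so that no measure has to be constructed. The words of \<open>Bad 0\<close>
  are those that carry too much flow for dimension \<open>s\<close>; the other families encode the conditions that define \<open>E\<close>.
  Suppose that \<open>E\<close> has a cover of small total size. Consider the set of words that consists of the words of each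
  \<open>Bad j\<close> beyond a large length, of the words that meet a set of the cover at the scale of its diameter, and of a long
  prefix of every sequence that ends in the constant digit \<open>l - 1\<close>. Each of the three groups carries at most an
  eighth of the flow, so some path avoids all of them. It has a point in \<open>E\<close> that no set of the cover contains.

  The conclusion speaks of covers instead of the Hausdorff measure, because the same \<open>\<delta>\<close> and \<open>\<kappa>\<close> serve all the
  dimensions below \<open>s\<close>.
\<close>

lemma flow_mass_distribution:
  fixes \<Theta> :: "nat list \<Rightarrow> real" and E :: "real set" and Bad :: "nat \<Rightarrow> nat list set"
  assumes l: "2 \<le> l" and s: "0 < s"
    and nonneg: "\<And>u. 0 \<le> \<Theta> u" and pos: "0 < \<Theta> []"
    and flow: "\<And>u. set u \<subseteq> {..<l} \<Longrightarrow> \<Theta> u = (\<Sum>j<l. \<Theta> (u @ [j]))"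
    and sm: "\<And>j. summable (\<lambda>n. \<Sum>u\<in>words_of_length l n \<inter> Bad j. \<Theta> u)"
    and good: "\<And>u. set u \<subseteq> {..<l} \<Longrightarrow> u \<notin> Bad 0 \<Longrightarrow> \<Theta> u \<le> ((1 / real l) powr s) ^ length u"
    and E: "\<And>x. x \<in> {0..<1} \<Longrightarrow>
       (\<And>j. \<exists>n0. \<forall>n\<ge>n0. \<forall>u\<in>words_of_length l n. x \<in> ladic_interval l u \<longrightarrow> u \<notin> Bad j) \<Longrightarrow> x \<in> E"
  obtains \<delta> \<kappa> where "0 < \<delta>" "\<delta> \<le> 1" "0 < \<kappa>"
    "\<And>U :: nat \<Rightarrow> real set. E \<subseteq> (\<Union>i. U i) \<Longrightarrow> (\<And>i. bounded (U i)) \<Longrightarrow> (\<And>i. diameter (U i) \<le> \<delta>)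
       \<Longrightarrow> ennreal \<kappa> \<le> (\<Sum>i. hausdorff_size s (U i))"
proof -
  define r where "r = (1 / real l) powr s"
  have l0: "0 < l" using l by simp
  have r: "0 < r" "r < 1" using l s powr_less_mono2[of s "1 / real l" 1] by (auto simp: r_def)
  define \<theta> where "\<theta> = \<Theta> []"
  have \<theta>: "0 < \<theta>" using pos by (simp add: \<theta>_def)
  define \<nu> where "\<nu> = density (count_space (UNIV :: nat list set)) (\<lambda>u. ennreal (\<Theta> u))"
  have \<nu>: "emeasure \<nu> A = (\<integral>\<^sup>+u. ennreal (\<Theta> u) * indicator A u \<partial>count_space UNIV)" for A
    unfolding \<nu>_def by (subst emeasure_density) auto
  have sets_\<nu>: "sets \<nu> = UNIV" by (simp add: \<nu>_def)
  have \<nu>_finite: "emeasure \<nu> A = ennreal (sum \<Theta> A)" if "finite A" for A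
  proof -
    have "emeasure \<nu> A = (\<Sum>u\<in>A. ennreal (\<Theta> u) * indicator A u)"
      unfolding \<nu> using that by (subst nn_integral_count_space'[of A]) (auto split: split_indicator)
    then show ?thesis using nonneg by simp
  qed
  have half: "(\<Sum>i. ennreal (c * (1 / 2) ^ Suc i)) = ennreal c" if "0 \<le> c" for c
  proof -
    have "(\<lambda>i. c * (1 / 2) ^ Suc i) sums (c * 1)" by (intro sums_mult power_half_series)
    then show ?thesis using that by (subst suminf_ennreal_eq[of _ c]) auto
  qed
  have UN_le: "emeasure \<nu> (\<Union>i. A i) \<le> ennreal c"
    if "0 \<le> c" "\<And>i. emeasure \<nu> (A i) \<le> ennreal (c * (1 / 2) ^ Suc i)" for A :: "nat \<Rightarrow> nat list set" and c
  proof -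
    have "emeasure \<nu> (\<Union>i. A i) \<le> (\<Sum>i. emeasure \<nu> (A i))"
      by (rule emeasure_subadditive_countably) (simp add: sets_\<nu>)
    also have "\<dots> \<le> (\<Sum>i. ennreal (c * (1 / 2) ^ Suc i))" by (intro suminf_le that) auto
    finally show ?thesis using half[OF that(1)] by simp
  qed
  \<comment> \<open>The \<open>j\<close>-th bad family is cut off where its remaining flow is at most \<open>\<theta> / 8 * (1 / 2) ^ Suc j\<close>.\<close>
  have "\<exists>N. \<forall>M\<ge>N. emeasure \<nu> {u \<in> Bad j. set u \<subseteq> {..<l} \<and> M \<le> length u} \<le> ennreal (\<theta> / 8 * (1 / 2) ^ Suc j)" for j
  proof -
    have e: "0 < \<theta> / 8 * (1 / 2) ^ Suc j" using \<theta> by simp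
    show ?thesis unfolding \<nu>
      by (rule nn_integral_long_words_small[OF nonneg sm[of j] e]) (intro exI allI impI, assumption)
  qed
  then obtain N where N': "\<forall>j. \<forall>M\<ge>N j. emeasure \<nu> {u \<in> Bad j. set u \<subseteq> {..<l} \<and> M \<le> length u} \<le> ennreal (\<theta> / 8 * (1 / 2) ^ Suc j)"
    using choice[of "\<lambda>j N. \<forall>M\<ge>N. emeasure \<nu> {u \<in> Bad j. set u \<subseteq> {..<l} \<and> M \<le> length u} \<le> ennreal (\<theta> / 8 * (1 / 2) ^ Suc j)"] by blast
  have N: "emeasure \<nu> {u \<in> Bad j. set u \<subseteq> {..<l} \<and> M \<le> length u} \<le> ennreal (\<theta> / 8 * (1 / 2) ^ Suc j)" if "N j \<le> M" for j M
    using N' that by blast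
  define Bd where "Bd = (\<Union>j. {u \<in> Bad j. set u \<subseteq> {..<l} \<and> N j \<le> length u})"
  have \<nu>_Bd: "emeasure \<nu> Bd \<le> ennreal (\<theta> / 8)" unfolding Bd_def
  proof (rule UN_le)
    show "emeasure \<nu> {u \<in> Bad j. set u \<subseteq> {..<l} \<and> N j \<le> length u} \<le> ennreal (\<theta> / 8 * (1 / 2) ^ Suc j)" for j
      by (rule N) simp
  qed (use \<theta> in simp)
  have good': "\<Theta> u \<le> r ^ length u" if "set u \<subseteq> {..<l}" "u \<notin> Bd" "N 0 \<le> length u" for u
    using good[of u] that by (auto simp: Bd_def r_def)
  \<comment> \<open>A word \<open>w\<close> followed by many letters \<open>l - 1\<close> is either bad or carries little flow. Excluding one such
    prefix for every \<open>w\<close> keeps the path away from the sequences that have no point in all their intervals.\<close>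
  have tail: "\<exists>k. w @ replicate k (l - 1) \<in> Bd \<or> \<Theta> (w @ replicate k (l - 1)) \<le> e"
    if w: "set w \<subseteq> {..<l}" and "0 < e" for w e
  proof -
    obtain k0 where k0: "r ^ k0 < e" using real_arch_pow_inv[OF \<open>0 < e\<close> r(2)] by blast
    define k where "k = max k0 (N 0)"
    have "r ^ (length w + k) \<le> r ^ k0" using r by (intro power_decreasing) (auto simp: k_def)
    moreover have "\<Theta> (w @ replicate k (l - 1)) \<le> r ^ (length w + k)" if "w @ replicate k (l - 1) \<notin> Bd"
    proof -
      have "set (w @ replicate k (l - 1)) \<subseteq> {..<l}" using w l0 by (auto simp: set_replicate_conv_if)
      moreover have "N 0 \<le> length (w @ replicate k (l - 1))" by (simp add: k_def)
      ultimately show ?thesis using good'[OF _ that] by simp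
    qed
    ultimately show ?thesis using k0 by (intro exI[of _ k]) linarith
  qed
  define P where "P i k \<longleftrightarrow> list_decode i @ replicate k (l - 1) \<in> Bd \<or>
     \<Theta> (list_decode i @ replicate k (l - 1)) \<le> \<theta> / 8 * (1 / 2) ^ Suc i" for i k
  define k where "k i = (SOME k. P i k)" for i
  have k: "list_decode i @ replicate (k i) (l - 1) \<in> Bd \<or>
     \<Theta> (list_decode i @ replicate (k i) (l - 1)) \<le> \<theta> / 8 * (1 / 2) ^ Suc i" if i: "set (list_decode i) \<subseteq> {..<l}" for i
  proof -
    have "0 < \<theta> / 8 * (1 / 2) ^ Suc i" using \<theta> by simp
    from tail[OF i this] have "\<exists>k. P i k" unfolding P_def .
    then have "P i (k i)" unfolding k_def by (rule someI_ex)
    then show ?thesis unfolding P_def .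
  qed
  define t where "t i = list_decode i @ replicate (k i) (l - 1)" for i
  define T where "T = (\<Union>i. if set (list_decode i) \<subseteq> {..<l} \<and> t i \<notin> Bd then {t i} else {})"
  have \<nu>_T: "emeasure \<nu> T \<le> ennreal (\<theta> / 8)" unfolding T_def
  proof (rule UN_le)
    show "emeasure \<nu> (if set (list_decode i) \<subseteq> {..<l} \<and> t i \<notin> Bd then {t i} else {}) \<le> ennreal (\<theta> / 8 * (1 / 2) ^ Suc i)" for i
      using k[of i] \<nu>_finite[of "{t i}"] by (auto simp: t_def intro!: ennreal_leI)
  qed (use \<theta> in auto)
  define K where "K = 3 / r"
  have K: "0 < K" using r by (simp add: K_def)
  define \<kappa> where "\<kappa> = \<theta> / 16 / K"
  have \<kappa>: "0 < \<kappa>" using \<theta> K by (simp add: \<kappa>_def)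
  define \<delta> where "\<delta> = 1 / real l ^ N 0"
  show ?thesis
  proof (rule that[of \<delta> \<kappa>])
    show "0 < \<delta>" "\<delta> \<le> 1" "0 < \<kappa>" using l \<kappa> by (auto simp: \<delta>_def divide_le_eq)
    fix U :: "nat \<Rightarrow> real set"
    assume cov: "E \<subseteq> (\<Union>i. U i)" and bd: "\<And>i. bounded (U i)" and dm: "\<And>i. diameter (U i) \<le> \<delta>"
    show "ennreal \<kappa> \<le> (\<Sum>i. hausdorff_size s (U i))"
    proof (rule ccontr)
      assume "\<not> ?thesis"
      then have lt: "(\<Sum>i. hausdorff_size s (U i)) < ennreal \<kappa>" by simp
      \<comment> \<open>Sets of diameter \<open>0\<close> have no scale of their own and are given a tiny positive one.\<close>
      have "\<exists>d>0. diameter (U i) \<le> d \<and> d \<le> \<delta> \<and> d powr s \<le> diameter (U i) powr s + \<kappa> * (1 / 2) ^ Suc i" for i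
      proof (cases "diameter (U i) = 0")
        case True
        define e where "e = \<kappa> * (1 / 2) ^ Suc i"
        have "0 < e" using \<kappa> by (simp add: e_def)
        define d where "d = min \<delta> (e powr (1 / s))"
        have "d powr s \<le> (e powr (1 / s)) powr s" using s \<open>0 < e\<close> \<open>0 < \<delta>\<close> by (intro powr_mono2) (auto simp: d_def)
        then have "d powr s \<le> e" using s \<open>0 < e\<close> by (simp add: powr_powr)
        then show ?thesis using True s \<open>0 < e\<close> \<open>0 < \<delta>\<close> unfolding e_def[symmetric] by (intro exI[of _ d]) (auto simp: d_def)
      next
        case False
        then have "0 < diameter (U i)" using diameter_ge_0[OF bd[of i]] by simp
        then show ?thesis using dm \<kappa> by (intro exI[of _ "diameter (U i)"]) auto
      qed
      then obtain d where d: "\<And>i. 0 < d i" "\<And>i. diameter (U i) \<le> d i" "\<And>i. d i \<le> \<delta>"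
        "\<And>i. d i powr s \<le> diameter (U i) powr s + \<kappa> * (1 / 2) ^ Suc i" by metis
      have "\<exists>n. N 0 \<le> n \<and> d i \<le> 1 / real l ^ n \<and> 1 / real l ^ Suc n < d i" for i
        using l_adic_scale[OF l d(1)[of i] d(3)[of i, unfolded \<delta>_def]] by metis
      then obtain n where n: "\<And>i. N 0 \<le> n i" "\<And>i. d i \<le> 1 / real l ^ n i" "\<And>i. 1 / real l ^ Suc (n i) < d i"
        by metis
      define Cov where "Cov i = {u \<in> words_of_length l (n i). ladic_interval l u \<inter> U i \<noteq> {}} - Bd" for i
      have \<nu>_Cov: "emeasure \<nu> (Cov i) \<le> ennreal K * (hausdorff_size s (U i) + ennreal (\<kappa> * (1 / 2) ^ Suc i))" for i
      proof (cases "U i = {}")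
        case False
        have fin: "finite (Cov i)" by (simp add: Cov_def)
        have "diameter (U i) \<le> 1 / real l ^ n i" using d(2)[of i] n(2)[of i] by linarith
        then have "card {u \<in> words_of_length l (n i). ladic_interval l u \<inter> U i \<noteq> {}} \<le> 3"
          by (intro card_ladic_intervals_meeting[OF l0 bd])
        then have card: "card (Cov i) \<le> 3"
          unfolding Cov_def by (rule order_trans[OF card_mono, rotated 2]) auto
        have "sum \<Theta> (Cov i) \<le> (\<Sum>u\<in>Cov i. r ^ n i)"
        proof (rule sum_mono)
          fix u assume "u \<in> Cov i"
          then have "set u \<subseteq> {..<l}" "u \<notin> Bd" "length u = n i" by (auto simp: Cov_def words_of_length_def)
          then show "\<Theta> u \<le> r ^ n i" using good'[of u] n(1)[of i] by simp
        qed
        also have "\<dots> = real (card (Cov i)) * r ^ n i" by simp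
        also have "\<dots> \<le> 3 * r ^ n i" using card r by (intro mult_right_mono) auto
        also have "\<dots> = K * r ^ Suc (n i)" using r by (simp add: K_def)
        also have "r ^ Suc (n i) = (1 / real l ^ Suc (n i)) powr s" unfolding r_def powr_inverse_power[OF l0] ..
        also have "K * \<dots> \<le> K * d i powr s" using n(3)[of i] s K by (intro mult_left_mono powr_mono2) auto
        also have "\<dots> \<le> K * (diameter (U i) powr s + \<kappa> * (1 / 2) ^ Suc i)" using d(4)[of i] K by (intro mult_left_mono) auto
        finally have "emeasure \<nu> (Cov i) \<le> ennreal (K * (diameter (U i) powr s + \<kappa> * (1 / 2) ^ Suc i))"
          unfolding \<nu>_finite[OF fin] by (rule ennreal_leI)
        also have "\<dots> = ennreal K * (hausdorff_size s (U i) + ennreal (\<kappa> * (1 / 2) ^ Suc i))"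
          using K \<kappa> s False by (simp add: hausdorff_size_def ennreal_mult ennreal_plus)
        finally show ?thesis .
      qed (simp add: Cov_def)
      have "emeasure \<nu> (\<Union>i. Cov i) \<le> (\<Sum>i. emeasure \<nu> (Cov i))"
        by (rule emeasure_subadditive_countably) (simp add: sets_\<nu>)
      also have "\<dots> \<le> (\<Sum>i. ennreal K * (hausdorff_size s (U i) + ennreal (\<kappa> * (1 / 2) ^ Suc i)))"
        by (intro suminf_le \<nu>_Cov) auto
      also have "\<dots> = ennreal K * (\<Sum>i. hausdorff_size s (U i) + ennreal (\<kappa> * (1 / 2) ^ Suc i))"
        by (rule ennreal_suminf_cmult)
      also have "(\<Sum>i. hausdorff_size s (U i) + ennreal (\<kappa> * (1 / 2) ^ Suc i))
          = (\<Sum>i. hausdorff_size s (U i)) + (\<Sum>i. ennreal (\<kappa> * (1 / 2) ^ Suc i))"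
        by (rule suminf_add[symmetric]) (rule summableI)+
      also have "(\<Sum>i. ennreal (\<kappa> * (1 / 2) ^ Suc i)) = ennreal \<kappa>" by (rule half) (use \<kappa> in simp)
      also have "ennreal K * ((\<Sum>i. hausdorff_size s (U i)) + ennreal \<kappa>) \<le> ennreal K * (ennreal \<kappa> + ennreal \<kappa>)"
        using lt by (intro mult_left_mono add_right_mono) auto
      also have "ennreal \<kappa> + ennreal \<kappa> = ennreal (\<kappa> + \<kappa>)" using \<kappa> by (intro ennreal_plus[symmetric]) auto
      also have "ennreal K * ennreal (\<kappa> + \<kappa>) = ennreal (K * (\<kappa> + \<kappa>))"
        using K \<kappa> by (intro ennreal_mult[symmetric]) auto
      also have "K * (\<kappa> + \<kappa>) = \<theta> / 8" using K by (simp add: \<kappa>_def field_simps)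
      finally have \<nu>_Covs: "emeasure \<nu> (\<Union>i. Cov i) \<le> ennreal (\<theta> / 8)" .
      define C where "C = Bd \<union> (T \<union> (\<Union>i. Cov i))"
      have "emeasure \<nu> C \<le> emeasure \<nu> Bd + emeasure \<nu> (T \<union> (\<Union>i. Cov i))"
        unfolding C_def by (rule emeasure_subadditive) (auto simp: sets_\<nu>)
      also have "\<dots> \<le> emeasure \<nu> Bd + (emeasure \<nu> T + emeasure \<nu> (\<Union>i. Cov i))"
        by (intro add_left_mono emeasure_subadditive) (auto simp: sets_\<nu>)
      also have "\<dots> \<le> ennreal (\<theta> / 8) + (ennreal (\<theta> / 8) + ennreal (\<theta> / 8))"
        by (intro add_mono \<nu>_Bd \<nu>_T \<nu>_Covs)
      also have "ennreal (\<theta> / 8) + (ennreal (\<theta> / 8) + ennreal (\<theta> / 8)) = ennreal (\<theta> / 8 + (\<theta> / 8 + \<theta> / 8))"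
      proof -
        have e8: "0 \<le> \<theta> / 8" using \<theta> by simp
        show ?thesis by (simp only: ennreal_plus[OF e8 e8] ennreal_plus[OF e8 add_nonneg_nonneg[OF e8 e8]])
      qed
      also have "ennreal (\<theta> / 8 + (\<theta> / 8 + \<theta> / 8)) < ennreal \<theta>" by (rule ennreal_lessI) (use \<theta> in auto)
      finally have \<nu>_C: "emeasure \<nu> C < ennreal (\<Theta> [])" unfolding \<theta>_def .
      obtain x where x: "\<And>i. x i < l" "\<And>n. map x [0..<n] \<notin> C"
        using flow_path_avoiding[OF nonneg flow \<nu>_C[unfolded \<nu>]] by blast
      have nontail: "\<exists>i\<ge>n. x i \<noteq> l - 1" for n
      proof (rule ccontr)
        assume no: "\<not> ?thesis"
        define i where "i = list_encode (map x [0..<n])"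
        have di: "list_decode i = map x [0..<n]" by (simp add: i_def)
        have "map x [n..<n + k i] = replicate (k i) (l - 1)"
        proof (rule nth_equalityI)
          fix j assume "j < length (map x [n..<n + k i])"
          then show "map x [n..<n + k i] ! j = replicate (k i) (l - 1) ! j" using no by simp
        qed simp
        then have "map x [0..<n + k i] = t i"
          unfolding t_def di upt_add_eq_append[OF zero_le] map_append by (simp only:)
        then have "t i \<notin> C" using x(2)[of "n + k i"] by simp
        moreover have "set (list_decode i) \<subseteq> {..<l}" unfolding di using x(1) by auto
        moreover have "t i \<in> T" if "t i \<notin> Bd"
          unfolding T_def using that \<open>set (list_decode i) \<subseteq> {..<l}\<close> by (intro UN_I[of i]) simp_all
        ultimately show False unfolding C_def by blast
      qed
      obtain y where y: "\<And>n. y \<in> ladic_interval l (map x [0..<n])"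
        using path_point[OF l0 x(1) nontail] by blast
      have w: "map x [0..<n] \<in> words_of_length l n" for n using x(1) by (auto simp: words_of_length_def)
      have y01: "y \<in> {0..<1}" using y[of 0] by (simp add: ladic_interval_def)
      have "y \<in> E"
      proof (rule E[OF y01])
        fix j
        show "\<exists>n0. \<forall>n\<ge>n0. \<forall>u\<in>words_of_length l n. y \<in> ladic_interval l u \<longrightarrow> u \<notin> Bad j"
        proof (intro exI[of _ "N j"] allI ballI impI)
          fix n u assume n: "N j \<le> n" and u: "u \<in> words_of_length l n" "y \<in> ladic_interval l u"
          have "u = map x [0..<n]" by (rule ladic_interval_unique[OF l0 u(1) w u(2) y])
          then have "u \<notin> Bd" using x(2)[of n] by (simp add: C_def)
          then show "u \<notin> Bad j" using u(1) n by (auto simp: Bd_def words_of_length_def)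
        qed
      qed
      then obtain i where i: "y \<in> U i" using cov by blast
      have "map x [0..<n i] \<in> Cov i \<union> Bd" using w[of "n i"] y[of "n i"] i by (auto simp: Cov_def)
      then show False using x(2)[of "n i"] by (auto simp: C_def)
    qed
  qed
qed

text \<open>
  Sets of diameter at most \<open>1\<close> are at least as large in dimension \<open>t\<close> as in dimension \<open>s\<close>. The guards of
  \<open>hausdorff_size\<close> make this true for \<open>t = 0\<close> too.
\<close>

lemma hausdorff_measure_nonzero:
  fixes E :: "real set"
  assumes "0 \<le> t" "t \<le> s" "0 < s" and \<delta>: "0 < \<delta>" "\<delta> \<le> 1" and \<kappa>: "0 < \<kappa>"
    and le: "\<And>U :: nat \<Rightarrow> real set. E \<subseteq> (\<Union>i. U i) \<Longrightarrow> (\<And>i. bounded (U i)) \<Longrightarrow> (\<And>i. diameter (U i) \<le> \<delta>)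
       \<Longrightarrow> ennreal \<kappa> \<le> (\<Sum>i. hausdorff_size s (U i))"
  shows "hausdorff_measure t E \<noteq> 0"
proof -
  have "ennreal \<kappa> \<le> hausdorff_premeasure t \<delta> E"
    unfolding hausdorff_premeasure_def
  proof (rule INF_greatest)
    fix U :: "nat \<Rightarrow> real set"
    assume U: "U \<in> {U. E \<subseteq> (\<Union>i. U i) \<and> (\<forall>i. bounded (U i) \<and> diameter (U i) \<le> \<delta>)}"
    have "hausdorff_size s (U i) \<le> hausdorff_size t (U i)" for i
    proof -
      have "0 \<le> diameter (U i)" "diameter (U i) \<le> 1"
        using U diameter_ge_0[of "U i"] \<delta> by (auto intro: order_trans)
      then show ?thesis using assms(1-3)
        by (auto simp: hausdorff_size_def intro!: ennreal_leI powr_mono' powr_le1 simp: ennreal_le_1)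
    qed
    then have "(\<Sum>i. hausdorff_size s (U i)) \<le> (\<Sum>i. hausdorff_size t (U i))" by (intro suminf_le) auto
    then show "ennreal \<kappa> \<le> (\<Sum>i. hausdorff_size t (U i))" using le[of U] U by (auto intro: order_trans)
  qed
  also have "\<dots> \<le> hausdorff_measure t E" unfolding hausdorff_measure_def using \<delta> by (intro SUP_upper) auto
  finally show ?thesis using \<kappa> by (auto simp: ennreal_eq_0_iff)
qed

section \<open>The structure function and its Legendre transform\<close>

text \<open>
  The properties of a structure function from which the Legendre transform is computed. Convexity is given by
  tangents because the moments provide tangents directly, by Jensen's inequality.
\<close>

locale smooth_convex =
  fixes t t' :: "real \<Rightarrow> real"
  assumes t_deriv: "\<And>q. (t has_real_derivative t' q) (at q)"
    and t_tangent: "\<And>p q. t q + t' q * (p - q) \<le> t p"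
    and t_0: "0 < t 0"
begin

lemma deriv_t: "deriv t q = t' q"
  using t_deriv by (rule DERIV_imp_deriv)

lemma t'_mono: "p \<le> q \<Longrightarrow> t' p \<le> t' q"
proof -
  assume "p \<le> q"
  have "(t' q - t' p) * (q - p) \<ge> 0"
    using t_tangent[of p q] t_tangent[of q p] by (simp add: algebra_simps)
  then show "t' p \<le> t' q" using \<open>p \<le> q\<close> by (cases "p = q") (auto simp: zero_le_mult_iff)
qed

lemma legendre_at_slope: "legendre t (- t' q) = ereal (t q - q * t' q)"
  unfolding legendre_def
proof (rule antisym)
  show "(INF p. ereal (p * - t' q + t p)) \<le> ereal (t q - q * t' q)"
    by (rule INF_lower2[of q]) auto
  show "ereal (t q - q * t' q) \<le> (INF p. ereal (p * - t' q + t p))"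
    using t_tangent[of q] by (intro INF_greatest) (simp add: algebra_simps)
qed

lemma q_range_iff: "q \<in> q_range t \<longleftrightarrow> 0 < t q - q * t' q"
  by (simp add: q_range_def deriv_t legendre_at_slope)

lemma zero_in_q_range: "0 \<in> q_range t" using t_0 by (simp add: q_range_iff)

lemma q_range_down: "b \<in> q_range t \<Longrightarrow> 0 \<le> a \<Longrightarrow> a \<le> b \<Longrightarrow> a \<in> q_range t"
  using t_tangent[of b a] mult_left_mono[OF t'_mono, of a b a]
  by (auto simp: q_range_iff algebra_simps)

lemma q_range_up: "b \<in> q_range t \<Longrightarrow> a \<le> 0 \<Longrightarrow> b \<le> a \<Longrightarrow> a \<in> q_range t"
  using t_tangent[of b a] mult_left_mono_neg[OF t'_mono, of b a a]
  by (auto simp: q_range_iff algebra_simps)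

text \<open>
  The extended derivative at \<open>q_max\<close> is approached by slopes at points to the left of which every nonnegative
  point is in \<open>q_range\<close>. Its mirror image \<open>above_q_min\<close> follows.
\<close>

lemma below_q_max:
  assumes "- deriv_ext t (q_max t) < ereal \<beta>"
  obtains r where "- \<beta> < t' r" "\<And>p. 0 \<le> p \<Longrightarrow> p < r \<Longrightarrow> p \<in> q_range t"
proof -
  have in_range: "p \<in> q_range t" if "0 \<le> p" "ereal p < q_max t" for p
    using that q_range_down unfolding q_max_def by (auto simp: less_SUP_iff)
  have "0 \<le> q_max t" unfolding q_max_def using zero_in_q_range by (intro SUP_upper2[of 0]) auto
  then consider (fin) r where "q_max t = ereal r" | (inf) "q_max t = \<infinity>" by (cases "q_max t") auto
  then show ?thesis
  proof cases
    case fin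
    then show ?thesis using assms in_range by (intro that[of r]) (auto simp: deriv_ext_def deriv_t)
  next
    case inf
    have "((\<lambda>r. ereal (t' r)) \<longlongrightarrow> (SUP r. ereal (t' r))) at_top"
    proof (rule order_tendstoI)
      fix a assume "a < (SUP r. ereal (t' r))"
      then obtain r where "a < ereal (t' r)" by (auto simp: less_SUP_iff)
      then show "\<forall>\<^sub>F x in at_top. a < ereal (t' x)"
        using t'_mono by (intro eventually_mono[OF eventually_ge_at_top[of r]]) (meson ereal_less_eq(3) less_le_trans)
    next
      fix a assume "(SUP r. ereal (t' r)) < a"
      then show "\<forall>\<^sub>F x in at_top. ereal (t' x) < a" by (intro always_eventually allI) (meson SUP_lessD UNIV_I)
    qed
    then have "deriv_ext t (q_max t) = (SUP r. ereal (t' r))"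
      using inf by (simp add: deriv_ext_def deriv_t tendsto_Lim)
    then have "ereal (- \<beta>) < (SUP r. ereal (t' r))"
      using assms by (metis ereal_uminus_less_reorder uminus_ereal.simps(1))
    then obtain r where "- \<beta> < t' r" by (auto simp: less_SUP_iff)
    then show ?thesis using in_range inf by (intro that[of r]) auto
  qed
qed

lemma above_q_min:
  assumes "ereal \<beta> < - deriv_ext t (q_min t)"
  obtains r where "t' r < - \<beta>" "\<And>p. p \<le> 0 \<Longrightarrow> r < p \<Longrightarrow> p \<in> q_range t"
proof -
  have in_range: "p \<in> q_range t" if "p \<le> 0" "q_min t < ereal p" for p
    using that q_range_up unfolding q_min_def by (auto simp: INF_less_iff)
  have "q_min t \<le> 0" unfolding q_min_def using zero_in_q_range by (intro INF_lower2[of 0]) auto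
  then consider (fin) r where "q_min t = ereal r" | (inf) "q_min t = - \<infinity>" by (cases "q_min t") auto
  then show ?thesis
  proof cases
    case fin
    then show ?thesis using assms in_range by (intro that[of r]) (auto simp: deriv_ext_def deriv_t)
  next
    case inf
    have "((\<lambda>r. ereal (t' r)) \<longlongrightarrow> (INF r. ereal (t' r))) at_bot"
    proof (rule order_tendstoI)
      fix a assume "(INF r. ereal (t' r)) < a"
      then obtain r where "ereal (t' r) < a" by (auto simp: INF_less_iff)
      then show "\<forall>\<^sub>F x in at_bot. ereal (t' x) < a"
        using t'_mono by (intro eventually_mono[OF eventually_le_at_bot[of r]]) (meson ereal_less_eq(3) le_less_trans)
    next
      fix a assume "a < (INF r. ereal (t' r))"
      then show "\<forall>\<^sub>F x in at_bot. a < ereal (t' x)" by (intro always_eventually allI) (meson less_INF_D UNIV_I)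
    qed
    then have "deriv_ext t (q_min t) = (INF r. ereal (t' r))"
      using inf by (simp add: deriv_ext_def deriv_t tendsto_Lim)
    then have "(INF r. ereal (t' r)) < ereal (- \<beta>)"
      using assms by (metis ereal_less_uminus_reorder uminus_ereal.simps(1))
    then obtain r where "t' r < - \<beta>" by (auto simp: INF_less_iff)
    then show ?thesis using in_range inf by (intro that[of r]) auto
  qed
qed

text \<open>
  The function \<open>p * \<beta> + t p\<close> decreases at \<open>r0\<close> and increases at \<open>r1\<close>, so its minimum over the segment is
  attained at an interior point \<open>q\<close>, which therefore has the right slope.
\<close>

lemma slope_attained:
  assumes "- deriv_ext t (q_max t) < ereal \<beta>" "ereal \<beta> < - deriv_ext t (q_min t)"
  obtains q where "t' q = - \<beta>" "q \<in> q_range t" "legendre t \<beta> = ereal (t q + q * \<beta>)"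
proof -
  obtain r1 where r1: "- \<beta> < t' r1" "\<And>p. 0 \<le> p \<Longrightarrow> p < r1 \<Longrightarrow> p \<in> q_range t"
    using below_q_max[OF assms(1)] by blast
  obtain r0 where r0: "t' r0 < - \<beta>" "\<And>p. p \<le> 0 \<Longrightarrow> r0 < p \<Longrightarrow> p \<in> q_range t"
    using above_q_min[OF assms(2)] by blast
  have "r0 < r1" using t'_mono[of r1 r0] r0 r1 by (meson less_trans not_le not_less_iff_gr_or_eq)
  define h where "h p = p * \<beta> + t p" for p
  have dh: "(h has_real_derivative (\<beta> + t' p)) (at p)" for p
    unfolding h_def by (auto intro!: derivative_eq_intros t_deriv)
  have "continuous_on {r0..r1} h" by (meson dh DERIV_isCont continuous_at_imp_continuous_on)
  then obtain q where q: "q \<in> {r0..r1}" "\<And>p. p \<in> {r0..r1} \<Longrightarrow> h q \<le> h p"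
    using continuous_attains_inf[of "{r0..r1}" h] \<open>r0 < r1\<close> by auto
  have "q \<noteq> r0"
  proof
    assume "q = r0"
    obtain d where d: "d > 0" "\<And>e. 0 < e \<Longrightarrow> e < d \<Longrightarrow> h (r0 + e) < h r0"
      using DERIV_neg_dec_right[OF dh, of r0] r0 by auto
    then have "h (r0 + min (d / 2) (r1 - r0)) < h r0" using \<open>r0 < r1\<close> by auto
    moreover have "h q \<le> h (r0 + min (d / 2) (r1 - r0))" using \<open>r0 < r1\<close> d by (intro q) auto
    ultimately show False using \<open>q = r0\<close> by simp
  qed
  moreover have "q \<noteq> r1"
  proof
    assume "q = r1"
    obtain d where d: "d > 0" "\<And>e. 0 < e \<Longrightarrow> e < d \<Longrightarrow> h (r1 - e) < h r1"
      using DERIV_pos_inc_left[OF dh, of r1] r1 by auto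
    then have "h (r1 - min (d / 2) (r1 - r0)) < h r1" using \<open>r0 < r1\<close> by auto
    moreover have "h q \<le> h (r1 - min (d / 2) (r1 - r0))" using \<open>r0 < r1\<close> d by (intro q) auto
    ultimately show False using \<open>q = r1\<close> by simp
  qed
  ultimately have q': "r0 < q" "q < r1" using q(1) by auto
  have "\<beta> + t' q = 0"
  proof (rule DERIV_local_min[OF dh, of "min (q - r0) (r1 - q)"])
    show "0 < min (q - r0) (r1 - q)" using q' by simp
    show "\<forall>y. \<bar>q - y\<bar> < min (q - r0) (r1 - q) \<longrightarrow> h q \<le> h y"
    proof (intro allI impI)
      fix y assume "\<bar>q - y\<bar> < min (q - r0) (r1 - q)"
      then have "r0 \<le> y" "y \<le> r1" by linarith+
      then show "h q \<le> h y" by (intro q(2)) simp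
    qed
  qed
  then have slope: "t' q = - \<beta>" by simp
  have "q \<in> q_range t" using q' r0(2)[of q] r1(2)[of q] by (cases "0 \<le> q") auto
  moreover have "legendre t \<beta> = ereal (t q + q * \<beta>)" using legendre_at_slope[of q] slope by simp
  ultimately show ?thesis using that slope by blast
qed

text \<open>
  The quotient \<open>t p / p\<close> has derivative \<open>- (t p - p * t' p) / p\<^sup>2\<close>, which is negative on the positive part of
  \<open>q_range\<close>, and it vanishes at \<open>1\<close>.
\<close>

lemma negative_beyond_1:
  assumes "t 1 = 0" "q \<in> q_range t" "1 < p" "p \<le> q"
  shows "t p < 0"
proof -
  have "t p / p < t 1 / 1"
  proof (rule DERIV_neg_imp_decreasing[OF assms(3)])
    fix x :: real assume x: "1 \<le> x" "x \<le> p"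
    have "x \<in> q_range t" using q_range_down[OF assms(2), of x] x assms(4) by simp
    then have "(t' x * x - t x * 1) / (x * x) < 0" using x by (auto simp: q_range_iff divide_less_0_iff mult.commute)
    moreover have "((\<lambda>x. t x / x) has_real_derivative (t' x * x - t x * 1) / (x * x)) (at x)"
      using x by (intro DERIV_divide t_deriv DERIV_ident) auto
    ultimately show "\<exists>y. ((\<lambda>x. t x / x) has_real_derivative y) (at x) \<and> y < 0" by blast
  qed
  then show ?thesis using assms by (simp add: divide_less_0_iff)
qed

end

section \<open>Moments as a function of the exponent\<close>

locale moments = prob_space M for M :: "'a measure" +
  fixes X :: "'a \<Rightarrow> real"
  assumes X_meas [measurable]: "X \<in> borel_measurable M"
    and X_pos: "\<And>\<omega>. 0 < X \<omega>"
    and X_int: "\<And>q. integrable M (\<lambda>\<omega>. X \<omega> powr q)"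
begin

definition mom :: "real \<Rightarrow> real" where "mom q = expectation (\<lambda>\<omega>. X \<omega> powr q)"

lemma mom_pos: "0 < mom q"
proof -
  have "mom q \<noteq> 0"
  proof
    assume "mom q = 0"
    then have "AE \<omega> in M. X \<omega> powr q = 0"
      unfolding mom_def using X_int by (subst (asm) integral_nonneg_eq_0_iff_AE) auto
    then have "AE \<omega> in M. False" using X_pos by (auto elim!: eventually_mono simp: less_le)
    then show False by simp
  qed
  moreover have "0 \<le> mom q" unfolding mom_def by (intro integral_nonneg_AE) auto
  ultimately show ?thesis by simp
qed

lemma mom_0: "mom 0 = 1"
proof -
  have "X \<omega> powr 0 = 1" for \<omega> using X_pos[of \<omega>] by simp
  then show ?thesis by (simp add: mom_def prob_space)
qed

lemma abs_ln_le: "0 < x \<Longrightarrow> \<bar>ln x\<bar> \<le> x + 1 / (x::real)"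
proof -
  assume x: "0 < x"
  have "ln x \<le> x" using x ln_less_self less_imp_le by blast
  moreover have "ln (1 / x) \<le> 1 / x" by (rule less_imp_le, rule ln_less_self) (use x in simp)
  moreover have "0 < 1 / x" "ln (1 / x) = - ln x" using x by (simp_all add: ln_div)
  ultimately show ?thesis using x by linarith
qed

lemma exp_abs_ln_le: "0 < x \<Longrightarrow> exp \<bar>ln x\<bar> \<le> x + 1 / (x::real)"
  by (cases "0 \<le> ln x") (auto simp: exp_minus field_simps)

lemma abs_exp_minus_1_le: "\<bar>exp z - 1\<bar> \<le> \<bar>z\<bar> * exp \<bar>z\<bar>" for z :: real
proof (cases "0 \<le> z")
  case True
  have "(1 - z) * exp z \<le> exp (- z) * exp z" using exp_ge_add_one_self[of "- z"] by (intro mult_right_mono) auto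
  then have "exp z - 1 \<le> z * exp z" by (simp add: exp_minus algebra_simps)
  then show ?thesis using True by simp
next
  case False
  have "1 + z \<le> exp z" by simp
  then have "1 - exp z \<le> - z" by linarith
  also have "- z \<le> - z * exp (- z)" using False by (simp add: mult_le_cancel_left1)
  finally show ?thesis using False by simp
qed

text \<open>
  The dominating function is independent of \<open>h\<close> because \<open>\<bar>ln x\<bar>\<close> and \<open>exp \<bar>ln x\<bar>\<close> are both at most \<open>x + 1 / x\<close>.
\<close>

lemma powr_difference_bound:
  fixes x h q :: real
  assumes "0 < x" "\<bar>h\<bar> \<le> 1" "h \<noteq> 0"
  shows "\<bar>(x powr (q + h) - x powr q) / h\<bar> \<le> x powr (q + 2) + 2 * x powr q + x powr (q - 2)"
proof -
  have e: "x powr (q + h) - x powr q = x powr q * (exp (h * ln x) - 1)"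
    using assms by (simp add: powr_add powr_def[of x h] algebra_simps)
  have "\<bar>exp (h * ln x) - 1\<bar> \<le> \<bar>h * ln x\<bar> * exp \<bar>h * ln x\<bar>" by (rule abs_exp_minus_1_le)
  also have "\<dots> \<le> \<bar>h * ln x\<bar> * exp \<bar>ln x\<bar>"
    using assms(2) by (intro mult_left_mono) (auto simp: abs_mult mult_left_le_one_le)
  also have "\<dots> \<le> (\<bar>h\<bar> * (x + 1 / x)) * (x + 1 / x)"
    using abs_ln_le[OF assms(1)] exp_abs_ln_le[OF assms(1)] assms(1)
    by (intro mult_mono) (auto simp: abs_mult intro!: mult_left_mono)
  finally have "\<bar>x powr (q + h) - x powr q\<bar> \<le> x powr q * (\<bar>h\<bar> * (x + 1 / x) * (x + 1 / x))"
    unfolding e by (simp add: abs_mult mult_left_mono)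
  then have "\<bar>(x powr (q + h) - x powr q) / h\<bar> \<le> x powr q * ((x + 1 / x) * (x + 1 / x))"
    using assms(3) by (simp add: divide_le_eq mult_ac)
  also have "\<dots> = x powr q * (x\<^sup>2 + 2 + 1 / x\<^sup>2)"
    using assms(1) by (simp add: field_simps power2_eq_square)
  also have "\<dots> = x powr (q + 2) + 2 * x powr q + x powr (q - 2)"
    using assms(1) by (simp add: powr_add powr_diff algebra_simps)
  finally show ?thesis .
qed

lemma mom_deriv_aux:
  shows mom_ln_integrable: "integrable M (\<lambda>\<omega>. X \<omega> powr q * ln (X \<omega>))"
    and mom_deriv: "(mom has_real_derivative expectation (\<lambda>\<omega>. X \<omega> powr q * ln (X \<omega>))) (at q)"
proof -
  let ?b = "\<lambda>\<omega>. X \<omega> powr (q + 2) + 2 * X \<omega> powr q + X \<omega> powr (q - 2)"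
  have b: "integrable M ?b" using X_int by auto
  have lim: "integrable M (\<lambda>\<omega>. X \<omega> powr q * ln (X \<omega>)) \<and>
     (\<lambda>i. (mom (q + h i) - mom q) / h i) \<longlonglongrightarrow> expectation (\<lambda>\<omega>. X \<omega> powr q * ln (X \<omega>))"
    if h: "h \<longlonglongrightarrow> 0" "\<And>i. h i \<noteq> 0" "\<And>i. \<bar>h i\<bar> \<le> 1" for h :: "nat \<Rightarrow> real"
  proof -
    let ?s = "\<lambda>i \<omega>. (X \<omega> powr (q + h i) - X \<omega> powr q) / h i"
    have s: "expectation (?s i) = (mom (q + h i) - mom q) / h i" for i
      unfolding mom_def using X_int by (simp add: Bochner_Integration.integral_diff)
    have lim: "AE \<omega> in M. (\<lambda>i. ?s i \<omega>) \<longlonglongrightarrow> X \<omega> powr q * ln (X \<omega>)"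
    proof (rule AE_I2)
      fix \<omega>
      have "((\<lambda>p. X \<omega> powr p) has_real_derivative X \<omega> powr q * ln (X \<omega>)) (at q)"
        using X_pos[of \<omega>] by (auto intro!: derivative_eq_intros simp: mult.commute)
      then have "((\<lambda>h. (X \<omega> powr (q + h) - X \<omega> powr q) / h) \<longlongrightarrow> X \<omega> powr q * ln (X \<omega>)) (at 0)"
        by (simp add: DERIV_def)
      then show "(\<lambda>i. ?s i \<omega>) \<longlonglongrightarrow> X \<omega> powr q * ln (X \<omega>)"
        using h(1,2) unfolding tendsto_at_iff_sequentially by (auto simp: o_def)
    qed
    have bound: "AE \<omega> in M. norm (?s i \<omega>) \<le> ?b \<omega>" for i
      using powr_difference_bound[OF X_pos h(3) h(2)] by auto
    have "integrable M (\<lambda>\<omega>. X \<omega> powr q * ln (X \<omega>))"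
      by (rule integrable_dominated_convergence[OF _ _ b lim bound]) measurable
    moreover have "(\<lambda>i. expectation (?s i)) \<longlonglongrightarrow> expectation (\<lambda>\<omega>. X \<omega> powr q * ln (X \<omega>))"
      by (rule integral_dominated_convergence[OF _ _ b lim bound]) measurable
    ultimately show ?thesis unfolding s by simp
  qed
  show int: "integrable M (\<lambda>\<omega>. X \<omega> powr q * ln (X \<omega>))"
    by (rule conjunct1[OF lim[of "\<lambda>i. 1 / real (Suc i)"]]) (use LIMSEQ_Suc[OF lim_1_over_n] in \<open>auto simp: divide_le_eq\<close>)
  have "((\<lambda>h. (mom (q + h) - mom q) / h) \<longlongrightarrow> expectation (\<lambda>\<omega>. X \<omega> powr q * ln (X \<omega>))) (at 0)"
    unfolding tendsto_at_iff_sequentially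
  proof (intro allI impI)
    fix h :: "nat \<Rightarrow> real" assume h: "\<forall>i. h i \<in> UNIV - {0}" "h \<longlonglongrightarrow> 0"
    then obtain N where N: "\<And>i. i \<ge> N \<Longrightarrow> \<bar>h i\<bar> < 1" using LIMSEQ_D[OF h(2), of 1] by auto
    have "(\<lambda>i. (mom (q + h (i + N)) - mom q) / h (i + N)) \<longlonglongrightarrow> expectation (\<lambda>\<omega>. X \<omega> powr q * ln (X \<omega>))"
      by (rule conjunct2[OF lim[of "\<lambda>i. h (i + N)"]]) (use h N in \<open>auto intro: LIMSEQ_ignore_initial_segment less_imp_le\<close>)
    then show "((\<lambda>h. (mom (q + h) - mom q) / h) \<circ> h) \<longlonglongrightarrow> expectation (\<lambda>\<omega>. X \<omega> powr q * ln (X \<omega>))"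
      unfolding o_def by (rule LIMSEQ_offset)
  qed
  then show "(mom has_real_derivative expectation (\<lambda>\<omega>. X \<omega> powr q * ln (X \<omega>))) (at q)"
    by (simp add: DERIV_def)
qed

text \<open>
  Jensen's inequality for the law with density \<open>X powr q / mom q\<close>: integrate
  \<open>exp z \<ge> exp c * (1 + z - c)\<close> at \<open>z = (p - q) * ln X\<close>, with \<open>c\<close> the mean of \<open>z\<close>.
\<close>

lemma ln_mom_tangent:
  defines "\<mu> \<equiv> \<lambda>q. expectation (\<lambda>\<omega>. X \<omega> powr q * ln (X \<omega>)) / mom q"
  shows "ln (mom q) + \<mu> q * (p - q) \<le> ln (mom p)"
proof -
  define c where "c = (p - q) * \<mu> q"
  let ?g = "\<lambda>\<omega>. exp c * ((1 - c) * X \<omega> powr q + (p - q) * (X \<omega> powr q * ln (X \<omega>)))"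
  have "?g \<omega> \<le> X \<omega> powr p" for \<omega>
  proof -
    have "exp c * (1 + ((p - q) * ln (X \<omega>) - c)) \<le> exp c * exp ((p - q) * ln (X \<omega>) - c)"
      by (intro mult_left_mono exp_ge_add_one_self) auto
    also have "\<dots> = X \<omega> powr (p - q)" using X_pos[of \<omega>] by (simp add: powr_def exp_add[symmetric])
    finally have "X \<omega> powr q * (exp c * (1 + ((p - q) * ln (X \<omega>) - c))) \<le> X \<omega> powr q * X \<omega> powr (p - q)"
      by (intro mult_left_mono) auto
    then show ?thesis using X_pos[of \<omega>] by (simp add: powr_diff algebra_simps)
  qed
  then have "expectation ?g \<le> mom p"
    unfolding mom_def using X_int mom_ln_integrable by (intro integral_mono) auto
  moreover have "expectation ?g = exp c * ((1 - c) * mom q + (p - q) * (\<mu> q * mom q))"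
    using X_int mom_ln_integrable mom_pos[of q] by (simp add: mom_def \<mu>_def)
  ultimately have "exp c * mom q \<le> mom p" by (simp add: c_def algebra_simps)
  then have "ln (exp c * mom q) \<le> ln (mom p)" using mom_pos[of q] by (subst ln_le_cancel_iff) (auto simp: mom_pos)
  then show ?thesis using mom_pos[of q] by (simp add: ln_mult c_def mult.commute)
qed

lemma structure_function_smooth_convex:
  assumes "2 \<le> l"
  shows "\<exists>t'. smooth_convex (structure_function M l X) t'"
proof -
  define L where "L = ln (real l)"
  have L: "0 < L" using assms by (simp add: L_def)
  define \<mu> where "\<mu> q = expectation (\<lambda>\<omega>. X \<omega> powr q * ln (X \<omega>)) / mom q" for q
  have sf: "structure_function M l X q = ln (mom q) / L - (q - 1)" for q
    by (simp add: structure_function_def log_def L_def mom_def)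
  have "smooth_convex (structure_function M l X) (\<lambda>q. \<mu> q / L - 1)"
  proof
    fix q
    have "((\<lambda>q. ln (mom q) / L - (q - 1)) has_real_derivative (\<mu> q / L - 1)) (at q)"
      using L mom_pos[of q] by (auto intro!: derivative_eq_intros mom_deriv simp: \<mu>_def)
    then show "(structure_function M l X has_real_derivative (\<mu> q / L - 1)) (at q)"
      by (subst has_field_derivative_cong_ev[where g="\<lambda>q. ln (mom q) / L - (q - 1)" and y=q and S=UNIV]) (auto simp: sf)
  next
    fix p q
    have "(ln (mom q) + \<mu> q * (p - q)) / L \<le> ln (mom p) / L"
      using ln_mom_tangent[of q p] L by (intro divide_right_mono) (auto simp: \<mu>_def)
    then show "structure_function M l X q + (\<mu> q / L - 1) * (p - q) \<le> structure_function M l X p"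
      by (simp add: sf add_divide_distrib left_diff_distrib)
  next
    show "0 < structure_function M l X 0" by (simp add: sf mom_0)
  qed
  then show ?thesis by blast
qed

end

section \<open>Cascades of positive weights\<close>

text \<open>
  The weights are positive everywhere, not just almost surely, so that real powers of them behave well.
\<close>

locale cascade_weights = prob_space M for M :: "'a measure" +
  fixes l :: nat and X :: "nat list \<Rightarrow> 'a \<Rightarrow> real"
  assumes l_ge_2: "2 \<le> l"
    and X_meas [measurable]: "\<And>u. X u \<in> borel_measurable M"
    and X_pos: "\<And>u \<omega>. 0 < X u \<omega>"
    and X_indep: "indep_vars (\<lambda>_. borel) X (words l)"
    and X_dist: "\<And>u v. u \<in> words l \<Longrightarrow> v \<in> words l \<Longrightarrow> distr M borel (X u) = distr M borel (X v)"
    and X_int: "\<And>u q. u \<in> words l \<Longrightarrow> integrable M (\<lambda>\<omega>. X u \<omega> powr q)"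
begin

lemma l_pos: "0 < l" using l_ge_2 by simp

text \<open>
  Words over the alphabet, the empty one included, in contrast to \<open>words l\<close>.
\<close>

definition is_word :: "nat list \<Rightarrow> bool" where "is_word u \<longleftrightarrow> set u \<subseteq> {..<l}"

lemma is_word_Nil [simp]: "is_word []" and is_word_snoc [simp]: "is_word (u @ [j]) \<longleftrightarrow> is_word u \<and> j < l"
  by (auto simp: is_word_def)

lemma words_iff: "u \<in> words l \<longleftrightarrow> u \<noteq> [] \<and> is_word u"
proof
  assume "u \<noteq> [] \<and> is_word u"
  then have "u \<in> words_of_length l (length u)" "1 \<le> length u"
    by (auto simp: words_of_length_def is_word_def Suc_le_eq)
  then show "u \<in> words l" unfolding words_def by blast
qed (auto simp: words_def words_of_length_def is_word_def)

lemma snoc_word: "is_word u \<Longrightarrow> j < l \<Longrightarrow> u @ [j] \<in> words l" by (simp add: words_iff)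

lemma zero_word: "[0] \<in> words l" using l_pos by (auto simp: words_iff is_word_def)

sublocale root: moments M "X [0]"
  by unfold_locales (use X_pos X_int[OF zero_word] in auto)

abbreviation mom :: "real \<Rightarrow> real" where "mom \<equiv> root.mom"

lemmas mom_def = root.mom_def and mom_pos = root.mom_pos

lemma nn_mom:
  assumes "u \<in> words l"
  shows "(\<integral>\<^sup>+\<omega>. ennreal (X u \<omega> powr q) \<partial>M) = ennreal (mom q)"
proof -
  have "(\<integral>\<^sup>+\<omega>. ennreal (X u \<omega> powr q) \<partial>M) = (\<integral>\<^sup>+x. ennreal (x powr q) \<partial>distr M borel (X u))"
    by (subst nn_integral_distr) auto
  also have "\<dots> = (\<integral>\<^sup>+x. ennreal (x powr q) \<partial>distr M borel (X [0]))"
    using X_dist[OF assms zero_word] by simp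
  also have "\<dots> = (\<integral>\<^sup>+\<omega>. ennreal (X [0] \<omega> powr q) \<partial>M)"
    by (subst nn_integral_distr) auto
  also have "\<dots> = ennreal (mom q)"
    unfolding mom_def by (intro nn_integral_eq_integral X_int zero_word) auto
  finally show ?thesis .
qed

text \<open>
  The constant that makes the weights \<open>X powr q / c q\<close> of the children of a vertex sum to \<open>1\<close> on average.
\<close>

definition c :: "real \<Rightarrow> real" where "c q = real l * mom q"

lemma c_pos: "0 < c q" using mom_pos[of q] l_pos by (simp add: c_def)

section \<open>Independence of disjoint sets of weights\<close>

text \<open>
  Measurability with respect to \<open>F A\<close> expresses that a quantity depends only on the weights in \<open>A\<close>; quantities
  that depend on disjoint sets of weights are independent.
\<close>

definition F :: "nat list set \<Rightarrow> 'a measure" where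
  "F A = sigma (space M) (\<Union>u\<in>A \<inter> words l. {X u -` S \<inter> space M |S. S \<in> sets borel})"

lemma space_F [simp]: "space (F A) = space M" by (simp add: F_def space_measure_of_conv)

lemma sets_F: "sets (F A) = sigma_sets (space M) (\<Union>u\<in>A \<inter> words l. {X u -` S \<inter> space M |S. S \<in> sets borel})"
  unfolding F_def by (rule sets_measure_of) auto

lemma X_F: "u \<in> A \<Longrightarrow> u \<in> words l \<Longrightarrow> X u \<in> borel_measurable (F A)"
  by (rule measurableI) (auto simp: sets_F intro!: sigma_sets.Basic)

lemma sets_F_mono: "A \<subseteq> B \<Longrightarrow> sets (F A) \<subseteq> sets (F B)"
  unfolding sets_F by (intro sigma_sets_mono') auto

lemma F_mono:
  assumes "f \<in> measurable (F A) N" "A \<subseteq> B"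
  shows "f \<in> measurable (F B) N"
  using assms(1) sets_F_mono[OF assms(2)] by (auto simp: measurable_def)

lemma sets_F_M: "sets (F A) \<subseteq> sets M"
  unfolding sets_F by (intro sets.sigma_sets_subset) (auto intro!: measurable_sets)

lemma F_M:
  assumes "f \<in> measurable (F A) N"
  shows "f \<in> measurable M N"
  using assms sets_F_M[of A] by (auto simp: measurable_def)

lemma F_indep_set:
  assumes "A \<inter> B = {}"
  shows "indep_set (sets (F A)) (sets (F B))"
proof -
  let ?E = "\<lambda>u. {X u -` S \<inter> space M |S. S \<in> sets borel}"
  let ?I = "case_bool (A \<inter> words l) (B \<inter> words l)"
  have "indep_sets ?E (words l)" using X_indep by (simp add: indep_vars_def2)
  then have "indep_sets ?E (\<Union>j. ?I j)" by (rule indep_sets_mono_index[rotated]) (auto split: bool.splits)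
  moreover have "Int_stable (?E u)" for u
  proof (rule Int_stableI)
    fix a b assume "a \<in> ?E u" "b \<in> ?E u"
    then obtain S T where "a = X u -` S \<inter> space M" "S \<in> sets borel" "b = X u -` T \<inter> space M" "T \<in> sets borel" by auto
    then have "a \<inter> b = X u -` (S \<inter> T) \<inter> space M" "S \<inter> T \<in> sets borel" by auto
    then show "a \<inter> b \<in> ?E u" by blast
  qed
  moreover have "disjoint_family ?I" using assms by (auto simp: disjoint_family_on_def split: bool.splits)
  ultimately have "indep_sets (\<lambda>j. sigma_sets (space M) (\<Union>u\<in>?I j. ?E u)) UNIV"
    by (intro indep_sets_collect_sigma) auto
  also have "(\<lambda>j. sigma_sets (space M) (\<Union>u\<in>?I j. ?E u)) = case_bool (sets (F A)) (sets (F B))"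
    by (auto simp: sets_F fun_eq_iff split: bool.splits)
  finally show ?thesis by (simp add: indep_set_def)
qed

lemma F_indep_var:
  assumes AB: "A \<inter> B = {}" and f: "f \<in> measurable (F A) N" and g: "g \<in> measurable (F B) N'"
  shows "indep_var N f N' g"
  unfolding indep_var_eq
proof (intro conjI F_M[OF f] F_M[OF g])
  have "sigma_sets (space M) {f -` S \<inter> space M |S. S \<in> sets N} \<subseteq> sets (F A)"
    using sets.sigma_sets_subset[of "{f -` S \<inter> space M |S. S \<in> sets N}" "F A"] measurable_sets[OF f] by auto
  moreover have "sigma_sets (space M) {g -` S \<inter> space M |S. S \<in> sets N'} \<subseteq> sets (F B)"
    using sets.sigma_sets_subset[of "{g -` S \<inter> space M |S. S \<in> sets N'}" "F B"] measurable_sets[OF g] by auto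
  ultimately show "indep_set (sigma_sets (space M) {f -` S \<inter> space M |S. S \<in> sets N})
     (sigma_sets (space M) {g -` S \<inter> space M |S. S \<in> sets N'})"
    using F_indep_set[OF AB] unfolding indep_set_def
    by (rule_tac indep_sets_mono_sets) (auto split: bool.splits)
qed

lemma nn_indep:
  fixes f g :: "'a \<Rightarrow> ennreal"
  assumes "A \<inter> B = {}" "f \<in> borel_measurable (F A)" "g \<in> borel_measurable (F B)"
  shows "(\<integral>\<^sup>+\<omega>. f \<omega> * g \<omega> \<partial>M) = (\<integral>\<^sup>+\<omega>. f \<omega> \<partial>M) * (\<integral>\<^sup>+\<omega>. g \<omega> \<partial>M)"
proof -
  have "indep_var borel f borel g" by (rule F_indep_var[OF assms])
  moreover have "case_bool borel borel = (\<lambda>_. borel :: ennreal measure)" by (auto simp: fun_eq_iff split: bool.splits)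
  ultimately have "indep_vars (\<lambda>_. borel) (case_bool f g) UNIV"
    unfolding indep_var_def by (simp only:)
  from indep_vars_nn_integral[OF _ this] show ?thesis by (simp add: UNIV_bool mult.commute)
qed

section \<open>Masses of subtrees at finite depth\<close>

text \<open>
  The weights that enter the masses below \<open>u\<close> sit at the proper extensions of \<open>u\<close>; together with the weight at \<open>u\<close>
  itself they form the branch of \<open>u\<close>.
\<close>

definition below :: "nat list \<Rightarrow> nat list set" where "below u = {w. strict_prefix u w}"
definition branch :: "nat list \<Rightarrow> nat list set" where "branch u = {w. prefix u w}"

lemma branch_disjoint: "i \<noteq> j \<Longrightarrow> branch (u @ [i]) \<inter> branch (u @ [j]) = {}"
  by (auto simp: branch_def prefix_def)

lemma below_subset_branch: "below u \<subseteq> branch u" by (auto simp: below_def branch_def)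

lemma branch_subset_below: "branch (u @ [j]) \<subseteq> below u"
  by (auto simp: below_def branch_def strict_prefix_def prefix_def)

lemma self_branch: "u \<in> branch u" by (simp add: branch_def)

lemma self_not_below: "u \<notin> below u" by (simp add: below_def)

text \<open>
  The total mass at depth \<open>k\<close> of the subtree rooted at \<open>u\<close>, for the cascade with the normalised weights
  \<open>X powr q / c q\<close>. If the weights have mean \<open>1\<close>, then \<open>q = 1\<close> gives the original cascade.
\<close>

primrec Y :: "real \<Rightarrow> nat \<Rightarrow> nat list \<Rightarrow> 'a \<Rightarrow> real" where
  "Y q 0 u \<omega> = 1"
| "Y q (Suc k) u \<omega> = (\<Sum>j<l. X (u @ [j]) \<omega> powr q * Y q k (u @ [j]) \<omega>) / c q"

lemma Y_meas [measurable]: "Y q k u \<in> borel_measurable M"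
proof (induction k arbitrary: u)
  case (Suc k)
  note Suc[measurable]
  show ?case unfolding Y.simps by measurable
next
  case 0
  have "Y q 0 u = (\<lambda>_. 1)" by (simp add: fun_eq_iff)
  then show ?case by simp
qed

lemma Y_F: "is_word u \<Longrightarrow> Y q k u \<in> borel_measurable (F (below u))"
proof (induction k arbitrary: u)
  case (Suc k)
  have "X (u @ [j]) \<in> borel_measurable (F (below u))" if "j < l" for j
    by (rule X_F) (use that Suc.prems branch_subset_below[of u j] self_branch[of "u @ [j]"] in \<open>auto intro: snoc_word\<close>)
  moreover have "Y q k (u @ [j]) \<in> borel_measurable (F (below u))" if "j < l" for j
    by (rule F_mono[OF Suc.IH]) (use that Suc.prems branch_subset_below[of u j] below_subset_branch[of "u @ [j]"] in auto)
  ultimately show ?case unfolding Y.simps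
    by (intro borel_measurable_divide borel_measurable_sum borel_measurable_times powr_real_measurable) auto
next
  case 0
  have "Y q 0 u = (\<lambda>_. 1)" by (simp add: fun_eq_iff)
  then show ?case by simp
qed

lemma Y_branch: "is_word u \<Longrightarrow> Y q k u \<in> borel_measurable (F (branch u))"
  by (rule F_mono[OF Y_F below_subset_branch])

lemma Y_pos: "0 < Y q k u \<omega>"
proof (induction k arbitrary: u)
  case (Suc k)
  have "0 < (\<Sum>j<l. X (u @ [j]) \<omega> powr q * Y q k (u @ [j]) \<omega>)"
    using l_pos by (intro sum_pos mult_pos_pos Suc) (use X_pos in \<open>auto simp: less_imp_neq[symmetric]\<close>)
  then show ?case using c_pos by simp
qed simp

definition child :: "real \<Rightarrow> nat \<Rightarrow> nat list \<Rightarrow> nat \<Rightarrow> 'a \<Rightarrow> real" where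
  "child q k u j \<omega> = X (u @ [j]) \<omega> powr q * Y q k (u @ [j]) \<omega>"

lemma Y_Suc: "Y q (Suc k) u \<omega> = (\<Sum>j<l. child q k u j \<omega>) / c q"
  by (simp add: child_def)

lemma child_pos: "0 < child q k u j \<omega>"
  unfolding child_def by (intro mult_pos_pos Y_pos) (use X_pos[of "u @ [j]" \<omega>] in simp)

lemma child_meas [measurable]: "child q k u j \<in> borel_measurable M"
  unfolding child_def by measurable

lemma child_branch:
  assumes "is_word u" "j < l"
  shows "child q k u j \<in> borel_measurable (F (branch (u @ [j])))"
  unfolding child_def using assms
  by (intro borel_measurable_times powr_real_measurable X_F Y_branch self_branch snoc_word) auto

lemma nn_child:
  assumes "is_word u" "j < l"
  shows "(\<integral>\<^sup>+\<omega>. ennreal (child q k u j \<omega> powr p) \<partial>M)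
     = ennreal (mom (q * p)) * (\<integral>\<^sup>+\<omega>. ennreal (Y q k (u @ [j]) \<omega> powr p) \<partial>M)"
proof -
  have "ennreal (child q k u j \<omega> powr p) = ennreal (X (u @ [j]) \<omega> powr (q * p)) * ennreal (Y q k (u @ [j]) \<omega> powr p)" for \<omega>
    using X_pos[of "u @ [j]" \<omega>] Y_pos[of q k "u @ [j]" \<omega>]
    by (simp add: child_def powr_mult powr_powr ennreal_mult)
  then have "(\<integral>\<^sup>+\<omega>. ennreal (child q k u j \<omega> powr p) \<partial>M)
     = (\<integral>\<^sup>+\<omega>. ennreal (X (u @ [j]) \<omega> powr (q * p)) * ennreal (Y q k (u @ [j]) \<omega> powr p) \<partial>M)" by simp
  also have "\<dots> = (\<integral>\<^sup>+\<omega>. ennreal (X (u @ [j]) \<omega> powr (q * p)) \<partial>M) * (\<integral>\<^sup>+\<omega>. ennreal (Y q k (u @ [j]) \<omega> powr p) \<partial>M)"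
  proof (rule nn_indep[of "{u @ [j]}" "below (u @ [j])"])
    have "X (u @ [j]) \<in> borel_measurable (F {u @ [j]})" using assms by (intro X_F snoc_word) auto
    then show "(\<lambda>\<omega>. ennreal (X (u @ [j]) \<omega> powr (q * p))) \<in> borel_measurable (F {u @ [j]})" by measurable
    have "Y q k (u @ [j]) \<in> borel_measurable (F (below (u @ [j])))" using assms by (intro Y_F) auto
    then show "(\<lambda>\<omega>. ennreal (Y q k (u @ [j]) \<omega> powr p)) \<in> borel_measurable (F (below (u @ [j])))" by measurable
  qed (use self_not_below in auto)
  finally show ?thesis using nn_mom[OF snoc_word[OF assms]] by simp
qed

lemma nn_children:
  assumes "is_word u" "i < l" "j < l" "i \<noteq> j"
  shows "(\<integral>\<^sup>+\<omega>. ennreal (child q k u i \<omega> powr a * child q k u j \<omega> powr b) \<partial>M)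
     = (\<integral>\<^sup>+\<omega>. ennreal (child q k u i \<omega> powr a) \<partial>M) * (\<integral>\<^sup>+\<omega>. ennreal (child q k u j \<omega> powr b) \<partial>M)"
proof -
  have "(\<integral>\<^sup>+\<omega>. ennreal (child q k u i \<omega> powr a * child q k u j \<omega> powr b) \<partial>M)
    = (\<integral>\<^sup>+\<omega>. ennreal (child q k u i \<omega> powr a) * ennreal (child q k u j \<omega> powr b) \<partial>M)"
    by (simp add: ennreal_mult)
  also have "\<dots> = (\<integral>\<^sup>+\<omega>. ennreal (child q k u i \<omega> powr a) \<partial>M) * (\<integral>\<^sup>+\<omega>. ennreal (child q k u j \<omega> powr b) \<partial>M)"
  proof (rule nn_indep[OF branch_disjoint[OF assms(4)]])
    note [measurable] = child_branch[OF assms(1,2)] child_branch[OF assms(1,3)]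
    show "(\<lambda>\<omega>. ennreal (child q k u i \<omega> powr a)) \<in> borel_measurable (F (branch (u @ [i])))" by measurable
    show "(\<lambda>\<omega>. ennreal (child q k u j \<omega> powr b)) \<in> borel_measurable (F (branch (u @ [j])))" by measurable
  qed
  finally show ?thesis .
qed

lemma nn_Y: "is_word u \<Longrightarrow> (\<integral>\<^sup>+\<omega>. ennreal (Y q k u \<omega>) \<partial>M) = 1"
proof (induction k arbitrary: u)
  case (Suc k)
  have ch: "(\<integral>\<^sup>+\<omega>. ennreal (child q k u j \<omega>) \<partial>M) = ennreal (mom q)" if "j < l" for j
    using nn_child[OF Suc.prems that, of q k 1] Suc that child_pos Y_pos by (simp add: less_imp_le)
  have "(\<integral>\<^sup>+\<omega>. ennreal (Y q (Suc k) u \<omega>) \<partial>M) = (\<integral>\<^sup>+\<omega>. ennreal (1 / c q) * (\<Sum>j<l. ennreal (child q k u j \<omega>)) \<partial>M)"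
    unfolding Y_Suc using c_pos[of q] child_pos
    by (intro nn_integral_cong) (simp add: ennreal_mult[symmetric] sum_nonneg less_imp_le)
  also have "\<dots> = ennreal (1 / c q) * (\<Sum>j<l. (\<integral>\<^sup>+\<omega>. ennreal (child q k u j \<omega>) \<partial>M))"
    by (subst nn_integral_cmult) (auto simp: nn_integral_sum)
  also have "\<dots> = ennreal (1 / c q) * (\<Sum>j<l. ennreal (mom q))" using ch by simp
  also have "\<dots> = ennreal (1 / c q * (\<Sum>j<l. mom q))"
  proof -
    have "(\<Sum>j<l. ennreal (mom q)) = ennreal (\<Sum>j<l. mom q)"
      using mom_pos[of q] by (intro sum_ennreal) auto
    then show ?thesis using mom_pos[of q] c_pos[of q] by (simp only: ennreal_mult[symmetric] sum_nonneg less_imp_le zero_le_divide_1_iff)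
  qed
  also have "1 / c q * (\<Sum>j<l. mom q) = 1" using l_pos mom_pos[of q] by (simp add: c_def)
  finally show ?case by simp
qed (simp add: emeasure_space_1)

section \<open>Invariance of the law under shifts\<close>

text \<open>
  The same recursion for an arbitrary configuration of weights \<open>x\<close>. It exhibits
  the masses below \<open>u\<close> as a fixed function of the weights shifted by \<open>u\<close>.
\<close>

primrec Y_on :: "real \<Rightarrow> nat \<Rightarrow> nat list \<Rightarrow> (nat list \<Rightarrow> real) \<Rightarrow> real" where
  "Y_on q 0 v x = 1"
| "Y_on q (Suc k) v x = (\<Sum>j<l. x (v @ [j]) powr q * Y_on q k (v @ [j]) x) / c q"

lemma Y_on_meas: "is_word v \<Longrightarrow> Y_on q k v \<in> borel_measurable (Pi\<^sub>M (words l) (\<lambda>_. borel))"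
proof (induction k arbitrary: v)
  case (Suc k)
  show ?case unfolding Y_on.simps using Suc
    by (intro borel_measurable_divide borel_measurable_sum borel_measurable_times powr_real_measurable
      measurable_component_singleton snoc_word) auto
next
  case 0
  have "Y_on q 0 v = (\<lambda>_. 1)" by (simp add: fun_eq_iff)
  then show ?case by simp
qed

lemma Y_eq_Y_on: "is_word v \<Longrightarrow> Y q k (u @ v) \<omega> = Y_on q k v (\<lambda>w\<in>words l. X (u @ w) \<omega>)"
proof (induction k arbitrary: v)
  case (Suc k)
  have *: "Y q k (u @ v @ [j]) \<omega> = Y_on q k (v @ [j]) (\<lambda>w\<in>words l. X (u @ w) \<omega>)" if "j < l" for j
    by (rule Suc.IH) (use Suc.prems that in simp)
  have "(\<lambda>w\<in>words l. X (u @ w) \<omega>) (v @ [j]) = X (u @ v @ [j]) \<omega>" if "j < l" for j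
    using snoc_word[OF Suc.prems that] by simp
  then show ?case unfolding Y.simps Y_on.simps append_assoc
    by (intro arg_cong2[where f="(/)"] sum.cong refl) (simp only: * lessThan_iff)
qed simp

lemma distr_shift:
  assumes "is_word u"
  shows "distr M (Pi\<^sub>M (words l) (\<lambda>_. borel)) (\<lambda>\<omega>. \<lambda>w\<in>words l. X (u @ w) \<omega>)
     = Pi\<^sub>M (words l) (\<lambda>_. distr M borel (X [0]))"
proof -
  have inj: "inj_on ((@) u) (words l)" by (simp add: inj_on_def)
  have sub: "(@) u ` words l \<subseteq> words l" using assms by (auto simp: words_iff is_word_def)
  have "indep_vars (\<lambda>_. borel) (\<lambda>w. X (u @ w)) (words l)"
    unfolding indep_vars_def2
  proof (intro conjI ballI indep_setsI)
    fix A J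
    assume J: "J \<noteq> {}" "J \<subseteq> words l" "finite J"
      and A: "\<forall>j\<in>J. A j \<in> {X (u @ j) -` S \<inter> space M |S. S \<in> sets borel}"
    define B where "B w = A (drop (length u) w)" for w
    have "prob (\<Inter>w\<in>(@) u ` J. B w) = (\<Prod>w\<in>(@) u ` J. prob (B w))"
    proof (rule indep_setsD)
      show "indep_sets (\<lambda>w. {X w -` S \<inter> space M |S. S \<in> sets borel}) (words l)"
        using X_indep by (simp add: indep_vars_def2)
      show "(@) u ` J \<subseteq> words l" using sub J(2) by blast
      show "\<forall>w\<in>(@) u ` J. B w \<in> {X w -` S \<inter> space M |S. S \<in> sets borel}"
        using A by (auto simp: B_def)
    qed (use J in auto)
    moreover have "inj_on ((@) u) J" by (simp add: inj_on_def)
    ultimately show "prob (\<Inter>j\<in>J. A j) = (\<Prod>j\<in>J. prob (A j))"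
      by (simp add: prod.reindex B_def)
  qed auto
  then have "distr M (Pi\<^sub>M (words l) (\<lambda>_. borel)) (\<lambda>\<omega>. \<lambda>w\<in>words l. X (u @ w) \<omega>)
     = Pi\<^sub>M (words l) (\<lambda>w. distr M borel (X (u @ w)))"
    using zero_word by (subst (asm) indep_vars_iff_distr_eq_PiM) auto
  also have "\<dots> = Pi\<^sub>M (words l) (\<lambda>_. distr M borel (X [0]))"
  proof (rule PiM_cong[OF refl])
    fix w assume "w \<in> words l"
    then have "u @ w \<in> words l" using sub by auto
    then show "distr M borel (X (u @ w)) = distr M borel (X [0])" using X_dist zero_word by blast
  qed
  finally show ?thesis .
qed

text \<open>
  Shifting by \<open>u\<close> a family of independent weights with a common law leaves its joint law unchanged.
\<close>

lemma Y_law: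
  assumes u: "is_word u" and S: "{x \<in> space (Pi\<^sub>M UNIV (\<lambda>_. borel)). S x} \<in> sets (Pi\<^sub>M (UNIV :: nat set) (\<lambda>_. borel :: real measure))"
  shows "prob {\<omega> \<in> space M. S (\<lambda>k. Y q k u \<omega>)} = prob {\<omega> \<in> space M. S (\<lambda>k. Y q k [] \<omega>)}"
proof -
  let ?P = "Pi\<^sub>M (words l) (\<lambda>_. borel :: real measure)"
  let ?T = "{x \<in> space ?P. S (\<lambda>k. Y_on q k [] x)}"
  have m: "(\<lambda>x. \<lambda>k\<in>UNIV. Y_on q k [] x) \<in> measurable ?P (Pi\<^sub>M UNIV (\<lambda>_. borel))"
    by (intro measurable_restrict Y_on_meas) auto
  have T: "?T \<in> sets ?P"
  proof -
    have "(\<lambda>k\<in>UNIV. Y_on q k [] x) = (\<lambda>k. Y_on q k [] x)" for x by auto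
    then show ?thesis using measurable_sets[OF m S] by (simp add: vimage_def Int_def space_PiM conj_commute)
  qed
  have eq: "prob {\<omega> \<in> space M. S (\<lambda>k. Y q k u \<omega>)}
      = measure (distr M ?P (\<lambda>\<omega>. \<lambda>w\<in>words l. X (u @ w) \<omega>)) ?T" for u
  proof -
    have G: "(\<lambda>\<omega>. \<lambda>w\<in>words l. X (u @ w) \<omega>) \<in> measurable M ?P" by measurable
    have "(\<lambda>\<omega>. \<lambda>w\<in>words l. X (u @ w) \<omega>) -` ?T \<inter> space M = {\<omega> \<in> space M. S (\<lambda>k. Y q k u \<omega>)}"
      using Y_eq_Y_on[of "[]" q _ u] by (auto simp: space_PiM)
    then show ?thesis using measure_distr[OF G T] by simp
  qed
  show ?thesis unfolding eq distr_shift[OF u] using distr_shift[of "[]"] eq[of "[]"] by simp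
qed

end

section \<open>Inequalities for real powers\<close>

lemma powr_le_one_plus:
  fixes y :: real
  assumes "0 < y" "0 \<le> p" "p \<le> 1"
  shows "y powr p \<le> 1 + y"
proof (cases "y \<le> 1")
  case True
  then have "y powr p \<le> 1" using assms by (intro powr_le1) auto
  then show ?thesis using assms by simp
next
  case False
  then have "y powr p \<le> y powr 1" using assms by (intro powr_mono) auto
  then show ?thesis using assms by simp
qed

lemma powr_tangent_upper:
  fixes S t :: real
  assumes "0 < t" "t \<le> S" "1 \<le> p"
  shows "S powr p \<le> t powr p + p * S powr (p - 1) * (S - t)"
proof (cases "t = S")
  case False
  then have "t < S" using assms by simp
  obtain z where z: "t < z" "z < S" "S powr p - t powr p = (S - t) * (p * z powr (p - 1))"
    using MVT2[OF \<open>t < S\<close>, of "\<lambda>x. x powr p" "\<lambda>x. p * x powr (p - 1)"] assms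
    by (metis has_real_derivative_powr less_le_trans)
  have "z powr (p - 1) \<le> S powr (p - 1)" using z assms by (intro powr_mono2) auto
  then have "(S - t) * (p * z powr (p - 1)) \<le> (S - t) * (p * S powr (p - 1))"
    using assms by (intro mult_left_mono) auto
  then show ?thesis using z(3) by (simp add: mult_ac)
qed simp

text \<open>
  The sharp constant \<open>1\<close> in front of the diagonal terms is what makes the recursion for the moments contract. With
  \<open>x m\<close> the largest term and \<open>S\<close> the sum, the tangent at \<open>S\<close> bounds \<open>S powr p - x m powr p\<close> by
  \<open>p * S powr (p - 1) * (S - x m)\<close>, and \<open>S \<le> l * x m\<close> turns this into mixed products with exponents \<open>p - 1\<close> and \<open>1\<close>.
\<close>

lemma sum_powr_le:
  fixes x :: "nat \<Rightarrow> real"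
  assumes "0 < l" "\<And>j. j < l \<Longrightarrow> 0 < x j" "1 \<le> p"
  shows "(\<Sum>j<l. x j) powr p \<le> (\<Sum>j<l. x j powr p)
     + p * real l powr (p - 1) * (\<Sum>i<l. \<Sum>j\<in>{..<l} - {i}. x i powr (p - 1) * x j powr 1)"
proof -
  define S where "S = (\<Sum>j<l. x j)"
  obtain m where m: "m < l" "\<And>j. j < l \<Longrightarrow> x j \<le> x m"
  proof -
    have "Max (x ` {..<l}) \<in> x ` {..<l}" using assms(1) by (intro Max_in) auto
    then obtain m where m: "m < l" "x m = Max (x ` {..<l})" by (metis imageE lessThan_iff)
    have "x j \<le> x m" if "j < l" for j unfolding m(2) using that by (intro Max_ge) auto
    then show ?thesis using that m(1) by blast
  qed
  have xm: "0 < x m" using m assms(2) by blast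
  have "S \<le> (\<Sum>j<l. x m)" unfolding S_def using m(2) by (intro sum_mono) auto
  then have S1: "S \<le> real l * x m" by simp
  have S2: "S - x m = (\<Sum>j\<in>{..<l} - {m}. x j)"
    unfolding S_def using m(1) by (subst sum.remove[of _ m]) auto
  have S3: "0 \<le> (\<Sum>j\<in>{..<l} - {m}. x j)" using assms(2) by (intro sum_nonneg) (auto intro: less_imp_le)
  have "S powr p \<le> x m powr p + p * S powr (p - 1) * (S - x m)"
    using S2 S3 xm assms(3) by (intro powr_tangent_upper) auto
  also have "\<dots> \<le> x m powr p + p * (real l * x m) powr (p - 1) * (S - x m)"
    using S1 S2 S3 xm assms(3) by (intro add_left_mono mult_right_mono mult_left_mono powr_mono2) auto
  also have "\<dots> = x m powr p + p * real l powr (p - 1) * (\<Sum>j\<in>{..<l} - {m}. x m powr (p - 1) * x j)"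
    using xm by (simp add: S2 powr_mult sum_distrib_left mult_ac)
  also have "(\<Sum>j\<in>{..<l} - {m}. x m powr (p - 1) * x j) = (\<Sum>j\<in>{..<l} - {m}. x m powr (p - 1) * x j powr 1)"
    using assms(2) by (intro sum.cong refl) (auto simp: less_imp_le)
  also have "\<dots> \<le> (\<Sum>i<l. \<Sum>j\<in>{..<l} - {i}. x i powr (p - 1) * x j powr 1)"
    using m(1) by (intro member_le_sum) (auto intro!: sum_nonneg)
  also have "x m powr p \<le> (\<Sum>j<l. x j powr p)" using m(1) by (intro member_le_sum) auto
  finally show ?thesis unfolding S_def using assms(3) by (simp add: mult_left_mono)
qed

text \<open>
  Write \<open>(1 + t) powr p = (1 + t) * (1 + t) powr (p - 1)\<close> and apply Bernoulli's inequality for the exponent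
  \<open>p - 1 \<le> 1\<close>.
\<close>

lemma one_plus_powr_le:
  fixes t p :: real
  assumes "1 < p" "p \<le> 2" "\<bar>t\<bar> \<le> 1"
  shows "(1 + t) powr p \<le> 1 + p * t + \<bar>t\<bar> powr p"
proof (cases "t = - 1")
  case True
  then show ?thesis using assms by simp
next
  case False
  then have t: "0 < 1 + t" using assms by auto
  have "(1 + t) powr (p - 1) \<le> 1 + (p - 1) * t"
  proof -
    have "(1 + t) powr (p - 1) = exp ((1 - (p - 1)) * 0 + (p - 1) * ln (1 + t))" using t by (simp add: powr_def)
    also have "\<dots> \<le> (1 - (p - 1)) * exp 0 + (p - 1) * exp (ln (1 + t))"
      using convex_onD[OF exp_convex, of "p - 1" 0 "ln (1 + t)"] assms by (simp add: algebra_simps)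
    also have "\<dots> = 1 + (p - 1) * t" using t by (simp add: algebra_simps)
    finally show ?thesis .
  qed
  then have "(1 + t) * (1 + t) powr (p - 1) \<le> (1 + t) * (1 + (p - 1) * t)"
    using t by (intro mult_left_mono) auto
  moreover have "(1 + t) powr p = (1 + t) * (1 + t) powr (p - 1)"
    using t powr_add[of "1 + t" 1 "p - 1"] by simp
  moreover have "(1 + t) * (1 + (p - 1) * t) = 1 + p * t + (p - 1) * t\<^sup>2"
    by (simp add: algebra_simps power2_eq_square)
  moreover have "(p - 1) * t\<^sup>2 \<le> 1 * \<bar>t\<bar> powr p"
  proof (rule mult_mono)
    have "\<bar>t\<bar> powr 2 \<le> \<bar>t\<bar> powr p" using assms by (intro powr_mono') auto
    then show "t\<^sup>2 \<le> \<bar>t\<bar> powr p" by (cases "t = 0") auto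
  qed (use assms in auto)
  ultimately show ?thesis by linarith
qed

text \<open>
  A first-order expansion of \<open>\<bar>a + b\<bar> powr p\<close> in which the remainder involves only \<open>b\<close>. The linear term averages
  out when \<open>b\<close> is centred and independent of \<open>a\<close>.
\<close>

lemma abs_add_powr_le:
  fixes a b p :: real
  assumes "1 < p" "p \<le> 2"
  shows "\<bar>a + b\<bar> powr p \<le> \<bar>a\<bar> powr p + p * sgn a * \<bar>a\<bar> powr (p - 1) * b + 6 * \<bar>b\<bar> powr p"
proof (cases "\<bar>b\<bar> \<le> \<bar>a\<bar> \<and> a \<noteq> 0")
  case True
  define t where "t = b / a"
  have b: "b = a * t" using True by (simp add: t_def)
  have t: "\<bar>t\<bar> \<le> 1" using True by (simp add: t_def)
  have "\<bar>a + b\<bar> powr p = \<bar>a\<bar> powr p * (1 + t) powr p"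
    using t by (simp add: b abs_mult powr_mult flip: distrib_left[of a 1 t, simplified])
  also have "\<dots> \<le> \<bar>a\<bar> powr p * (1 + p * t + \<bar>t\<bar> powr p)"
    using one_plus_powr_le[OF assms t] by (intro mult_left_mono) auto
  also have "\<dots> = \<bar>a\<bar> powr p + p * (\<bar>a\<bar> powr p * t) + \<bar>b\<bar> powr p"
    by (simp add: b abs_mult powr_mult algebra_simps)
  also have "\<bar>a\<bar> powr p * t = sgn a * \<bar>a\<bar> powr (p - 1) * b"
  proof -
    have "\<bar>a\<bar> powr p = \<bar>a\<bar> * \<bar>a\<bar> powr (p - 1)" using True powr_add[of "\<bar>a\<bar>" 1 "p - 1"] by simp
    then show ?thesis by (simp add: b abs_sgn[of a])
  qed
  finally have "\<bar>a + b\<bar> powr p \<le> \<bar>a\<bar> powr p + p * (sgn a * \<bar>a\<bar> powr (p - 1) * b) + \<bar>b\<bar> powr p" .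
  moreover have "0 \<le> \<bar>b\<bar> powr p" by simp
  ultimately show ?thesis unfolding mult.assoc by linarith
next
  case False
  then have ab: "\<bar>a\<bar> \<le> \<bar>b\<bar>" by (cases "a = 0") simp_all
  have "\<bar>a + b\<bar> powr p \<le> (2 * \<bar>b\<bar>) powr p" using ab assms by (intro powr_mono2) auto
  also have "\<dots> = 2 powr p * \<bar>b\<bar> powr p" by (simp add: powr_mult)
  also have "\<dots> \<le> 2 powr 2 * \<bar>b\<bar> powr p" using assms by (intro mult_right_mono powr_mono) auto
  finally have 1: "\<bar>a + b\<bar> powr p \<le> 4 * \<bar>b\<bar> powr p" by simp
  have "\<bar>p * sgn a * \<bar>a\<bar> powr (p - 1) * b\<bar> \<le> 2 * (\<bar>b\<bar> powr (p - 1) * \<bar>b\<bar>)"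
  proof -
    have "\<bar>p * sgn a * \<bar>a\<bar> powr (p - 1) * b\<bar> = (p * \<bar>sgn a\<bar>) * (\<bar>a\<bar> powr (p - 1) * \<bar>b\<bar>)"
      using assms by (simp add: abs_mult)
    also have "\<dots> \<le> 2 * (\<bar>b\<bar> powr (p - 1) * \<bar>b\<bar>)"
    proof (rule mult_mono)
      show "p * \<bar>sgn a\<bar> \<le> 2" using assms by (simp add: sgn_if)
    qed (use ab assms in \<open>auto intro!: mult_right_mono powr_mono2\<close>)
    finally show ?thesis .
  qed
  also have "\<bar>b\<bar> powr (p - 1) * \<bar>b\<bar> = \<bar>b\<bar> powr p"
    using powr_add[of "\<bar>b\<bar>" "p - 1" 1] by (cases "b = 0") auto
  finally have "- (2 * \<bar>b\<bar> powr p) \<le> p * sgn a * \<bar>a\<bar> powr (p - 1) * b" by linarith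
  then show ?thesis using 1 by (smt (verit) powr_ge_zero)
qed

lemma abs_powr_mult_le:
  fixes x a p :: real
  assumes "1 < p" "0 \<le> a"
  shows "\<bar>x\<bar> powr (p - 1) * a \<le> \<bar>x\<bar> powr p + a powr p"
proof -
  define m where "m = max \<bar>x\<bar> a"
  have "\<bar>x\<bar> powr (p - 1) * a \<le> m powr (p - 1) * m"
    unfolding m_def using assms by (intro mult_mono powr_mono2) auto
  also have "m powr (p - 1) * m = m powr p"
    using powr_add[of m "p - 1" 1] by (cases "m = 0") (auto simp: m_def)
  also have "\<dots> \<le> \<bar>x\<bar> powr p + a powr p" by (auto simp: m_def max_def)
  finally show ?thesis .
qed

text \<open>
  A form of Young's inequality without constants, valid for exponents \<open>e\<close> of either sign.
\<close>

lemma mult_powr_le: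
  fixes x y p e :: real
  assumes "1 < p" "0 < x" "0 < y"
  shows "x * y powr e \<le> x powr p + y powr (e * (p / (p - 1)))"
proof (cases "y powr e \<le> x powr (p - 1)")
  case True
  then have "x * y powr e \<le> x * x powr (p - 1)" using assms by (intro mult_left_mono) auto
  also have "\<dots> = x powr p" using assms powr_add[of x 1 "p - 1"] by simp
  finally show ?thesis by (simp add: add_increasing2)
next
  case False
  then have "(x powr (p - 1)) powr (1 / (p - 1)) \<le> (y powr e) powr (1 / (p - 1))"
    using assms by (intro powr_mono2) auto
  then have "x \<le> y powr (e * (1 / (p - 1)))" using assms by (simp add: powr_powr)
  then have "x * y powr e \<le> y powr (e * (1 / (p - 1))) * y powr e" by (intro mult_right_mono) auto
  also have "\<dots> = y powr (e * (p / (p - 1)))"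
  proof -
    have "e * (1 / (p - 1)) + e = e * (p / (p - 1))" using assms by (simp add: field_simps)
    then show ?thesis by (simp flip: powr_add)
  qed
  finally show ?thesis by (simp add: add_increasing)
qed

context cascade_weights
begin

section \<open>Positive moments\<close>

text \<open>
  Boundedness is required uniformly in the depth and the vertex, which is what Fatou's lemma needs in the limit.
\<close>

definition bounded_moment :: "real \<Rightarrow> real \<Rightarrow> bool" where
  "bounded_moment q p \<longleftrightarrow> (\<exists>C\<ge>0. \<forall>k u. is_word u \<longrightarrow> (\<integral>\<^sup>+\<omega>. ennreal (Y q k u \<omega> powr p) \<partial>M) \<le> ennreal C)"

lemma bounded_moment_le_1:
  assumes "0 \<le> p" "p \<le> 1"
  shows "bounded_moment q p"
  unfolding bounded_moment_def
proof (intro exI[of _ 2] conjI allI impI)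
  fix k u assume "is_word u"
  have "(\<integral>\<^sup>+\<omega>. ennreal (Y q k u \<omega> powr p) \<partial>M) \<le> (\<integral>\<^sup>+\<omega>. 1 + ennreal (Y q k u \<omega>) \<partial>M)"
    using powr_le_one_plus[OF Y_pos assms] Y_pos
    by (intro nn_integral_mono) (simp add: less_imp_le flip: ennreal_1 ennreal_plus)
  also have "\<dots> = 1 + 1" using nn_Y[OF \<open>is_word u\<close>] by (subst nn_integral_add) (auto simp: emeasure_space_1)
  finally show "(\<integral>\<^sup>+\<omega>. ennreal (Y q k u \<omega> powr p) \<partial>M) \<le> ennreal 2" by simp
qed simp

text \<open>
  By \<open>sum_powr_le\<close> the moments \<open>a k\<close> of order \<open>p\<close> at depth \<open>k\<close> satisfy \<open>a (k + 1) \<le> \<rho> * a k + D\<close>, where the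
  contraction factor \<open>\<rho>\<close> comes from the diagonal terms and \<open>D\<close> from the mixed ones, which involve only moments of the
  orders \<open>p - 1\<close> and \<open>1\<close> thanks to the independence of different branches.
\<close>

lemma bounded_moment_step:
  assumes p: "1 < p" and low: "bounded_moment q (p - 1)"
    and contr: "l * mom (q * p) / c q powr p < 1"
  shows "bounded_moment q p"
proof -
  obtain C1 where C1: "0 \<le> C1" "\<And>k u. is_word u \<Longrightarrow> (\<integral>\<^sup>+\<omega>. ennreal (Y q k u \<omega> powr (p - 1)) \<partial>M) \<le> ennreal C1"
    using low unfolding bounded_moment_def by blast
  define \<rho> where "\<rho> = l * mom (q * p) / c q powr p"
  have \<rho>: "0 \<le> \<rho>" "\<rho> < 1" using contr mom_pos[of "q * p"] c_pos[of q] by (auto simp: \<rho>_def)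
  define a where "a = 1 / c q powr p"
  define K where "K = p * real l powr (p - 1)"
  \<comment> \<open>A bound for the expectation of a mixed term.\<close>
  define e where "e = mom (q * (p - 1)) * C1 * mom q"
  define D where "D = a * K * (\<Sum>i<l. \<Sum>j\<in>{..<l} - {i}. e)"
  have a: "0 \<le> a" by (simp add: a_def)
  have K: "0 \<le> K" using p by (simp add: K_def)
  have e: "0 \<le> e" using C1 mom_pos by (simp add: e_def less_imp_le)
  have D: "0 \<le> D" unfolding D_def by (intro mult_nonneg_nonneg sum_nonneg a K e)
  define C where "C = max 1 (D / (1 - \<rho>))"
  have C: "1 \<le> C" by (simp add: C_def)
  have CD: "\<rho> * C + D \<le> C"
  proof -
    have "D / (1 - \<rho>) \<le> C" by (simp add: C_def)
    then have "D \<le> C * (1 - \<rho>)" using \<rho> by (simp add: divide_le_eq)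
    then show ?thesis by (simp add: algebra_simps)
  qed
  have "(\<integral>\<^sup>+\<omega>. ennreal (Y q k u \<omega> powr p) \<partial>M) \<le> ennreal C" if "is_word u" for k u
    using that
  proof (induction k arbitrary: u)
    case 0
    then show ?case using ennreal_leI[OF C] by (simp add: emeasure_space_1)
  next
    case (Suc k)
    let ?x = "\<lambda>j. child q k u j"
    have pw: "Y q (Suc k) u \<omega> powr p \<le> a * ((\<Sum>j<l. ?x j \<omega> powr p) + K * (\<Sum>i<l. \<Sum>j\<in>{..<l} - {i}. ?x i \<omega> powr (p - 1) * ?x j \<omega> powr 1))" for \<omega>
    proof -
      have "Y q (Suc k) u \<omega> powr p = a * (\<Sum>j<l. ?x j \<omega>) powr p"
        unfolding Y_Suc a_def by (simp add: powr_divide)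
      then show ?thesis unfolding K_def
        using mult_left_mono[OF sum_powr_le[of l "\<lambda>j. child q k u j \<omega>", OF l_pos child_pos less_imp_le[OF p]] a] by (simp only:)
    qed
    have x1: "(\<integral>\<^sup>+\<omega>. ennreal (?x j \<omega> powr p) \<partial>M) \<le> ennreal (mom (q * p) * C)" if "j < l" for j
    proof -
      have "(\<integral>\<^sup>+\<omega>. ennreal (Y q k (u @ [j]) \<omega> powr p) \<partial>M) \<le> ennreal C" using Suc that by simp
      from mult_left_mono[OF this, of "ennreal (mom (q * p))"] show ?thesis
        unfolding nn_child[OF Suc.prems that] using mom_pos[of "q * p"] C by (simp add: ennreal_mult less_imp_le)
    qed
    have x2: "(\<integral>\<^sup>+\<omega>. ennreal (?x i \<omega> powr (p - 1) * ?x j \<omega> powr 1) \<partial>M) \<le> ennreal e" if "i < l" "j < l" "i \<noteq> j" for i j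
    proof -
      have "(\<integral>\<^sup>+\<omega>. ennreal (?x i \<omega> powr (p - 1) * ?x j \<omega> powr 1) \<partial>M)
        = (ennreal (mom (q * (p - 1))) * (\<integral>\<^sup>+\<omega>. ennreal (Y q k (u @ [i]) \<omega> powr (p - 1)) \<partial>M)) * ennreal (mom q)"
        unfolding nn_children[OF Suc.prems that] using nn_child[OF Suc.prems that(1), of q k "p - 1"]
          nn_child[OF Suc.prems that(2), of q k 1] nn_Y[of "u @ [j]" q k] Y_pos that Suc.prems by (simp add: less_imp_le)
      also have "\<dots> \<le> (ennreal (mom (q * (p - 1))) * ennreal C1) * ennreal (mom q)"
        using C1(2)[of "u @ [i]" k] Suc.prems that by (intro mult_right_mono mult_left_mono) auto
      also have "\<dots> = ennreal e" using C1 mom_pos by (simp add: e_def ennreal_mult less_imp_le)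
      finally show ?thesis .
    qed
    define v where "v j \<omega> = ?x j \<omega> powr p" for j \<omega>
    define w where "w i j \<omega> = ?x i \<omega> powr (p - 1) * ?x j \<omega> powr 1" for i j \<omega>
    have nn: "0 \<le> v j \<omega>" "0 \<le> w i j \<omega>" for i j \<omega> by (simp_all add: v_def w_def)
    have [measurable]: "v j \<in> borel_measurable M" "w i j \<in> borel_measurable M" for i j
      unfolding v_def[abs_def] w_def[abs_def] by measurable
    have "ennreal (Y q (Suc k) u \<omega> powr p)
       \<le> ennreal a * ((\<Sum>j<l. ennreal (v j \<omega>)) + ennreal K * (\<Sum>i<l. \<Sum>j\<in>{..<l} - {i}. ennreal (w i j \<omega>)))" for \<omega>
    proof -
      have s1: "(\<Sum>j<l. ennreal (v j \<omega>)) = ennreal (\<Sum>j<l. v j \<omega>)" using nn by simp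
      have s2: "(\<Sum>i<l. \<Sum>j\<in>{..<l} - {i}. ennreal (w i j \<omega>)) = ennreal (\<Sum>i<l. \<Sum>j\<in>{..<l} - {i}. w i j \<omega>)"
        by (simp only: sum_ennreal nn sum_nonneg)
      have n1: "0 \<le> (\<Sum>j<l. v j \<omega>)" and n2: "0 \<le> (\<Sum>i<l. \<Sum>j\<in>{..<l} - {i}. w i j \<omega>)"
        using nn by (simp_all only: sum_nonneg)
      have "ennreal (Y q (Suc k) u \<omega> powr p) \<le> ennreal (a * ((\<Sum>j<l. v j \<omega>) + K * (\<Sum>i<l. \<Sum>j\<in>{..<l} - {i}. w i j \<omega>)))"
        unfolding v_def w_def by (rule ennreal_leI[OF pw])
      also have "\<dots> = ennreal a * (ennreal (\<Sum>j<l. v j \<omega>) + ennreal K * ennreal (\<Sum>i<l. \<Sum>j\<in>{..<l} - {i}. w i j \<omega>))"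
        by (simp only: ennreal_mult[OF a add_nonneg_nonneg[OF n1 mult_nonneg_nonneg[OF K n2]]]
            ennreal_plus[OF n1 mult_nonneg_nonneg[OF K n2]] ennreal_mult[OF K n2])
      finally show ?thesis unfolding s1 s2 .
    qed
    then have "(\<integral>\<^sup>+\<omega>. ennreal (Y q (Suc k) u \<omega> powr p) \<partial>M)
       \<le> (\<integral>\<^sup>+\<omega>. ennreal a * ((\<Sum>j<l. ennreal (v j \<omega>)) + ennreal K * (\<Sum>i<l. \<Sum>j\<in>{..<l} - {i}. ennreal (w i j \<omega>))) \<partial>M)"
      by (intro nn_integral_mono)
    also have "\<dots> = ennreal a * ((\<Sum>j<l. (\<integral>\<^sup>+\<omega>. ennreal (v j \<omega>) \<partial>M)) + ennreal K * (\<Sum>i<l. \<Sum>j\<in>{..<l} - {i}. (\<integral>\<^sup>+\<omega>. ennreal (w i j \<omega>) \<partial>M)))"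
      by (simp add: nn_integral_cmult nn_integral_add nn_integral_sum)
    also have "\<dots> \<le> ennreal a * ((\<Sum>j<l. ennreal (mom (q * p) * C)) + ennreal K * (\<Sum>i<l. \<Sum>j\<in>{..<l} - {i}. ennreal e))"
      unfolding v_def w_def by (intro mult_left_mono add_mono sum_mono x1 x2) auto
    also have "\<dots> = ennreal (a * ((\<Sum>j<l. mom (q * p) * C) + K * (\<Sum>i<l. \<Sum>j\<in>{..<l} - {i}. e)))"
    proof -
      have mC: "0 \<le> mom (q * p) * C" using mom_pos[of "q * p"] C by simp
      have n1: "0 \<le> (\<Sum>j<l. mom (q * p) * C)" by (intro sum_nonneg mC)
      have n2: "0 \<le> (\<Sum>i<l. \<Sum>j\<in>{..<l} - {i}. e)" by (intro sum_nonneg e)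
      have s1: "(\<Sum>j<l. ennreal (mom (q * p) * C)) = ennreal (\<Sum>j<l. mom (q * p) * C)" by (rule sum_ennreal) (rule mC)
      have s2: "(\<Sum>i<l. \<Sum>j\<in>{..<l} - {i}. ennreal e) = ennreal (\<Sum>i<l. \<Sum>j\<in>{..<l} - {i}. e)"
        by (simp only: sum_ennreal[OF e] sum_ennreal[OF sum_nonneg[OF e]])
      show ?thesis unfolding s1 s2
        by (simp only: ennreal_mult[OF a add_nonneg_nonneg[OF n1 mult_nonneg_nonneg[OF K n2]]]
            ennreal_plus[OF n1 mult_nonneg_nonneg[OF K n2]] ennreal_mult[OF K n2])
    qed
    also have "a * ((\<Sum>j<l. mom (q * p) * C) + K * (\<Sum>i<l. \<Sum>j\<in>{..<l} - {i}. e)) = \<rho> * C + D"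
    proof -
      have "a * (\<Sum>j<l. mom (q * p) * C) = \<rho> * C" by (simp add: \<rho>_def a_def)
      then show ?thesis by (simp only: D_def distrib_left mult.assoc)
    qed
    also have "ennreal (\<rho> * C + D) \<le> ennreal C" using CD by (rule ennreal_leI)
    finally show ?case .
  qed
  then show ?thesis unfolding bounded_moment_def using C by (intro exI[of _ C]) auto
qed

text \<open>
  Orders up to \<open>1\<close> are controlled by the mean; larger ones are reached in steps of length \<open>1\<close>.
\<close>

lemma bounded_moment_iterate:
  assumes "0 \<le> p" "\<And>r. 1 < r \<Longrightarrow> r \<le> p \<Longrightarrow> l * mom (q * r) / c q powr r < 1"
  shows "bounded_moment q p"
proof -
  have "bounded_moment q p" if "p \<le> real n + 1" "0 \<le> p" "\<And>r. 1 < r \<Longrightarrow> r \<le> p \<Longrightarrow> l * mom (q * r) / c q powr r < 1" for n p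
    using that
  proof (induction n arbitrary: p)
    case 0
    then show ?case by (intro bounded_moment_le_1) auto
  next
    case (Suc n)
    show ?case
    proof (cases "p \<le> 1")
      case True
      then show ?thesis using Suc.prems by (intro bounded_moment_le_1) auto
    next
      case False
      have "bounded_moment q (p - 1)"
      proof (rule Suc.IH)
        fix r assume "1 < r" "r \<le> p - 1"
        then show "l * mom (q * r) / c q powr r < 1" by (intro Suc.prems(3)) auto
      qed (use Suc.prems(1) False in auto)
      then show ?thesis using Suc.prems(3)[of p] False by (rule_tac bounded_moment_step) (simp_all only: not_le order_refl)
    qed
  qed
  moreover have "p \<le> real (nat \<lceil>p\<rceil>) + 1" by linarith
  ultimately show ?thesis using assms by blast
qed

end

section \<open>Summability from geometric bounds\<close>

lemma le_ennreal_of_power2_le: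
  assumes "x\<^sup>2 \<le> ennreal (s\<^sup>2)" "0 \<le> s"
  shows "x \<le> ennreal s"
proof (cases x)
  case (real r)
  then have "ennreal (r\<^sup>2) \<le> ennreal (s\<^sup>2)" using assms(1) by (simp add: ennreal_power)
  then have "r\<^sup>2 \<le> s\<^sup>2" by (subst (asm) ennreal_le_iff) auto
  then have "r \<le> s" using assms(2) by (rule power2_le_imp_le)
  then show ?thesis using real by (simp add: ennreal_leI)
next
  case top
  then have "x\<^sup>2 = top" by (simp add: power2_eq_square ennreal_top_mult)
  then show ?thesis using assms(1) by (simp add: top_unique)
qed

lemma AE_summable_geometric:
  fixes G :: "nat \<Rightarrow> 'a \<Rightarrow> real"
  assumes G [measurable]: "\<And>n. G n \<in> borel_measurable M" and nn: "\<And>n \<omega>. 0 \<le> G n \<omega>"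
    and le: "\<And>n. (\<integral>\<^sup>+\<omega>. ennreal (G n \<omega>) \<partial>M) \<le> ennreal (C * \<theta> ^ n)"
    and C: "0 \<le> C" and \<theta>: "0 \<le> \<theta>" "\<theta> < 1"
  shows "AE \<omega> in M. summable (\<lambda>n. G n \<omega>)" "integrable M (\<lambda>\<omega>. \<Sum>n. G n \<omega>)"
proof -
  have "(\<integral>\<^sup>+\<omega>. (\<Sum>n. ennreal (G n \<omega>)) \<partial>M) = (\<Sum>n. \<integral>\<^sup>+\<omega>. ennreal (G n \<omega>) \<partial>M)"
    by (rule nn_integral_suminf) simp
  also have "\<dots> \<le> (\<Sum>n. ennreal (C * \<theta> ^ n))" by (intro suminf_le le) auto
  also have "\<dots> = ennreal (\<Sum>n. C * \<theta> ^ n)"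
    using C \<theta> by (intro suminf_ennreal2 summable_mult summable_geometric) auto
  finally have fin: "(\<integral>\<^sup>+\<omega>. (\<Sum>n. ennreal (G n \<omega>)) \<partial>M) < \<infinity>" by (auto simp: less_top[symmetric] top_unique)
  then have "AE \<omega> in M. (\<Sum>n. ennreal (G n \<omega>)) \<noteq> \<infinity>" by (intro nn_integral_PInf_AE) auto
  then show sm: "AE \<omega> in M. summable (\<lambda>n. G n \<omega>)"
    by (rule eventually_mono) (rule summable_suminf_not_top[OF nn], simp)
  show "integrable M (\<lambda>\<omega>. \<Sum>n. G n \<omega>)"
  proof (rule integrableI_bounded)
    have "(\<integral>\<^sup>+\<omega>. ennreal (norm (\<Sum>n. G n \<omega>)) \<partial>M) = (\<integral>\<^sup>+\<omega>. (\<Sum>n. ennreal (G n \<omega>)) \<partial>M)"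
      using sm by (intro nn_integral_cong_AE) (auto elim!: eventually_mono simp: suminf_ennreal2 nn suminf_nonneg)
    then show "(\<integral>\<^sup>+\<omega>. ennreal (norm (\<Sum>n. G n \<omega>)) \<partial>M) < \<infinity>" using fin by simp
  qed measurable
qed

context cascade_weights
begin

section \<open>Convergence of the normalised cascades\<close>

lemma Y_integrable: "is_word u \<Longrightarrow> integrable M (Y q k u)"
  and Y_expectation: "is_word u \<Longrightarrow> expectation (Y q k u) = 1"
proof -
  assume "is_word u"
  note n = nn_Y[OF this, of q k]
  show "integrable M (Y q k u)"
    using n Y_pos by (intro integrableI_nn_integral_finite[where x=1]) (auto simp: less_imp_le)
  show "expectation (Y q k u) = 1"
    using n Y_pos by (subst integral_eq_nn_integral) (auto simp: less_imp_le)
qed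

definition D :: "real \<Rightarrow> nat \<Rightarrow> nat list \<Rightarrow> 'a \<Rightarrow> real" where
  "D q k u \<omega> = Y q (Suc k) u \<omega> - Y q k u \<omega>"

lemma D_meas [measurable]: "D q k u \<in> borel_measurable M"
  unfolding D_def[abs_def] by measurable

lemma D_F: "is_word u \<Longrightarrow> D q k u \<in> borel_measurable (F (below u))"
  unfolding D_def[abs_def] by (intro borel_measurable_diff Y_F)

lemma D_Suc: "D q (Suc k) u \<omega> = (\<Sum>j<l. (X (u @ [j]) \<omega> powr q / c q) * D q k (u @ [j]) \<omega>)"
  unfolding D_def Y.simps(2)[of q "Suc k"] Y.simps(2)[of q k]
  by (simp only: diff_divide_distrib[symmetric] sum_subtractf[symmetric] sum_divide_distrib
      right_diff_distrib times_divide_eq_left)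

text \<open>
  By independence the linear term of \<open>abs_add_powr_le\<close> has mean zero, so a centred summand contributes only through
  its own moment.
\<close>

lemma von_Bahr_Esseen_step:
  fixes A a Z :: "'a \<Rightarrow> real"
  assumes p: "1 < p" "p \<le> 2" and BB: "B \<inter> B' = {}"
    and AF: "A \<in> borel_measurable (F B)" and aF: "a \<in> borel_measurable (F B)"
    and ZF: "Z \<in> borel_measurable (F B')"
    and a0: "\<And>\<omega>. 0 \<le> a \<omega>" and Z: "integrable M Z" "expectation Z = 0"
    and Afin: "(\<integral>\<^sup>+\<omega>. ennreal (\<bar>A \<omega>\<bar> powr p) \<partial>M) < \<infinity>"
    and afin: "(\<integral>\<^sup>+\<omega>. ennreal (a \<omega> powr p) \<partial>M) < \<infinity>"
    and ZK: "(\<integral>\<^sup>+\<omega>. ennreal (\<bar>Z \<omega>\<bar> powr p) \<partial>M) \<le> ennreal K" and K: "0 \<le> K"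
  shows "(\<integral>\<^sup>+\<omega>. ennreal (\<bar>A \<omega> + a \<omega> * Z \<omega>\<bar> powr p) \<partial>M)
     \<le> (\<integral>\<^sup>+\<omega>. ennreal (\<bar>A \<omega>\<bar> powr p) \<partial>M) + ennreal (6 * K) * (\<integral>\<^sup>+\<omega>. ennreal (a \<omega> powr p) \<partial>M)"
proof -
  note [measurable] = F_M[OF AF] F_M[OF aF] F_M[OF ZF]
  have IA: "integrable M (\<lambda>\<omega>. \<bar>A \<omega>\<bar> powr p)" using Afin by (intro integrableI_bounded) auto
  have Ia: "integrable M (\<lambda>\<omega>. a \<omega> powr p)" using afin by (intro integrableI_bounded) auto
  have IZ: "integrable M (\<lambda>\<omega>. \<bar>Z \<omega>\<bar> powr p)"
    using ZK by (intro integrableI_bounded) (auto simp: less_top[symmetric] top_unique)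
  define T where "T \<omega> = p * sgn (A \<omega>) * \<bar>A \<omega>\<bar> powr (p - 1) * a \<omega>" for \<omega>
  have TF: "T \<in> borel_measurable (F B)"
  proof -
    note [measurable] = AF aF
    show ?thesis unfolding T_def[abs_def] sgn_if by measurable
  qed
  note [measurable] = F_M[OF TF]
  have IT: "integrable M T"
  proof (rule Bochner_Integration.integrable_bound)
    show "integrable M (\<lambda>\<omega>. p * (\<bar>A \<omega>\<bar> powr p + a \<omega> powr p))" using IA Ia by auto
    have "\<bar>T \<omega>\<bar> \<le> p * (\<bar>A \<omega>\<bar> powr p + a \<omega> powr p)" for \<omega>
    proof -
      have "\<bar>T \<omega>\<bar> = p * \<bar>sgn (A \<omega>)\<bar> * (\<bar>A \<omega>\<bar> powr (p - 1) * a \<omega>)"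
        using p a0 by (simp add: T_def abs_mult)
      also have "\<dots> \<le> p * 1 * (\<bar>A \<omega>\<bar> powr p + a \<omega> powr p)"
        using p a0 abs_powr_mult_le[OF p(1) a0] by (intro mult_mono) (auto simp: sgn_if)
      finally show ?thesis by simp
    qed
    then show "AE \<omega> in M. norm (T \<omega>) \<le> norm (p * (\<bar>A \<omega>\<bar> powr p + a \<omega> powr p))"
      using p by (intro AE_I2) (simp add: abs_mult)
  qed measurable
  have iTZ: "indep_var borel T borel Z" by (rule F_indep_var[OF BB TF ZF])
  have ITZ: "integrable M (\<lambda>\<omega>. T \<omega> * Z \<omega>)" by (rule indep_var_integrable[OF iTZ IT Z(1)])
  have ETZ: "expectation (\<lambda>\<omega>. T \<omega> * Z \<omega>) = 0"
    using indep_var_lebesgue_integral[OF iTZ IT Z(1)] Z(2) by simp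
  have iaZ: "indep_var borel (\<lambda>\<omega>. a \<omega> powr p) borel (\<lambda>\<omega>. \<bar>Z \<omega>\<bar> powr p)"
  proof (rule F_indep_var[OF BB])
    note [measurable] = aF
    show "(\<lambda>\<omega>. a \<omega> powr p) \<in> borel_measurable (F B)" by measurable
  next
    note [measurable] = ZF
    show "(\<lambda>\<omega>. \<bar>Z \<omega>\<bar> powr p) \<in> borel_measurable (F B')" by measurable
  qed
  have IaZ: "integrable M (\<lambda>\<omega>. a \<omega> powr p * \<bar>Z \<omega>\<bar> powr p)" by (rule indep_var_integrable[OF iaZ Ia IZ])
  have EaZ: "expectation (\<lambda>\<omega>. a \<omega> powr p * \<bar>Z \<omega>\<bar> powr p)
     = expectation (\<lambda>\<omega>. a \<omega> powr p) * expectation (\<lambda>\<omega>. \<bar>Z \<omega>\<bar> powr p)"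
    by (rule indep_var_lebesgue_integral[OF iaZ Ia IZ])
  define R where "R \<omega> = \<bar>A \<omega>\<bar> powr p + T \<omega> * Z \<omega> + 6 * (a \<omega> powr p * \<bar>Z \<omega>\<bar> powr p)" for \<omega>
  have R: "\<bar>A \<omega> + a \<omega> * Z \<omega>\<bar> powr p \<le> R \<omega>" for \<omega>
    using abs_add_powr_le[OF p, of "A \<omega>" "a \<omega> * Z \<omega>"] a0[of \<omega>]
    by (simp add: R_def T_def abs_mult powr_mult mult_ac)
  have R0: "0 \<le> R \<omega>" for \<omega> using R[of \<omega>] powr_ge_zero by (rule order_trans[rotated])
  have IR: "integrable M R" unfolding R_def[abs_def] using IA ITZ IaZ by auto
  have EZ: "expectation (\<lambda>\<omega>. \<bar>Z \<omega>\<bar> powr p) \<le> K"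
    using ZK K by (subst (asm) nn_integral_eq_integral[OF IZ]) auto
  have "(\<integral>\<^sup>+\<omega>. ennreal (\<bar>A \<omega> + a \<omega> * Z \<omega>\<bar> powr p) \<partial>M) \<le> (\<integral>\<^sup>+\<omega>. ennreal (R \<omega>) \<partial>M)"
    using R by (intro nn_integral_mono ennreal_leI)
  also have "\<dots> = ennreal (expectation R)" using R0 by (intro nn_integral_eq_integral IR) auto
  also have "expectation R = expectation (\<lambda>\<omega>. \<bar>A \<omega>\<bar> powr p)
      + 6 * (expectation (\<lambda>\<omega>. a \<omega> powr p) * expectation (\<lambda>\<omega>. \<bar>Z \<omega>\<bar> powr p))"
    unfolding R_def using IA ITZ IaZ ETZ EaZ by simp
  also have "ennreal \<dots> \<le> ennreal (expectation (\<lambda>\<omega>. \<bar>A \<omega>\<bar> powr p) + 6 * (expectation (\<lambda>\<omega>. a \<omega> powr p) * K))"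
    using EZ by (intro ennreal_leI add_left_mono mult_left_mono integral_nonneg_AE) auto
  also have "\<dots> = ennreal (expectation (\<lambda>\<omega>. \<bar>A \<omega>\<bar> powr p)) + ennreal (6 * K) * ennreal (expectation (\<lambda>\<omega>. a \<omega> powr p))"
  proof -
    have n: "0 \<le> expectation (\<lambda>\<omega>. \<bar>A \<omega>\<bar> powr p)" "0 \<le> expectation (\<lambda>\<omega>. a \<omega> powr p)"
      by (intro integral_nonneg_AE AE_I2 powr_ge_zero)+
    have "6 * (expectation (\<lambda>\<omega>. a \<omega> powr p) * K) = (6 * K) * expectation (\<lambda>\<omega>. a \<omega> powr p)" by simp
    moreover have "0 \<le> 6 * K" using K by simp
    ultimately show ?thesis by (simp only: ennreal_plus[OF n(1) mult_nonneg_nonneg[OF _ n(2)]] ennreal_mult[OF _ n(2)])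
  qed
  also have "ennreal (expectation (\<lambda>\<omega>. \<bar>A \<omega>\<bar> powr p)) = (\<integral>\<^sup>+\<omega>. ennreal (\<bar>A \<omega>\<bar> powr p) \<partial>M)"
    by (rule nn_integral_eq_integral[symmetric, OF IA]) auto
  also have "ennreal (expectation (\<lambda>\<omega>. a \<omega> powr p)) = (\<integral>\<^sup>+\<omega>. ennreal (a \<omega> powr p) \<partial>M)"
    by (rule nn_integral_eq_integral[symmetric, OF Ia]) auto
  finally show ?thesis .
qed

text \<open>
  The increment at depth \<open>k + 1\<close> is a weighted sum of the increments of the children at depth \<open>k\<close>. Applying the
  expansion level by level would lose a constant at each level. To lose it only once, the statement carries along
  an arbitrary \<open>A\<close> that has been accumulated outside the subtree, and a coefficient \<open>a\<close>; the children are then added one by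
  one, and the constant enters only at \<open>k = 0\<close>.
\<close>

lemma increment_moment_aux:
  assumes p: "1 < p" "p \<le> 2" and K: "0 \<le> K"
    and D0: "\<And>u. is_word u \<Longrightarrow> (\<integral>\<^sup>+\<omega>. ennreal (\<bar>D q 0 u \<omega>\<bar> powr p) \<partial>M) \<le> ennreal K"
  defines "\<rho> \<equiv> l * mom (q * p) / c q powr p"
  assumes "is_word u" "A \<in> borel_measurable (F B)" "a \<in> borel_measurable (F B)" "B \<inter> below u = {}"
    and "\<And>\<omega>. 0 \<le> a \<omega>"
    and "(\<integral>\<^sup>+\<omega>. ennreal (\<bar>A \<omega>\<bar> powr p) \<partial>M) < \<infinity>" "(\<integral>\<^sup>+\<omega>. ennreal (a \<omega> powr p) \<partial>M) < \<infinity>"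
  shows "(\<integral>\<^sup>+\<omega>. ennreal (\<bar>A \<omega> + a \<omega> * D q k u \<omega>\<bar> powr p) \<partial>M)
     \<le> (\<integral>\<^sup>+\<omega>. ennreal (\<bar>A \<omega>\<bar> powr p) \<partial>M) + ennreal (6 * K * \<rho> ^ k) * (\<integral>\<^sup>+\<omega>. ennreal (a \<omega> powr p) \<partial>M)"
  using assms(6-)
proof (induction k arbitrary: u A a B)
  case 0
  have "integrable M (D q 0 u)" "expectation (D q 0 u) = 0"
    using Bochner_Integration.integrable_diff[OF Y_integrable[OF 0(1), of q "Suc 0"] Y_integrable[OF 0(1), of q 0]]
      Bochner_Integration.integral_diff[OF Y_integrable[OF 0(1), of q "Suc 0"] Y_integrable[OF 0(1), of q 0]]
      Y_expectation[OF 0(1)] unfolding D_def[abs_def] by (simp_all only: diff_self)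
  then show ?case
    using von_Bahr_Esseen_step[OF p 0(4,2,3) D_F[OF 0(1)] 0(5) _ _ 0(6,7) D0[OF 0(1)] K] by simp
next
  case (Suc k)
  define b where "b i \<omega> = X (u @ [i]) \<omega> powr q / c q" for i \<omega>
  define A' where "A' i \<omega> = A \<omega> + (\<Sum>j<i. a \<omega> * b j \<omega> * D q k (u @ [j]) \<omega>)" for i \<omega>
  define s where "s = 6 * K * \<rho> ^ k * (mom (q * p) / c q powr p)"
  have \<rho>: "0 \<le> \<rho>" unfolding \<rho>_def using mom_pos[of "q * p"] by simp
  have s: "0 \<le> s" unfolding s_def using K \<rho> mom_pos[of "q * p"] by simp
  let ?a = "\<integral>\<^sup>+\<omega>. ennreal (a \<omega> powr p) \<partial>M" and ?A = "\<integral>\<^sup>+\<omega>. ennreal (\<bar>A \<omega>\<bar> powr p) \<partial>M"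
  note IH = Suc.IH and prems = Suc.prems
  have step: "(\<integral>\<^sup>+\<omega>. ennreal (\<bar>A' i \<omega>\<bar> powr p) \<partial>M) \<le> ?A + ennreal (real i * s) * ?a" if "i \<le> l" for i
    using that
  proof (induction i)
    case (Suc i)
    then have i: "i < l" "i \<le> l" by auto
    \<comment> \<open>The weights that occur in the partial sum and in the next coefficient.\<close>
    define Bi where "Bi = B \<union> (\<Union>j<i. branch (u @ [j])) \<union> {u @ [i]}"
    have wdj: "is_word (u @ [j])" "u @ [j] \<in> words l" if "j \<le> i" for j
      using Suc.prems that prems(1) by (auto intro: snoc_word)
    have bF: "b j \<in> borel_measurable (F Bi)" if "j \<le> i" for j
    proof -
      have "u @ [j] \<in> Bi" using that self_branch[of "u @ [j]"] by (cases "j = i") (auto simp: Bi_def)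
      then have "X (u @ [j]) \<in> borel_measurable (F Bi)" using wdj(2)[OF that] by (rule X_F)
      then show ?thesis unfolding b_def[abs_def] by measurable
    qed
    have aF: "a \<in> borel_measurable (F Bi)" by (rule F_mono[OF prems(3)]) (auto simp: Bi_def)
    have DF: "D q k (u @ [j]) \<in> borel_measurable (F Bi)" if "j < i" for j
      by (rule F_mono[OF D_F]) (use that wdj[of j] below_subset_branch[of "u @ [j]"] in \<open>auto simp: Bi_def\<close>)
    have A'F: "A' i \<in> borel_measurable (F Bi)" unfolding A'_def[abs_def]
      by (intro borel_measurable_add borel_measurable_sum borel_measurable_times F_mono[OF prems(2)] aF bF DF)
        (auto simp: Bi_def)
    have abF: "(\<lambda>\<omega>. a \<omega> * b i \<omega>) \<in> borel_measurable (F Bi)"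
      by (intro borel_measurable_times aF bF) simp
    have disj: "Bi \<inter> below (u @ [i]) = {}"
    proof -
      have "below (u @ [i]) \<subseteq> below u" using below_subset_branch[of "u @ [i]"] branch_subset_below[of u i] by blast
      then have "B \<inter> below (u @ [i]) = {}" using prems(4) by blast
      moreover have "branch (u @ [j]) \<inter> below (u @ [i]) = {}" if "j < i" for j
        using branch_disjoint[of j i u] below_subset_branch[of "u @ [i]"] that by blast
      ultimately show ?thesis using self_not_below[of "u @ [i]"] unfolding Bi_def by blast
    qed
    have b0: "0 \<le> a \<omega> * b i \<omega>" for \<omega> using prems(5) c_pos[of q] by (simp add: b_def)
    have "ennreal ((a \<omega> * b i \<omega>) powr p) = ennreal (a \<omega> powr p) * ennreal (X (u @ [i]) \<omega> powr (q * p) / c q powr p)" for \<omega>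
      using prems(5)[of \<omega>] X_pos[of "u @ [i]" \<omega>] c_pos[of q]
      by (simp add: b_def powr_mult powr_divide powr_powr ennreal_mult[symmetric])
    then have "(\<integral>\<^sup>+\<omega>. ennreal ((a \<omega> * b i \<omega>) powr p) \<partial>M)
      = (\<integral>\<^sup>+\<omega>. ennreal (a \<omega> powr p) * ennreal (X (u @ [i]) \<omega> powr (q * p) / c q powr p) \<partial>M)" by simp
    also have "\<dots> = ?a * (\<integral>\<^sup>+\<omega>. ennreal (X (u @ [i]) \<omega> powr (q * p) / c q powr p) \<partial>M)"
    proof (rule nn_indep[of B "{u @ [i]}"])
      show "B \<inter> {u @ [i]} = {}" using prems(4) branch_subset_below[of u i] self_branch[of "u @ [i]"] by blast
      note [measurable] = prems(3)
      show "(\<lambda>\<omega>. ennreal (a \<omega> powr p)) \<in> borel_measurable (F B)" by measurable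
      have [measurable]: "X (u @ [i]) \<in> borel_measurable (F {u @ [i]})" by (rule X_F) (use wdj in auto)
      show "(\<lambda>\<omega>. ennreal (X (u @ [i]) \<omega> powr (q * p) / c q powr p)) \<in> borel_measurable (F {u @ [i]})" by measurable
    qed
    also have "(\<integral>\<^sup>+\<omega>. ennreal (X (u @ [i]) \<omega> powr (q * p) / c q powr p) \<partial>M) = ennreal (mom (q * p) / c q powr p)"
    proof -
      have "(\<integral>\<^sup>+\<omega>. ennreal (X (u @ [i]) \<omega> powr (q * p) / c q powr p) \<partial>M)
        = (\<integral>\<^sup>+\<omega>. ennreal (1 / c q powr p) * ennreal (X (u @ [i]) \<omega> powr (q * p)) \<partial>M)"
        by (intro nn_integral_cong) (simp add: ennreal_mult[symmetric])
      also have "\<dots> = ennreal (1 / c q powr p) * ennreal (mom (q * p))"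
        using nn_mom[OF wdj(2)[of i]] by (subst nn_integral_cmult) auto
      finally show ?thesis using mom_pos[of "q * p"] by (simp add: ennreal_mult[symmetric])
    qed
    finally have ab: "(\<integral>\<^sup>+\<omega>. ennreal ((a \<omega> * b i \<omega>) powr p) \<partial>M) = ?a * ennreal (mom (q * p) / c q powr p)" .
    have abfin: "(\<integral>\<^sup>+\<omega>. ennreal ((a \<omega> * b i \<omega>) powr p) \<partial>M) < \<infinity>"
      unfolding ab using prems(7) by (simp add: ennreal_mult_less_top)
    have A'fin: "(\<integral>\<^sup>+\<omega>. ennreal (\<bar>A' i \<omega>\<bar> powr p) \<partial>M) < \<infinity>"
      by (rule le_less_trans[OF Suc.IH[OF i(2)]]) (use prems(6,7) in \<open>simp add: ennreal_mult_less_top\<close>)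
    have "(\<integral>\<^sup>+\<omega>. ennreal (\<bar>A' (Suc i) \<omega>\<bar> powr p) \<partial>M)
       = (\<integral>\<^sup>+\<omega>. ennreal (\<bar>A' i \<omega> + a \<omega> * b i \<omega> * D q k (u @ [i]) \<omega>\<bar> powr p) \<partial>M)"
      by (simp add: A'_def add.assoc)
    also have "\<dots> \<le> (\<integral>\<^sup>+\<omega>. ennreal (\<bar>A' i \<omega>\<bar> powr p) \<partial>M)
        + ennreal (6 * K * \<rho> ^ k) * (\<integral>\<^sup>+\<omega>. ennreal ((a \<omega> * b i \<omega>) powr p) \<partial>M)"
      by (rule IH[OF wdj(1)[OF order_refl] A'F abF disj b0 A'fin abfin])
    also have "ennreal (6 * K * \<rho> ^ k) * (\<integral>\<^sup>+\<omega>. ennreal ((a \<omega> * b i \<omega>) powr p) \<partial>M) = ennreal s * ?a"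
      unfolding ab s_def using K \<rho> mom_pos[of "q * p"] by (subst ennreal_mult) (auto simp: mult_ac)
    also have "(\<integral>\<^sup>+\<omega>. ennreal (\<bar>A' i \<omega>\<bar> powr p) \<partial>M) + ennreal s * ?a \<le> (?A + ennreal (real i * s) * ?a) + ennreal s * ?a"
      by (intro add_right_mono Suc.IH i)
    also have "\<dots> = ?A + ennreal (real (Suc i) * s) * ?a"
    proof -
      have "ennreal (real (Suc i) * s) = ennreal (real i * s) + ennreal s"
        using s by (subst ennreal_plus[symmetric]) (auto simp: algebra_simps)
      then show ?thesis by (simp only: distrib_right add.assoc)
    qed
    finally show ?case .
  qed (simp add: A'_def)
  have "A' l \<omega> = A \<omega> + a \<omega> * D q (Suc k) u \<omega>" for \<omega>
    unfolding D_Suc A'_def b_def by (simp add: sum_distrib_left mult.assoc)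
  moreover have "real l * s = 6 * K * \<rho> ^ Suc k" by (simp add: s_def \<rho>_def)
  ultimately show ?case using step[OF order_refl] by simp
qed

lemma increment_moment:
  assumes p: "1 < p" "p \<le> 2" and bd: "bounded_moment q p"
  obtains K where "0 \<le> K" "\<And>k u. is_word u \<Longrightarrow>
    (\<integral>\<^sup>+\<omega>. ennreal (\<bar>D q k u \<omega>\<bar> powr p) \<partial>M) \<le> ennreal (K * (l * mom (q * p) / c q powr p) ^ k)"
proof -
  obtain C where C: "0 \<le> C" "\<And>k u. is_word u \<Longrightarrow> (\<integral>\<^sup>+\<omega>. ennreal (Y q k u \<omega> powr p) \<partial>M) \<le> ennreal C"
    using bd unfolding bounded_moment_def by blast
  have D0: "(\<integral>\<^sup>+\<omega>. ennreal (\<bar>D q 0 u \<omega>\<bar> powr p) \<partial>M) \<le> ennreal (C + 1)" if "is_word u" for u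
  proof -
    have "\<bar>D q 0 u \<omega>\<bar> powr p \<le> Y q 1 u \<omega> powr p + 1" for \<omega>
    proof -
      have e: "D q 0 u \<omega> = Y q 1 u \<omega> - 1" by (simp add: D_def)
      have "\<bar>D q 0 u \<omega>\<bar> \<le> max (Y q 1 u \<omega>) 1" unfolding e using Y_pos[of q 1 u \<omega>] by linarith
      then have "\<bar>D q 0 u \<omega>\<bar> powr p \<le> max (Y q 1 u \<omega>) 1 powr p" using p by (intro powr_mono2) auto
      also have "\<dots> \<le> Y q 1 u \<omega> powr p + 1" by (simp add: max_def)
      finally show ?thesis .
    qed
    then have "(\<integral>\<^sup>+\<omega>. ennreal (\<bar>D q 0 u \<omega>\<bar> powr p) \<partial>M) \<le> (\<integral>\<^sup>+\<omega>. ennreal (Y q 1 u \<omega> powr p) + 1 \<partial>M)"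
      by (intro nn_integral_mono) (simp only: ennreal_leI flip: ennreal_1 ennreal_plus[OF powr_ge_zero zero_le_one])
    also have "\<dots> = (\<integral>\<^sup>+\<omega>. ennreal (Y q 1 u \<omega> powr p) \<partial>M) + 1"
      by (subst nn_integral_add) (simp_all add: emeasure_space_1 del: Y.simps)
    also have "\<dots> \<le> ennreal C + 1" by (intro add_right_mono C that)
    also have "\<dots> = ennreal (C + 1)" using C(1) by simp
    finally show ?thesis .
  qed
  show ?thesis
  proof (rule that[of "6 * (C + 1)"])
    fix k u assume u: "is_word u"
    have "(\<integral>\<^sup>+\<omega>. ennreal (\<bar>0 + 1 * D q k u \<omega>\<bar> powr p) \<partial>M)
       \<le> (\<integral>\<^sup>+\<omega>. ennreal (\<bar>0\<bar> powr p) \<partial>M) + ennreal (6 * (C + 1) * (l * mom (q * p) / c q powr p) ^ k) * (\<integral>\<^sup>+\<omega>. ennreal (1 powr p) \<partial>M)"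
      by (rule increment_moment_aux[OF p _ D0 u, where B="{}"]) (use C(1) in \<open>auto simp: emeasure_space_1\<close>)
    then show "(\<integral>\<^sup>+\<omega>. ennreal (\<bar>D q k u \<omega>\<bar> powr p) \<partial>M) \<le> ennreal (6 * (C + 1) * (l * mom (q * p) / c q powr p) ^ k)"
      by (simp add: emeasure_space_1)
  qed (use C in simp)
qed

definition nondegenerate :: "real \<Rightarrow> bool" where
  "nondegenerate q \<longleftrightarrow> (\<forall>u. is_word u \<longrightarrow> (AE \<omega> in M. convergent (\<lambda>k. Y q k u \<omega>)))
     \<and> \<not> (AE \<omega> in M. (\<lambda>k. Y q k [] \<omega>) \<longlonglongrightarrow> 0)"

text \<open>
  The increments decay geometrically in mean of order \<open>p\<close>, hence also in the mean of order \<open>1\<close>: with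
  \<open>t = \<theta> ^ k\<close> use \<open>\<bar>d\<bar> \<le> t powr (1 - p) * \<bar>d\<bar> powr p + t\<close>. So the masses converge almost surely, dominated by an integrable
  function, and the limit inherits the mean \<open>1\<close>.
\<close>

lemma nondegenerateI:
  assumes p: "1 < p" "p \<le> 2" and contr: "l * mom (q * p) / c q powr p < 1"
  shows "nondegenerate q"
proof -
  define \<rho> where "\<rho> = l * mom (q * p) / c q powr p"
  have \<rho>: "0 < \<rho>" "\<rho> < 1" using contr mom_pos[of "q * p"] c_pos[of q] l_pos by (auto simp: \<rho>_def)
  have "bounded_moment q p"
    by (rule bounded_moment_step[OF p(1) bounded_moment_le_1 contr]) (use p in auto)
  then obtain K where K: "0 \<le> K" "\<And>k u. is_word u \<Longrightarrow> (\<integral>\<^sup>+\<omega>. ennreal (\<bar>D q k u \<omega>\<bar> powr p) \<partial>M) \<le> ennreal (K * \<rho> ^ k)"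
    unfolding \<rho>_def using increment_moment[OF p] by blast
  define \<theta> where "\<theta> = \<rho> powr (1 / p)"
  have \<theta>: "0 < \<theta>" "\<theta> < 1" using \<rho> p powr_less_mono2[of "1 / p" \<rho> 1] by (auto simp: \<theta>_def)
  have L1: "(\<integral>\<^sup>+\<omega>. ennreal \<bar>D q k u \<omega>\<bar> \<partial>M) \<le> ennreal ((K + 1) * \<theta> ^ k)" if "is_word u" for k u
  proof -
    define t where "t = \<theta> ^ k"
    have t: "0 < t" using \<theta> by (simp add: t_def)
    have tp: "t powr p = \<rho> ^ k"
    proof -
      have "t powr p = (\<theta> powr p) ^ k" using \<theta> by (simp add: t_def powr_power flip: powr_realpow) (simp add: powr_powr mult.commute)
      moreover have "\<theta> powr p = \<rho>" using \<rho> p by (simp add: \<theta>_def powr_powr)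
      ultimately show ?thesis by simp
    qed
    have "\<bar>d\<bar> \<le> t powr (1 - p) * \<bar>d\<bar> powr p + t" for d :: real
    proof (cases "\<bar>d\<bar> \<le> t")
      case False
      have "t powr (p - 1) \<le> \<bar>d\<bar> powr (p - 1)" using False t p by (intro powr_mono2) auto
      then have "t powr (1 - p) * t powr (p - 1) * \<bar>d\<bar> \<le> t powr (1 - p) * \<bar>d\<bar> powr (p - 1) * \<bar>d\<bar>"
        by (intro mult_right_mono mult_left_mono) auto
      moreover have "t powr (1 - p) * t powr (p - 1) = 1" using t by (simp flip: powr_add)
      moreover have "\<bar>d\<bar> powr (p - 1) * \<bar>d\<bar> = \<bar>d\<bar> powr p" using powr_add[of "\<bar>d\<bar>" "p - 1" 1] False t by simp
      ultimately show ?thesis using t by (simp add: mult.assoc)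
    qed (use t in \<open>simp add: add_increasing\<close>)
    then have "(\<integral>\<^sup>+\<omega>. ennreal \<bar>D q k u \<omega>\<bar> \<partial>M) \<le> (\<integral>\<^sup>+\<omega>. ennreal (t powr (1 - p)) * ennreal (\<bar>D q k u \<omega>\<bar> powr p) + ennreal t \<partial>M)"
      using t by (intro nn_integral_mono) (simp add: ennreal_mult[symmetric] ennreal_plus[symmetric] ennreal_leI del: ennreal_plus)
    also have "\<dots> = ennreal (t powr (1 - p)) * (\<integral>\<^sup>+\<omega>. ennreal (\<bar>D q k u \<omega>\<bar> powr p) \<partial>M) + ennreal t"
      by (subst nn_integral_add) (auto simp: nn_integral_cmult emeasure_space_1)
    also have "\<dots> \<le> ennreal (t powr (1 - p)) * ennreal (K * t powr p) + ennreal t"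
      unfolding tp by (intro add_right_mono mult_left_mono K that) auto
    also have "\<dots> = ennreal (t powr (1 - p) * (K * t powr p) + t)"
      using K(1) t by (simp add: ennreal_mult ennreal_plus)
    also have "t powr (1 - p) * (K * t powr p) + t = (K + 1) * \<theta> ^ k"
    proof -
      have "t powr (1 - p) * t powr p = t" using t by (simp flip: powr_add)
      then have "t powr (1 - p) * (K * t powr p) = K * t" by (simp add: mult_ac)
      then show ?thesis by (simp add: t_def algebra_simps)
    qed
    finally show ?thesis .
  qed
  have tel: "Y q k u \<omega> = 1 + (\<Sum>i<k. D q i u \<omega>)" for k u \<omega>
    by (induction k) (simp_all add: D_def del: Y.simps(2))
  have sm: "AE \<omega> in M. summable (\<lambda>k. \<bar>D q k u \<omega>\<bar>)" and im: "integrable M (\<lambda>\<omega>. \<Sum>k. \<bar>D q k u \<omega>\<bar>)" if "is_word u" for u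
    using AE_summable_geometric[where G="\<lambda>k \<omega>. \<bar>D q k u \<omega>\<bar>" and C="K + 1" and \<theta>=\<theta>, OF _ _ L1[OF that]] K(1) \<theta> by auto
  have conv: "AE \<omega> in M. convergent (\<lambda>k. Y q k u \<omega>)" if "is_word u" for u
    using sm[OF that]
  proof (rule eventually_mono)
    fix \<omega> assume "summable (\<lambda>k. \<bar>D q k u \<omega>\<bar>)"
    then have "summable (\<lambda>k. D q k u \<omega>)" by (rule summable_rabs_cancel)
    then have "(\<lambda>k. 1 + (\<Sum>i<k. D q i u \<omega>)) \<longlonglongrightarrow> 1 + (\<Sum>i. D q i u \<omega>)"
      by (intro tendsto_add tendsto_const summable_LIMSEQ)
    then show "convergent (\<lambda>k. Y q k u \<omega>)" unfolding tel by (rule convergentI)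
  qed
  have "\<not> (AE \<omega> in M. (\<lambda>k. Y q k [] \<omega>) \<longlonglongrightarrow> 0)"
  proof
    assume z: "AE \<omega> in M. (\<lambda>k. Y q k [] \<omega>) \<longlonglongrightarrow> 0"
    have bound: "AE \<omega> in M. norm (Y q k [] \<omega>) \<le> 1 + (\<Sum>k. \<bar>D q k [] \<omega>\<bar>)" for k
      using sm[OF is_word_Nil]
    proof (rule eventually_mono)
      fix \<omega> assume s: "summable (\<lambda>k. \<bar>D q k [] \<omega>\<bar>)"
      have "(\<Sum>i<k. D q i [] \<omega>) \<le> (\<Sum>i<k. \<bar>D q i [] \<omega>\<bar>)" by (intro sum_mono) simp
      also have "\<dots> \<le> (\<Sum>i. \<bar>D q i [] \<omega>\<bar>)" by (intro sum_le_suminf s) auto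
      finally show "norm (Y q k [] \<omega>) \<le> 1 + (\<Sum>k. \<bar>D q k [] \<omega>\<bar>)"
        using Y_pos[of q k "[]" \<omega>] tel[of k "[]" \<omega>] by simp
    qed
    have ib: "integrable M (\<lambda>\<omega>. 1 + (\<Sum>k. \<bar>D q k [] \<omega>\<bar>))" using im[OF is_word_Nil] by simp
    have "(\<lambda>k. expectation (Y q k [])) \<longlonglongrightarrow> expectation (\<lambda>_. 0)"
      by (rule integral_dominated_convergence[OF _ _ ib z bound]) measurable
    then show False using Y_expectation[OF is_word_Nil] LIMSEQ_unique[OF _ tendsto_const] by fastforce
  qed
  then show ?thesis unfolding nondegenerate_def using conv by blast
qed

end

context cascade_weights
begin

section \<open>Zero-one law for extinction\<close>

text \<open>
  For positive sequences this is convergence to \<open>0\<close>; the form with quantifiers over natural numbers shows that it is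
  an event.
\<close>

definition vanishing :: "(nat \<Rightarrow> real) \<Rightarrow> bool" where
  "vanishing x \<longleftrightarrow> (\<forall>n. \<exists>N. \<forall>k\<ge>N. x k < 1 / real (Suc n))"

lemma vanishing_iff:
  assumes "\<And>k. 0 < x k"
  shows "vanishing x \<longleftrightarrow> x \<longlonglongrightarrow> 0"
proof
  assume v: "vanishing x"
  show "x \<longlonglongrightarrow> 0"
  proof (rule LIMSEQ_I)
    fix r :: real assume "0 < r"
    then obtain n where n: "1 / real (Suc n) < r" using nat_approx_posE by blast
    obtain N where "\<forall>k\<ge>N. x k < 1 / real (Suc n)" using v unfolding vanishing_def by blast
    then have "\<forall>k\<ge>N. norm (x k - 0) < r" using n assms by (auto simp: abs_of_pos intro: less_trans)
    then show "\<exists>no. \<forall>n\<ge>no. norm (x n - 0) < r" by blast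
  qed
next
  assume x: "x \<longlonglongrightarrow> 0"
  show "vanishing x" unfolding vanishing_def
  proof
    fix n
    have "eventually (\<lambda>k. x k < 1 / real (Suc n)) sequentially" by (rule order_tendstoD(2)[OF x]) simp
    then show "\<exists>N. \<forall>k\<ge>N. x k < 1 / real (Suc n)" by (simp add: eventually_sequentially)
  qed
qed

definition extinct :: "real \<Rightarrow> nat list \<Rightarrow> 'a set" where
  "extinct q u = {\<omega> \<in> space M. vanishing (\<lambda>k. Y q k u \<omega>)}"

lemma extinct_iff: "\<omega> \<in> extinct q u \<longleftrightarrow> \<omega> \<in> space M \<and> (\<lambda>k. Y q k u \<omega>) \<longlonglongrightarrow> 0"
  using vanishing_iff[of "\<lambda>k. Y q k u \<omega>", OF Y_pos] by (simp add: extinct_def)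

lemma extinct_F: "is_word u \<Longrightarrow> extinct q u \<in> sets (F (below u))"
proof -
  assume "is_word u"
  note [measurable] = Y_F[OF this]
  have "{\<omega> \<in> space (F (below u)). vanishing (\<lambda>k. Y q k u \<omega>)} \<in> sets (F (below u))"
    unfolding vanishing_def by measurable
  then show ?thesis by (simp add: extinct_def)
qed

lemma prob_extinct: "is_word u \<Longrightarrow> prob (extinct q u) = prob (extinct q [])"
  unfolding extinct_def
proof (rule Y_law)
  show "{x \<in> space (Pi\<^sub>M UNIV (\<lambda>_. borel)). vanishing x} \<in> sets (Pi\<^sub>M (UNIV :: nat set) (\<lambda>_. borel :: real measure))"
    unfolding vanishing_def by measurable
qed

lemma extinct_child: "j < l \<Longrightarrow> extinct q [] \<subseteq> extinct q [j]"
proof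
  fix \<omega> assume j: "j < l" and "\<omega> \<in> extinct q []"
  then have \<omega>: "\<omega> \<in> space M" "(\<lambda>k. Y q k [] \<omega>) \<longlonglongrightarrow> 0" by (auto simp: extinct_iff)
  define b where "b = c q / X [j] \<omega> powr q"
  have Xj: "0 < X [j] \<omega> powr q" using X_pos[of "[j]" \<omega>] by simp
  have le: "Y q k [j] \<omega> \<le> b * Y q (Suc k) [] \<omega>" for k
  proof -
    have "child q k [] j \<omega> \<le> (\<Sum>i<l. child q k [] i \<omega>)"
      using j child_pos by (intro member_le_sum) (auto intro: less_imp_le)
    then have "X [j] \<omega> powr q * Y q k [j] \<omega> \<le> c q * Y q (Suc k) [] \<omega>"
      unfolding Y_Suc using c_pos[of q] by (simp add: child_def)
    then show ?thesis unfolding b_def using Xj by (simp add: field_simps del: Y.simps)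
  qed
  have "(\<lambda>k. b * Y q (Suc k) [] \<omega>) \<longlonglongrightarrow> b * 0" by (intro tendsto_mult tendsto_const LIMSEQ_Suc \<omega>(2))
  then have "(\<lambda>k. b * Y q (Suc k) [] \<omega>) \<longlonglongrightarrow> 0" by simp
  then have "(\<lambda>k. Y q k [j] \<omega>) \<longlonglongrightarrow> 0"
    by (rule tendsto_sandwich[OF always_eventually always_eventually tendsto_const, rotated 2])
      (use le Y_pos in \<open>auto intro: less_imp_le simp del: Y.simps\<close>)
  then show "\<omega> \<in> extinct q [j]" using \<omega> by (simp add: extinct_iff)
qed

text \<open>
  If the mass below the root dies out, then so do the masses below its first two children. These are independent events
  of the same probability \<open>r\<close>, so \<open>r \<le> r * r\<close> and \<open>r\<close> is \<open>0\<close> or \<open>1\<close>.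
\<close>

lemma not_extinct:
  assumes "nondegenerate q" "is_word u"
  shows "AE \<omega> in M. \<not> (\<lambda>k. Y q k u \<omega>) \<longlonglongrightarrow> 0"
proof -
  define r where "r = prob (extinct q [])"
  have wd01: "is_word [0]" "is_word [1]" using l_ge_2 by (auto simp: is_word_def)
  have ev: "extinct q u \<in> events" if "is_word u" for u using extinct_F[OF that, of q] sets_F_M by blast
  have "indep_set (sets (F (below [0]))) (sets (F (below [1])))"
    by (rule F_indep_set) (auto simp: below_def strict_prefix_def prefix_def)
  then have "prob (extinct q [0] \<inter> extinct q [1]) = prob (extinct q [0]) * prob (extinct q [1])"
    by (rule indep_setD) (intro extinct_F wd01)+
  also have "\<dots> = r * r" unfolding prob_extinct[OF wd01(1)] prob_extinct[OF wd01(2)] r_def ..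
  finally have "prob (extinct q [0] \<inter> extinct q [1]) = r * r" .
  moreover have "r \<le> prob (extinct q [0] \<inter> extinct q [1])"
    unfolding r_def using extinct_child[of 0 q] extinct_child[of 1 q] l_ge_2 ev wd01 by (intro finite_measure_mono) auto
  ultimately have rr: "r \<le> r * r" by simp
  have "r \<noteq> 1"
  proof
    assume "r = 1"
    then have "AE \<omega> in M. \<omega> \<in> extinct q []" unfolding r_def using ev[OF is_word_Nil] by (simp add: AE_in_set_eq_1)
    then have "AE \<omega> in M. (\<lambda>k. Y q k [] \<omega>) \<longlonglongrightarrow> 0" by (rule eventually_mono) (simp add: extinct_iff)
    then show False using assms(1) by (simp add: nondegenerate_def)
  qed
  have "r = 0"
  proof (rule ccontr)
    assume "r \<noteq> 0"
    then have "0 < r" "r < 1" using \<open>r \<noteq> 1\<close> prob_le_1[of "extinct q []"] measure_nonneg[of M "extinct q []"]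
      unfolding r_def by linarith+
    then show False using rr by simp
  qed
  then have "prob (extinct q u) = 0" unfolding prob_extinct[OF assms(2)] r_def .
  then have "AE \<omega> in M. \<omega> \<notin> extinct q u" using ev[OF assms(2)] by (simp add: prob_eq_0)
  then show ?thesis by (rule AE_mp) (simp add: extinct_iff)
qed

section \<open>Limit masses\<close>

definition Z :: "real \<Rightarrow> nat list \<Rightarrow> 'a \<Rightarrow> real" where
  "Z q u \<omega> = lim (\<lambda>k. Y q k u \<omega>)"

lemma Z_meas [measurable]: "Z q u \<in> borel_measurable M"
  unfolding Z_def[abs_def] by measurable

lemma Y_tendsto_Z:
  assumes "nondegenerate q"
  shows "AE \<omega> in M. \<forall>u. is_word u \<longrightarrow> (\<lambda>k. Y q k u \<omega>) \<longlonglongrightarrow> Z q u \<omega> \<and> 0 < Z q u \<omega>"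
proof -
  have "AE \<omega> in M. is_word u \<longrightarrow> (\<lambda>k. Y q k u \<omega>) \<longlonglongrightarrow> Z q u \<omega> \<and> 0 < Z q u \<omega>" for u
  proof (cases "is_word u")
    case True
    then have "AE \<omega> in M. convergent (\<lambda>k. Y q k u \<omega>)" using assms by (simp add: nondegenerate_def)
    then show ?thesis using not_extinct[OF assms True]
    proof eventually_elim
      case (elim \<omega>)
      then have lim: "(\<lambda>k. Y q k u \<omega>) \<longlonglongrightarrow> Z q u \<omega>" by (simp add: Z_def convergent_LIMSEQ_iff)
      then have "0 \<le> Z q u \<omega>" by (rule LIMSEQ_le_const) (intro exI allI impI less_imp_le Y_pos)
      moreover have "Z q u \<omega> \<noteq> 0" using lim elim(2) by auto
      ultimately show ?case using lim by simp
    qed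
  qed simp
  then show ?thesis by (simp add: AE_all_countable)
qed

section \<open>Negative moments\<close>

text \<open>
  The masses at the root converge to a positive limit, so they stay above a small threshold with high probability from
  some depth on. By equality of laws the threshold and the depth serve all vertices.
\<close>

lemma small_mass_tight:
  assumes "nondegenerate q" "0 < \<delta>"
  obtains \<epsilon> N where "0 < \<epsilon>" "\<And>k u. N \<le> k \<Longrightarrow> is_word u \<Longrightarrow> prob {\<omega> \<in> space M. Y q k u \<omega> < \<epsilon>} \<le> \<delta>"
proof -
  define A where "A n = {\<omega> \<in> space M. \<forall>k\<ge>n. 1 / real (Suc n) \<le> Y q k [] \<omega>}" for n
  have [measurable]: "A n \<in> events" for n unfolding A_def by measurable
  have "incseq A"
  proof (rule incseq_SucI)
    fix n
    have "1 / real (Suc (Suc n)) \<le> 1 / real (Suc n)" by (intro divide_left_mono) auto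
    then show "A n \<subseteq> A (Suc n)" unfolding A_def by (auto intro: order_trans)
  qed
  then have lim: "(\<lambda>n. prob (A n)) \<longlonglongrightarrow> prob (\<Union>n. A n)" by (intro finite_Lim_measure_incseq) auto
  have "AE \<omega> in M. \<omega> \<in> (\<Union>n. A n)"
    using Y_tendsto_Z[OF assms(1)] AE_space
  proof eventually_elim
    case (elim \<omega>)
    then have z: "(\<lambda>k. Y q k [] \<omega>) \<longlonglongrightarrow> Z q [] \<omega>" "0 < Z q [] \<omega>" by auto
    have "eventually (\<lambda>k. Z q [] \<omega> / 2 < Y q k [] \<omega>) sequentially"
      by (rule order_tendstoD(1)[OF z(1)]) (use z(2) in simp)
    then obtain N where N: "\<And>k. k \<ge> N \<Longrightarrow> Z q [] \<omega> / 2 < Y q k [] \<omega>" by (auto simp: eventually_sequentially)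
    obtain m where m: "1 / real (Suc m) < Z q [] \<omega> / 2" using nat_approx_posE[of "Z q [] \<omega> / 2"] z(2) by auto
    have "1 / real (Suc (max m N)) \<le> 1 / real (Suc m)" by (intro divide_left_mono) auto
    moreover have "1 / real (Suc m) \<le> Y q k [] \<omega>" if "max m N \<le> k" for k
      using N[of k] m that by linarith
    ultimately have "\<omega> \<in> A (max m N)" unfolding A_def using elim(2) by (auto intro: order_trans)
    then show ?case by blast
  qed
  then have "prob (\<Union>n. A n) = 1" by (subst (asm) AE_in_set_eq_1) auto
  then have "eventually (\<lambda>n. 1 - \<delta> < prob (A n)) sequentially"
    using order_tendstoD(1)[OF lim, of "1 - \<delta>"] assms(2) by simp
  then obtain n where n: "1 - \<delta> < prob (A n)" by (auto simp: eventually_sequentially)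
  show ?thesis
  proof (rule that[of "1 / real (Suc n)" n])
    fix k u assume k: "n \<le> k" and u: "is_word u"
    have S: "{x \<in> space (Pi\<^sub>M UNIV (\<lambda>_. borel)). x k < 1 / real (Suc n)} \<in> sets (Pi\<^sub>M (UNIV :: nat set) (\<lambda>_. borel :: real measure))"
      by measurable
    have "prob {\<omega> \<in> space M. Y q k u \<omega> < 1 / real (Suc n)} = prob {\<omega> \<in> space M. Y q k [] \<omega> < 1 / real (Suc n)}"
      using Y_law[OF u S, of q] .
    also have "\<dots> \<le> prob (space M - A n)"
      using k by (intro finite_measure_mono) (auto simp: A_def not_le)
    also have "\<dots> = 1 - prob (A n)" by (rule prob_compl) simp
    finally show "prob {\<omega> \<in> space M. Y q k u \<omega> < 1 / real (Suc n)} \<le> \<delta>" using n by simp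
  qed simp
qed

text \<open>
  Only the event of a small mass matters for a negative moment, and the Cauchy--Schwarz inequality bounds its contribution
  by a small multiple of the square root of the moment of twice the order.
\<close>

lemma negative_moment_split:
  assumes "0 < h" "0 < \<epsilon>" "0 \<le> b" "0 \<le> \<delta>"
    and N: "(\<integral>\<^sup>+\<omega>. ennreal (Y q k u \<omega> powr (- (2 * h))) \<partial>M) \<le> ennreal b"
    and P: "prob {\<omega> \<in> space M. Y q k u \<omega> < \<epsilon>} \<le> \<delta>"
  shows "(\<integral>\<^sup>+\<omega>. ennreal (Y q k u \<omega> powr (- h)) \<partial>M) \<le> ennreal (\<epsilon> powr (- h) + sqrt (b * \<delta>))"
proof -
  let ?A = "{\<omega> \<in> space M. Y q k u \<omega> < \<epsilon>}"
  let ?f = "\<lambda>\<omega>. ennreal (Y q k u \<omega> powr (- h))"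
  have [measurable]: "?A \<in> events" by measurable
  have "(\<integral>\<^sup>+\<omega>. ?f \<omega> * indicator ?A \<omega> \<partial>M)\<^sup>2 \<le> (\<integral>\<^sup>+\<omega>. (?f \<omega>)\<^sup>2 \<partial>M) * (\<integral>\<^sup>+\<omega>. (indicator ?A \<omega>)\<^sup>2 \<partial>M)"
    by (rule Cauchy_Schwarz_nn_integral) measurable
  also have "(\<integral>\<^sup>+\<omega>. (?f \<omega>)\<^sup>2 \<partial>M) = (\<integral>\<^sup>+\<omega>. ennreal (Y q k u \<omega> powr (- (2 * h))) \<partial>M)"
  proof (rule nn_integral_cong)
    fix \<omega>
    have "(Y q k u \<omega> powr (- h))\<^sup>2 = Y q k u \<omega> powr (- (2 * h))"
      by (simp add: power2_eq_square flip: powr_add)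
    then show "(?f \<omega>)\<^sup>2 = ennreal (Y q k u \<omega> powr (- (2 * h)))" by (simp add: ennreal_power)
  qed
  also have "(\<integral>\<^sup>+\<omega>. (indicator ?A \<omega>)\<^sup>2 \<partial>M) = (\<integral>\<^sup>+\<omega>. indicator ?A \<omega> \<partial>M)"
    by (intro nn_integral_cong) (auto split: split_indicator)
  also have "\<dots> = ennreal (prob ?A)" by (simp add: emeasure_eq_measure)
  also have "(\<integral>\<^sup>+\<omega>. ennreal (Y q k u \<omega> powr (- (2 * h))) \<partial>M) * ennreal (prob ?A) \<le> ennreal b * ennreal \<delta>"
    by (intro mult_mono N ennreal_leI P) auto
  also have "\<dots> = ennreal ((sqrt (b * \<delta>))\<^sup>2)" using assms by (simp add: ennreal_mult)
  finally have cs: "(\<integral>\<^sup>+\<omega>. ?f \<omega> * indicator ?A \<omega> \<partial>M) \<le> ennreal (sqrt (b * \<delta>))"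
    by (rule le_ennreal_of_power2_le) (use assms in auto)
  have "(\<integral>\<^sup>+\<omega>. ?f \<omega> \<partial>M) \<le> (\<integral>\<^sup>+\<omega>. ennreal (\<epsilon> powr (- h)) + ?f \<omega> * indicator ?A \<omega> \<partial>M)"
  proof (rule nn_integral_mono)
    fix \<omega> assume "\<omega> \<in> space M"
    show "?f \<omega> \<le> ennreal (\<epsilon> powr (- h)) + ?f \<omega> * indicator ?A \<omega>"
    proof (cases "\<omega> \<in> ?A")
      case False
      then have "\<epsilon> \<le> Y q k u \<omega>" using \<open>\<omega> \<in> space M\<close> by auto
      then have "Y q k u \<omega> powr (- h) \<le> \<epsilon> powr (- h)" using assms by (intro powr_mono2') auto
      then have "?f \<omega> \<le> ennreal (\<epsilon> powr (- h))" by (rule ennreal_leI)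
      then show ?thesis using False by simp
    qed simp
  qed
  also have "\<dots> = ennreal (\<epsilon> powr (- h)) + (\<integral>\<^sup>+\<omega>. ?f \<omega> * indicator ?A \<omega> \<partial>M)"
    by (subst nn_integral_add) (auto simp: emeasure_space_1)
  also have "\<dots> \<le> ennreal (\<epsilon> powr (- h)) + ennreal (sqrt (b * \<delta>))" by (intro add_left_mono cs)
  also have "\<dots> = ennreal (\<epsilon> powr (- h) + sqrt (b * \<delta>))" using assms by (intro ennreal_plus[symmetric]) auto
  finally show ?thesis .
qed

text \<open>
  By the inequality of the means the sum over the children is at least twice the geometric mean of two of them.
\<close>

lemma negative_moment_recursion:
  assumes h: "0 < h" and u: "is_word u" and g: "0 \<le> g"
    and G: "\<And>v. is_word v \<Longrightarrow> (\<integral>\<^sup>+\<omega>. ennreal (Y q k v \<omega> powr (- h)) \<partial>M) \<le> ennreal g"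
  shows "(\<integral>\<^sup>+\<omega>. ennreal (Y q (Suc k) u \<omega> powr (- (2 * h))) \<partial>M)
    \<le> ennreal ((c q / 2) powr (2 * h) * (mom (q * - h))\<^sup>2 * g\<^sup>2)"
proof -
  define a where "a = (c q / 2) powr (2 * h)"
  let ?x = "\<lambda>j. child q k u j"
  have l01: "0 < l" "1 < l" using l_ge_2 by auto
  have "Y q (Suc k) u \<omega> powr (- (2 * h)) \<le> a * (?x 0 \<omega> powr (- h) * ?x 1 \<omega> powr (- h))" for \<omega>
  proof -
    define x0 x1 where "x0 = ?x 0 \<omega>" and "x1 = ?x 1 \<omega>"
    have x: "0 < x0" "0 < x1" using child_pos by (auto simp: x0_def x1_def)
    have "2 * sqrt (x0 * x1) \<le> x0 + x1" using arith_geo_mean_sqrt[of x0 x1] x by simp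
    also have "x0 + x1 = (\<Sum>j\<in>{0,1}. ?x j \<omega>)" by (simp add: x0_def x1_def)
    also have "\<dots> \<le> (\<Sum>j<l. ?x j \<omega>)" using l01 child_pos by (intro sum_mono2) (auto intro: less_imp_le)
    finally have "2 * sqrt (x0 * x1) / c q \<le> Y q (Suc k) u \<omega>"
      unfolding Y_Suc using c_pos[of q] by (intro divide_right_mono) auto
    moreover have "0 < 2 * sqrt (x0 * x1) / c q" using x c_pos[of q] by simp
    ultimately have "Y q (Suc k) u \<omega> powr (- (2 * h)) \<le> (2 * sqrt (x0 * x1) / c q) powr (- (2 * h))"
      using h by (intro powr_mono2') auto
    also have "\<dots> = (sqrt (x0 * x1) / (c q / 2)) powr (- (2 * h))" by (simp add: mult.commute)
    also have "\<dots> = sqrt (x0 * x1) powr (- (2 * h)) * a"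
      unfolding a_def powr_divide[of "sqrt (x0 * x1)" "c q / 2"] powr_minus[of "c q / 2"]
      by (simp only: divide_inverse inverse_inverse_eq)
    also have "sqrt (x0 * x1) powr (- (2 * h)) = (x0 * x1) powr (- h)"
    proof -
      have "sqrt (x0 * x1) = (x0 * x1) powr (1 / 2)" using x by (simp add: powr_half_sqrt)
      then show ?thesis by (simp add: powr_powr)
    qed
    also have "\<dots> = x0 powr (- h) * x1 powr (- h)" by (rule powr_mult)
    finally show ?thesis by (simp add: x0_def x1_def mult.commute)
  qed
  then have "(\<integral>\<^sup>+\<omega>. ennreal (Y q (Suc k) u \<omega> powr (- (2 * h))) \<partial>M)
     \<le> (\<integral>\<^sup>+\<omega>. ennreal a * ennreal (?x 0 \<omega> powr (- h) * ?x 1 \<omega> powr (- h)) \<partial>M)"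
    by (intro nn_integral_mono) (simp add: a_def ennreal_mult[symmetric] ennreal_leI del: Y.simps)
  also have "\<dots> = ennreal a * (\<integral>\<^sup>+\<omega>. ennreal (?x 0 \<omega> powr (- h) * ?x 1 \<omega> powr (- h)) \<partial>M)"
    by (rule nn_integral_cmult) measurable
  also have "\<dots> = ennreal a * ((ennreal (mom (q * - h)) * (\<integral>\<^sup>+\<omega>. ennreal (Y q k (u @ [0]) \<omega> powr (- h)) \<partial>M))
      * (ennreal (mom (q * - h)) * (\<integral>\<^sup>+\<omega>. ennreal (Y q k (u @ [1]) \<omega> powr (- h)) \<partial>M)))"
    using nn_children[OF u l01, of q k "- h" "- h"] nn_child[OF u l01(1)] nn_child[OF u l01(2)] by simp
  also have "\<dots> \<le> ennreal a * ((ennreal (mom (q * - h)) * ennreal g) * (ennreal (mom (q * - h)) * ennreal g))"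
    using u l01 by (intro mult_left_mono mult_mono G) auto
  also have "\<dots> = ennreal (a * ((mom (q * - h) * g) * (mom (q * - h) * g)))"
  proof -
    have "0 \<le> mom (q * - h)" "0 \<le> a" using mom_pos[of "q * - h"] by (auto simp: a_def)
    then show ?thesis using g by (simp only: ennreal_mult mult_nonneg_nonneg)
  qed
  also have "a * ((mom (q * - h) * g) * (mom (q * - h) * g)) = a * (mom (q * - h))\<^sup>2 * g\<^sup>2"
    by (simp add: power2_eq_square)
  finally show ?thesis unfolding a_def .
qed

text \<open>
  The last two lemmas bound the moment at depth \<open>k + 1\<close> by a constant plus \<open>2 * \<kappa> * \<delta>\<close> times the one at depth
  \<open>k\<close>. Choosing \<open>\<delta> = 1 / (4 * \<kappa>)\<close> makes this factor \<open>1 / 2\<close>, so the moments remain bounded beyond the depth where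
  tightness holds. At the finitely many other depths it suffices that the moment is finite.
\<close>

lemma bounded_negative_moment:
  assumes nd: "nondegenerate q" and h: "0 < h"
  shows "bounded_moment q (- (2 * h))"
proof -
  define \<kappa> where "\<kappa> = (c q / 2) powr (2 * h) * (mom (q * - h))\<^sup>2"
  have \<kappa>: "0 < \<kappa>" using c_pos[of q] mom_pos[of "q * - h"] by (simp add: \<kappa>_def)
  let ?N = "\<lambda>k u. \<integral>\<^sup>+\<omega>. ennreal (Y q k u \<omega> powr (- (2 * h))) \<partial>M"
  have fin: "\<exists>b\<ge>0. \<forall>u. is_word u \<longrightarrow> ?N k u \<le> ennreal b" for k
  proof (induction k)
    case 0
    show ?case by (intro exI[of _ 1]) (simp add: emeasure_space_1)
  next
    case (Suc k)
    then obtain b where b: "0 \<le> b" "\<And>u. is_word u \<Longrightarrow> ?N k u \<le> ennreal b" by blast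
    have G: "(\<integral>\<^sup>+\<omega>. ennreal (Y q k v \<omega> powr (- h)) \<partial>M) \<le> ennreal (1 powr (- h) + sqrt (b * 1))" if "is_word v" for v
      by (rule negative_moment_split[OF h _ b(1) _ b(2)[OF that]]) auto
    show ?case
      by (intro exI[of _ "\<kappa> * (1 powr (- h) + sqrt (b * 1))\<^sup>2"] conjI allI impI)
        (use \<kappa> negative_moment_recursion[OF h _ _ G] b(1) in \<open>simp_all add: \<kappa>_def del: Y.simps\<close>)
  qed
  define \<delta> where "\<delta> = 1 / (4 * \<kappa>)"
  have \<delta>: "0 < \<delta>" using \<kappa> by (simp add: \<delta>_def)
  obtain \<epsilon> N where \<epsilon>: "0 < \<epsilon>" "\<And>k u. N \<le> k \<Longrightarrow> is_word u \<Longrightarrow> prob {\<omega> \<in> space M. Y q k u \<omega> < \<epsilon>} \<le> \<delta>"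
    using small_mass_tight[OF nd \<delta>] by blast
  define K where "K = 2 * \<kappa> * (\<epsilon> powr (- h))\<^sup>2"
  obtain b0 where b0: "0 \<le> b0" "\<And>u. is_word u \<Longrightarrow> ?N N u \<le> ennreal b0" using fin by blast
  define B where "B = max (2 * K) b0"
  have B0: "0 \<le> B" using b0 by (simp add: B_def)
  have large: "?N (N + k) u \<le> ennreal B" if "is_word u" for k u
    using that
  proof (induction k arbitrary: u)
    case 0
    have "ennreal b0 \<le> ennreal B" by (intro ennreal_leI) (simp add: B_def)
    then show ?case using b0(2)[OF 0] by simp
  next
    case (Suc k)
    have G: "(\<integral>\<^sup>+\<omega>. ennreal (Y q (N + k) v \<omega> powr (- h)) \<partial>M) \<le> ennreal (\<epsilon> powr (- h) + sqrt (B * \<delta>))" if "is_word v" for v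
      by (rule negative_moment_split[OF h \<epsilon>(1) B0 less_imp_le[OF \<delta>] Suc.IH[OF that] \<epsilon>(2)[OF _ that]]) simp
    have "?N (Suc (N + k)) u \<le> ennreal (\<kappa> * (\<epsilon> powr (- h) + sqrt (B * \<delta>))\<^sup>2)"
      unfolding \<kappa>_def by (rule negative_moment_recursion[OF h Suc.prems _ G]) (use B0 \<delta> in auto)
    also have "\<dots> \<le> ennreal B"
    proof (rule ennreal_leI)
      have "(\<epsilon> powr (- h) + sqrt (B * \<delta>))\<^sup>2 \<le> 2 * (\<epsilon> powr (- h))\<^sup>2 + 2 * (sqrt (B * \<delta>))\<^sup>2"
        using sum_squares_bound[of "\<epsilon> powr (- h)" "sqrt (B * \<delta>)"] unfolding power2_sum by linarith
      then have "\<kappa> * (\<epsilon> powr (- h) + sqrt (B * \<delta>))\<^sup>2 \<le> \<kappa> * (2 * (\<epsilon> powr (- h))\<^sup>2 + 2 * (B * \<delta>))"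
        using \<kappa> B0 \<delta> by (intro mult_left_mono) auto
      also have "\<dots> = K + B / 2" using \<kappa> by (simp add: K_def \<delta>_def field_simps)
      also have "\<dots> \<le> B" by (simp add: B_def max_def)
      finally show "\<kappa> * (\<epsilon> powr (- h) + sqrt (B * \<delta>))\<^sup>2 \<le> B" .
    qed
    finally show ?case by (simp del: Y.simps)
  qed
  from choice[OF allI[OF fin]] obtain b where
    bb: "\<forall>k. 0 \<le> b k \<and> (\<forall>u. is_word u \<longrightarrow> ?N k u \<le> ennreal (b k))" ..
  have b: "0 \<le> b k" "is_word u \<Longrightarrow> ?N k u \<le> ennreal (b k)" for k u using bb by simp_all
  define C where "C = B + (\<Sum>k<N. b k)"
  have "?N k u \<le> ennreal C" if "is_word u" for k u
  proof (cases "k < N")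
    case True
    then have "b k \<le> (\<Sum>k<N. b k)" using b(1) by (intro member_le_sum) auto
    then have "ennreal (b k) \<le> ennreal C" using B0 by (intro ennreal_leI) (simp add: C_def)
    then show ?thesis by (rule order_trans[OF b(2)[OF that]])
  next
    case False
    then have "?N k u \<le> ennreal B" using large[OF that, of "k - N"] by simp
    also have "\<dots> \<le> ennreal C" using b(1) by (intro ennreal_leI) (simp add: C_def sum_nonneg)
    finally show ?thesis .
  qed
  moreover have "0 \<le> C" using B0 b(1) by (simp add: C_def sum_nonneg)
  ultimately show ?thesis unfolding bounded_moment_def by blast
qed

end

context cascade_weights
begin

section \<open>Masses of cylinders\<close>

definition Q :: "nat list \<Rightarrow> 'a \<Rightarrow> real" where
  "Q u \<omega> = (\<Prod>k = 1..length u. X (take k u) \<omega>)"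

lemma Q_Nil [simp]: "Q [] \<omega> = 1"
  and Q_snoc: "Q (u @ [j]) \<omega> = Q u \<omega> * X (u @ [j]) \<omega>"
  by (simp_all add: Q_def)

lemma Q_pos: "0 < Q u \<omega>"
  unfolding Q_def by (intro prod_pos) (simp add: X_pos)

lemma Q_meas [measurable]: "Q u \<in> borel_measurable M"
  unfolding Q_def[abs_def] by measurable

definition ancestors :: "nat list \<Rightarrow> nat list set" where "ancestors u = {w. prefix w u}"

lemma ancestors_below: "ancestors u \<inter> below u = {}"
  unfolding ancestors_def below_def by (auto simp: strict_prefix_def)

lemma Q_F: "is_word u \<Longrightarrow> Q u \<in> borel_measurable (F (ancestors u))"
proof (induction u rule: rev_induct)
  case (snoc j u)
  have "X (u @ [j]) \<in> borel_measurable (F (ancestors (u @ [j])))"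
    using snoc.prems by (intro X_F snoc_word) (auto simp: ancestors_def)
  moreover have "Q u \<in> borel_measurable (F (ancestors (u @ [j])))"
    by (rule F_mono[OF snoc.IH]) (use snoc.prems in \<open>auto simp: ancestors_def\<close>)
  ultimately show ?case unfolding Q_snoc[abs_def] by (intro borel_measurable_times)
qed (simp add: Q_def[abs_def])

lemma nn_Q: "is_word u \<Longrightarrow> (\<integral>\<^sup>+\<omega>. ennreal (Q u \<omega> powr r) \<partial>M) = ennreal (mom r ^ length u)"
proof (induction u rule: rev_induct)
  case (snoc j u)
  have "(\<integral>\<^sup>+\<omega>. ennreal (Q (u @ [j]) \<omega> powr r) \<partial>M)
     = (\<integral>\<^sup>+\<omega>. ennreal (Q u \<omega> powr r) * ennreal (X (u @ [j]) \<omega> powr r) \<partial>M)"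
    unfolding Q_snoc by (simp add: powr_mult ennreal_mult)
  also have "\<dots> = (\<integral>\<^sup>+\<omega>. ennreal (Q u \<omega> powr r) \<partial>M) * (\<integral>\<^sup>+\<omega>. ennreal (X (u @ [j]) \<omega> powr r) \<partial>M)"
  proof (rule nn_indep[of "ancestors u" "{u @ [j]}"])
    show "ancestors u \<inter> {u @ [j]} = {}" by (auto simp: ancestors_def prefix_def)
    have [measurable]: "Q u \<in> borel_measurable (F (ancestors u))" by (rule Q_F) (use snoc.prems in simp)
    show "(\<lambda>\<omega>. ennreal (Q u \<omega> powr r)) \<in> borel_measurable (F (ancestors u))" by measurable
    have [measurable]: "X (u @ [j]) \<in> borel_measurable (F {u @ [j]})" by (intro X_F snoc_word) (use snoc.prems in auto)
    show "(\<lambda>\<omega>. ennreal (X (u @ [j]) \<omega> powr r)) \<in> borel_measurable (F {u @ [j]})" by measurable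
  qed
  also have "\<dots> = ennreal (mom r ^ length u) * ennreal (mom r)"
    using snoc nn_mom[OF snoc_word, of u j r] by simp
  also have "\<dots> = ennreal (mom r ^ length (u @ [j]))"
    using mom_pos[of r] by (simp add: ennreal_mult[symmetric] mult.commute)
  finally show ?case .
qed (simp add: emeasure_space_1)

text \<open>
  The limit mass of the interval of \<open>u\<close> for the cascade of exponent \<open>q\<close>.
\<close>

definition mass :: "real \<Rightarrow> nat list \<Rightarrow> 'a \<Rightarrow> real" where
  "mass q u \<omega> = Q u \<omega> powr q / c q ^ length u * Z q u \<omega>"

lemma mass_meas [measurable]: "mass q u \<in> borel_measurable M"
  unfolding mass_def[abs_def] by measurable

lemma AE_mass_flow:
  assumes "nondegenerate q"
  shows "AE \<omega> in M. \<forall>u. is_word u \<longrightarrow> 0 < mass q u \<omega> \<and> mass q u \<omega> = (\<Sum>j<l. mass q (u @ [j]) \<omega>)"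
  using Y_tendsto_Z[OF assms]
proof eventually_elim
  case (elim \<omega>)
  show ?case
  proof (intro allI impI)
    fix u assume u: "is_word u"
    have "(\<lambda>k. (\<Sum>j<l. X (u @ [j]) \<omega> powr q * Y q k (u @ [j]) \<omega>) / c q)
        \<longlonglongrightarrow> (\<Sum>j<l. X (u @ [j]) \<omega> powr q * Z q (u @ [j]) \<omega>) / c q"
      using elim u c_pos[of q] by (intro tendsto_divide tendsto_sum tendsto_mult tendsto_const) auto
    then have "(\<lambda>k. Y q (Suc k) u \<omega>) \<longlonglongrightarrow> (\<Sum>j<l. X (u @ [j]) \<omega> powr q * Z q (u @ [j]) \<omega>) / c q" by simp
    moreover have "(\<lambda>k. Y q (Suc k) u \<omega>) \<longlonglongrightarrow> Z q u \<omega>" using elim u by (intro LIMSEQ_Suc) simp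
    ultimately have "Z q u \<omega> = (\<Sum>j<l. X (u @ [j]) \<omega> powr q * Z q (u @ [j]) \<omega>) / c q"
      by (rule LIMSEQ_unique[rotated])
    then have "mass q u \<omega> = (\<Sum>j<l. mass q (u @ [j]) \<omega>)"
      unfolding mass_def Q_snoc by (simp add: powr_mult sum_distrib_left sum_divide_distrib mult_ac)
    moreover have "0 < mass q u \<omega>" unfolding mass_def
      using elim u Q_pos[of u \<omega>] c_pos[of q] by (intro mult_pos_pos divide_pos_pos) auto
    ultimately show "0 < mass q u \<omega> \<and> mass q u \<omega> = (\<Sum>j<l. mass q (u @ [j]) \<omega>)" by simp
  qed
qed

text \<open>
  The product of the weights along \<open>u\<close> is independent of the masses below \<open>u\<close>. Fatou's lemma carries the moment bounds
  at finite depth over to the limit.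
\<close>

lemma nn_mass_moment:
  assumes nd: "nondegenerate q" "nondegenerate 1" and u: "is_word u"
    and C: "0 \<le> C" "\<And>k. (\<integral>\<^sup>+\<omega>. ennreal (Y q k u \<omega> powr a * Y 1 k u \<omega> powr b) \<partial>M) \<le> ennreal C"
  shows "(\<integral>\<^sup>+\<omega>. ennreal (mass q u \<omega> powr a * mass 1 u \<omega> powr b) \<partial>M)
     \<le> ennreal (C * (mom (q * a + b) / (c q powr a * c 1 powr b)) ^ length u)"
proof -
  define n where "n = length u"
  define e where "e = 1 / (c q powr a * c 1 powr b) ^ n"
  have e0: "0 \<le> e" by (simp add: e_def)
  let ?f = "\<lambda>\<omega>. ennreal (e * Q u \<omega> powr (q * a + b))"
  let ?g = "\<lambda>k \<omega>. ennreal (Y q k u \<omega> powr a * Y 1 k u \<omega> powr b)"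
  have cn: "(c r ^ n) powr t = (c r powr t) ^ n" for r t
  proof -
    have "(c r ^ n) powr t = (c r powr real n) powr t" using c_pos[of r] by (simp add: powr_realpow)
    also have "\<dots> = (c r powr t) powr real n" by (simp add: powr_powr mult.commute)
    also have "\<dots> = (c r powr t) ^ n" using c_pos[of r] by (intro powr_realpow) simp
    finally show ?thesis .
  qed
  have eq: "mass q u \<omega> powr a * mass 1 u \<omega> powr b = e * Q u \<omega> powr (q * a + b) * (Z q u \<omega> powr a * Z 1 u \<omega> powr b)" for \<omega>
    unfolding mass_def n_def[symmetric] using Q_pos[of u \<omega>]
    by (simp add: powr_mult powr_divide cn e_def powr_powr powr_add power_mult_distrib)
  have gF: "?g k \<in> borel_measurable (F (below u))" for k
  proof -
    note [measurable] = Y_F[OF u]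
    show ?thesis by measurable
  qed
  have fF: "?f \<in> borel_measurable (F (ancestors u))"
  proof -
    note [measurable] = Q_F[OF u]
    show ?thesis by measurable
  qed
  have "(\<integral>\<^sup>+\<omega>. ennreal (mass q u \<omega> powr a * mass 1 u \<omega> powr b) \<partial>M)
     = (\<integral>\<^sup>+\<omega>. liminf (\<lambda>k. ?f \<omega> * ?g k \<omega>) \<partial>M)"
  proof (rule nn_integral_cong_AE)
    show "AE \<omega> in M. ennreal (mass q u \<omega> powr a * mass 1 u \<omega> powr b) = liminf (\<lambda>k. ?f \<omega> * ?g k \<omega>)"
      using Y_tendsto_Z[OF nd(1)] Y_tendsto_Z[OF nd(2)]
    proof eventually_elim
      case (elim \<omega>)
      then have "(\<lambda>k. e * Q u \<omega> powr (q * a + b) * (Y q k u \<omega> powr a * Y 1 k u \<omega> powr b))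
         \<longlonglongrightarrow> mass q u \<omega> powr a * mass 1 u \<omega> powr b"
        unfolding eq using u by (intro tendsto_mult tendsto_const tendsto_powr) auto
      then have "(\<lambda>k. ennreal (e * Q u \<omega> powr (q * a + b) * (Y q k u \<omega> powr a * Y 1 k u \<omega> powr b)))
         \<longlonglongrightarrow> ennreal (mass q u \<omega> powr a * mass 1 u \<omega> powr b)" by (rule tendsto_ennrealI)
      moreover have "ennreal (e * Q u \<omega> powr (q * a + b) * (Y q k u \<omega> powr a * Y 1 k u \<omega> powr b)) = ?f \<omega> * ?g k \<omega>" for k
        using e0 by (intro ennreal_mult) auto
      ultimately have "(\<lambda>k. ?f \<omega> * ?g k \<omega>) \<longlonglongrightarrow> ennreal (mass q u \<omega> powr a * mass 1 u \<omega> powr b)" by simp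
      then show ?case by (rule lim_imp_Liminf[OF sequentially_bot, symmetric])
    qed
  qed
  also have "\<dots> \<le> liminf (\<lambda>k. \<integral>\<^sup>+\<omega>. ?f \<omega> * ?g k \<omega> \<partial>M)"
    by (rule nn_integral_liminf) measurable
  also have "\<dots> \<le> liminf (\<lambda>k. ennreal (e * mom (q * a + b) ^ n) * ennreal C)"
  proof (rule Liminf_mono[OF always_eventually], rule allI)
    fix k
    have "(\<integral>\<^sup>+\<omega>. ?f \<omega> * ?g k \<omega> \<partial>M) = (\<integral>\<^sup>+\<omega>. ?f \<omega> \<partial>M) * (\<integral>\<^sup>+\<omega>. ?g k \<omega> \<partial>M)"
      by (rule nn_indep[OF ancestors_below fF gF])
    also have "(\<integral>\<^sup>+\<omega>. ?f \<omega> \<partial>M) = (\<integral>\<^sup>+\<omega>. ennreal e * ennreal (Q u \<omega> powr (q * a + b)) \<partial>M)"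
      using e0 by (simp add: ennreal_mult)
    also have "\<dots> = ennreal (e * mom (q * a + b) ^ n)"
      using nn_Q[OF u, of "q * a + b"] e0 mom_pos[of "q * a + b"]
      by (subst nn_integral_cmult) (auto simp: n_def ennreal_mult)
    finally show "(\<integral>\<^sup>+\<omega>. ?f \<omega> * ?g k \<omega> \<partial>M) \<le> ennreal (e * mom (q * a + b) ^ n) * ennreal C"
      using C(2)[of k] by (simp add: mult_left_mono)
  qed
  also have "\<dots> = ennreal (e * mom (q * a + b) ^ n) * ennreal C" by (simp add: Liminf_const)
  also have "\<dots> = ennreal (C * (mom (q * a + b) / (c q powr a * c 1 powr b)) ^ n)"
    using C(1) e0 mom_pos[of "q * a + b"]
    by (subst ennreal_mult[symmetric]) (auto simp: e_def power_divide mult.commute)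
  finally show ?thesis unfolding n_def .
qed

text \<open>
  Three choices of \<open>a\<close> and \<open>b\<close> are used: \<open>(0, q)\<close> to count intervals for the upper bound, \<open>(1 + e, 0)\<close> for words that
  carry too much flow, and \<open>(1, e)\<close> for flow through words of untypical mass.
\<close>

lemma AE_summable_level_sums:
  assumes nd: "nondegenerate q" "nondegenerate 1" and C: "0 \<le> C"
    and C': "\<And>k u. is_word u \<Longrightarrow> (\<integral>\<^sup>+\<omega>. ennreal (Y q k u \<omega> powr a * Y 1 k u \<omega> powr b) \<partial>M) \<le> ennreal C"
    and x: "0 \<le> x" and small: "l * mom (q * a + b) / (c q powr a * c 1 powr b) * x < 1"
  shows "AE \<omega> in M. summable (\<lambda>n. \<Sum>u\<in>words_of_length l n. mass q u \<omega> powr a * mass 1 u \<omega> powr b * x ^ n)"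
proof -
  define r where "r = mom (q * a + b) / (c q powr a * c 1 powr b)"
  have r: "0 \<le> r" using mom_pos[of "q * a + b"] by (simp add: r_def)
  have \<theta>: "0 \<le> real l * r * x" "real l * r * x < 1"
    by (rule mult_nonneg_nonneg[OF mult_nonneg_nonneg[OF of_nat_0_le_iff r] x], use small in \<open>simp add: r_def\<close>)
  show ?thesis
  proof (rule AE_summable_geometric(1)[where C=C and \<theta>="real l * r * x"])
    fix n
    have "(\<integral>\<^sup>+\<omega>. ennreal (\<Sum>u\<in>words_of_length l n. mass q u \<omega> powr a * mass 1 u \<omega> powr b * x ^ n) \<partial>M)
       = (\<Sum>u\<in>words_of_length l n. \<integral>\<^sup>+\<omega>. ennreal (x ^ n) * ennreal (mass q u \<omega> powr a * mass 1 u \<omega> powr b) \<partial>M)"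
      using x by (subst nn_integral_sum[symmetric])
        (auto intro!: nn_integral_cong simp: ennreal_mult[symmetric] mult.commute)
    also have "\<dots> \<le> (\<Sum>u\<in>words_of_length l n. ennreal (x ^ n) * ennreal (C * r ^ n))"
    proof (rule sum_mono)
      fix u assume "u \<in> words_of_length l n"
      then have u: "is_word u" "length u = n" by (auto simp: is_word_def words_of_length_def)
      have "(\<integral>\<^sup>+\<omega>. ennreal (x ^ n) * ennreal (mass q u \<omega> powr a * mass 1 u \<omega> powr b) \<partial>M)
         = ennreal (x ^ n) * (\<integral>\<^sup>+\<omega>. ennreal (mass q u \<omega> powr a * mass 1 u \<omega> powr b) \<partial>M)"
        by (rule nn_integral_cmult) measurable
      also have "\<dots> \<le> ennreal (x ^ n) * ennreal (C * r ^ n)"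
        using nn_mass_moment[OF nd u(1) C C'[OF u(1)]] u(2) by (intro mult_left_mono) (auto simp: r_def)
      finally show "(\<integral>\<^sup>+\<omega>. ennreal (x ^ n) * ennreal (mass q u \<omega> powr a * mass 1 u \<omega> powr b) \<partial>M)
         \<le> ennreal (x ^ n) * ennreal (C * r ^ n)" .
    qed
    also have "\<dots> = ennreal (C * (real l * r * x) ^ n)"
    proof -
      have "card (words_of_length l n) = l ^ n"
        by (rule card_words_of_length)
      then have "(\<Sum>u\<in>words_of_length l n. ennreal (x ^ n) * ennreal (C * r ^ n))
          = ennreal (real (l ^ n)) * ennreal (x ^ n * (C * r ^ n))"
        using x C r by (simp add: ennreal_mult[symmetric] ennreal_of_nat_eq_real_of_nat)
      also have "\<dots> = ennreal (C * (real l * r * x) ^ n)"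
        using x C r by (subst ennreal_mult[symmetric]) (auto simp: power_mult_distrib mult_ac)
      finally show ?thesis .
    qed
    finally show "(\<integral>\<^sup>+\<omega>. ennreal (\<Sum>u\<in>words_of_length l n. mass q u \<omega> powr a * mass 1 u \<omega> powr b * x ^ n) \<partial>M)
       \<le> ennreal (C * (real l * r * x) ^ n)" .
  qed (use x C \<theta> in \<open>auto intro!: sum_nonneg\<close>)
qed

lemma joint_moment:
  assumes p: "1 < p" "bounded_moment q p" "bounded_moment 1 (e * (p / (p - 1)))"
  obtains C where "0 \<le> C"
    "\<And>k u. is_word u \<Longrightarrow> (\<integral>\<^sup>+\<omega>. ennreal (Y q k u \<omega> powr 1 * Y 1 k u \<omega> powr e) \<partial>M) \<le> ennreal C"
proof -
  obtain C1 where C1: "0 \<le> C1" "\<And>k u. is_word u \<Longrightarrow> (\<integral>\<^sup>+\<omega>. ennreal (Y q k u \<omega> powr p) \<partial>M) \<le> ennreal C1"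
    using p(2) unfolding bounded_moment_def by blast
  obtain C2 where C2: "0 \<le> C2" "\<And>k u. is_word u \<Longrightarrow> (\<integral>\<^sup>+\<omega>. ennreal (Y 1 k u \<omega> powr (e * (p / (p - 1)))) \<partial>M) \<le> ennreal C2"
    using p(3) unfolding bounded_moment_def by blast
  show ?thesis
  proof (rule that[of "C1 + C2"])
    fix k u assume u: "is_word u"
    have "Y q k u \<omega> powr 1 * Y 1 k u \<omega> powr e \<le> Y q k u \<omega> powr p + Y 1 k u \<omega> powr (e * (p / (p - 1)))" for \<omega>
      using mult_powr_le[OF p(1) Y_pos Y_pos, of q k u \<omega> 1 k u \<omega> e] Y_pos[of q k u \<omega>] by simp
    then have "(\<integral>\<^sup>+\<omega>. ennreal (Y q k u \<omega> powr 1 * Y 1 k u \<omega> powr e) \<partial>M)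
       \<le> (\<integral>\<^sup>+\<omega>. ennreal (Y q k u \<omega> powr p) + ennreal (Y 1 k u \<omega> powr (e * (p / (p - 1)))) \<partial>M)"
      by (intro nn_integral_mono) (simp only: ennreal_leI ennreal_plus[OF powr_ge_zero powr_ge_zero, symmetric])
    also have "\<dots> = (\<integral>\<^sup>+\<omega>. ennreal (Y q k u \<omega> powr p) \<partial>M) + (\<integral>\<^sup>+\<omega>. ennreal (Y 1 k u \<omega> powr (e * (p / (p - 1)))) \<partial>M)"
      by (rule nn_integral_add) measurable
    also have "\<dots> \<le> ennreal C1 + ennreal C2" using u by (intro add_mono C1 C2)
    also have "\<dots> = ennreal (C1 + C2)" using C1 C2 by simp
    finally show "(\<integral>\<^sup>+\<omega>. ennreal (Y q k u \<omega> powr 1 * Y 1 k u \<omega> powr e) \<partial>M) \<le> ennreal (C1 + C2)" .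
  qed (use C1 C2 in simp)
qed

end

section \<open>The limit measure of cylinders\<close>

locale cascade_measure = cascade_weights +
  fixes m :: "'a \<Rightarrow> real measure"
  assumes unit_mean: "mom 1 = 1"
    and cascade: "mandelbrot_cascade M l X m"
begin

lemma c_1: "c 1 = real l" by (simp add: c_def unit_mean)

text \<open>
  The mass of the interval of \<open>u\<close> under the approximation of level \<open>length u + k\<close>.
\<close>

definition stage_mass :: "nat \<Rightarrow> nat list \<Rightarrow> 'a \<Rightarrow> real" where
  "stage_mass k u \<omega> = Q u \<omega> / real l ^ length u * Y 1 k u \<omega>"

lemma stage_mass_Suc: "stage_mass (Suc k) u \<omega> = (\<Sum>j<l. stage_mass k (u @ [j]) \<omega>)"
proof -
  have "X v \<omega> powr 1 = X v \<omega>" for v using X_pos[of v \<omega>] by simp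
  then show ?thesis unfolding stage_mass_def Q_snoc Y.simps(2) c_1
    by (simp add: sum_distrib_left sum_divide_distrib mult_ac)
qed

lemma stage_mass_add: "(\<Sum>v\<in>words_of_length l k. stage_mass n (u @ v) \<omega>) = stage_mass (n + k) u \<omega>"
proof (induction k arbitrary: n)
  case 0
  show ?case by (simp add: words_of_length_0)
next
  case (Suc k)
  have "(\<Sum>v\<in>words_of_length l (Suc k). stage_mass n (u @ v) \<omega>)
     = (\<Sum>v\<in>words_of_length l k. \<Sum>j<l. stage_mass n ((u @ v) @ [j]) \<omega>)"
    by (simp add: sum_words_of_length_Suc)
  also have "\<dots> = (\<Sum>v\<in>words_of_length l k. stage_mass (Suc n) (u @ v) \<omega>)"
    by (simp only: stage_mass_Suc)
  also have "\<dots> = stage_mass (Suc n + k) u \<omega>" by (rule Suc)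
  finally show ?case by simp
qed

definition cylinder_integral :: "(real \<Rightarrow> real) \<Rightarrow> nat list \<Rightarrow> real" where
  "cylinder_integral g v = (\<integral>x. indicator (ladic_interval l v) x * g x \<partial>lborel)"

lemma ladic_interval_borel [measurable]: "ladic_interval l v \<in> sets borel"
  unfolding ladic_interval_eq[OF l_pos] by simp

lemma emeasure_ladic_interval: "emeasure lborel (ladic_interval l v) = ennreal (1 / real l ^ length v)"
proof -
  have "real (word_index l v) / real l ^ length v \<le> (real (word_index l v) + 1) / real l ^ length v"
    by (intro divide_right_mono) auto
  then show ?thesis unfolding ladic_interval_eq[OF l_pos] by (simp add: diff_divide_distrib[symmetric])
qed

lemma cylinder_integrable:
  fixes g :: "real \<Rightarrow> real"
  assumes "continuous_on UNIV g" "\<And>x. \<bar>g x\<bar> \<le> B"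
  shows "integrable lborel (\<lambda>x. indicator (ladic_interval l v) x * g x)"
proof (rule Bochner_Integration.integrable_bound)
  show "integrable lborel (\<lambda>x. B * indicator (ladic_interval l v) x :: real)"
    by (intro integrable_mult_right) (simp add: emeasure_ladic_interval integrable_indicator_iff)
  have [measurable]: "g \<in> borel_measurable borel" by (rule borel_measurable_continuous_onI[OF assms(1)])
  show "(\<lambda>x. indicator (ladic_interval l v) x * g x) \<in> borel_measurable lborel" by measurable
  show "AE x in lborel. norm (indicator (ladic_interval l v) x * g x) \<le> norm (B * indicator (ladic_interval l v) x :: real)"
  proof (rule AE_I2)
    fix x
    have "\<bar>g x\<bar> \<le> \<bar>B\<bar>" using assms(2)[of x] by linarith
    then show "norm (indicator (ladic_interval l v) x * g x) \<le> norm (B * indicator (ladic_interval l v) x :: real)"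
      by (simp add: indicator_def)
  qed
qed

lemma cascade_approx_integral:
  fixes g :: "real \<Rightarrow> real"
  assumes g: "continuous_on UNIV g" "\<And>x. \<bar>g x\<bar> \<le> B"
  shows "(\<integral>x. g x \<partial>cascade_approx l X k \<omega>) = (\<Sum>v\<in>words_of_length l k. Q v \<omega> * cylinder_integral g v)"
proof -
  have [measurable]: "g \<in> borel_measurable borel" by (rule borel_measurable_continuous_onI[OF g(1)])
  have dens: "cascade_density l X k \<omega> x = (\<Sum>v\<in>words_of_length l k. Q v \<omega> * indicator (ladic_interval l v) x)" for x
    unfolding cascade_density_def Q_def by (intro sum.cong refl) (auto simp: words_of_length_def)
  have d0: "0 \<le> cascade_density l X k \<omega> x" for x
    unfolding dens using Q_pos by (intro sum_nonneg mult_nonneg_nonneg) (auto intro: less_imp_le)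
  have [measurable]: "cascade_density l X k \<omega> \<in> borel_measurable borel"
    unfolding dens[abs_def] by measurable
  have "(\<integral>x. g x \<partial>cascade_approx l X k \<omega>) = (\<integral>x. cascade_density l X k \<omega> x *\<^sub>R g x \<partial>restrict_space lborel {0..1})"
    unfolding cascade_approx_def using d0 by (intro integral_density) (auto intro!: measurable_restrict_space1)
  also have "\<dots> = (\<integral>x. indicator {0..1} x *\<^sub>R (cascade_density l X k \<omega> x *\<^sub>R g x) \<partial>lborel)"
    by (rule integral_restrict_space) simp
  also have "\<dots> = (\<integral>x. (\<Sum>v\<in>words_of_length l k. Q v \<omega> * (indicator (ladic_interval l v) x * g x)) \<partial>lborel)"
  proof (rule Bochner_Integration.integral_cong[OF refl])
    fix x
    have v: "indicator {0..1} x * (Q v \<omega> * indicator (ladic_interval l v) x * g x) = Q v \<omega> * (indicator (ladic_interval l v) x * g x)"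
      if "v \<in> words_of_length l k" for v
      using ladic_interval_subset_unit[OF l_pos that] by (auto simp: indicator_def)
    show "indicator {0..1} x *\<^sub>R (cascade_density l X k \<omega> x *\<^sub>R g x)
       = (\<Sum>v\<in>words_of_length l k. Q v \<omega> * (indicator (ladic_interval l v) x * g x))"
      unfolding dens real_scaleR_def sum_distrib_left sum_distrib_right by (intro sum.cong refl v)
  qed
  also have "\<dots> = (\<Sum>v\<in>words_of_length l k. Q v \<omega> * cylinder_integral g v)"
    unfolding cylinder_integral_def using cylinder_integrable[OF g]
    by (subst Bochner_Integration.integral_sum) auto
  finally show ?thesis .
qed

lemma cylinder_integral_const: "cylinder_integral (\<lambda>_. a) v = a / real l ^ length v"
  unfolding cylinder_integral_def using emeasure_ladic_interval[of v]
  by (simp add: measure_def)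

lemma stage_mass_0: "stage_mass 0 v \<omega> = Q v \<omega> * cylinder_integral (\<lambda>_. 1) v"
  by (simp add: stage_mass_def cylinder_integral_const)

lemma cascade_approx_total: "(\<integral>x. 1 \<partial>cascade_approx l X k \<omega>) = Y 1 k [] \<omega>"
proof -
  have "(\<integral>x. 1 \<partial>cascade_approx l X k \<omega>) = (\<Sum>v\<in>words_of_length l k. Q v \<omega> * cylinder_integral (\<lambda>_. 1) v)"
    by (rule cascade_approx_integral[of _ 1]) auto
  also have "\<dots> = stage_mass k [] \<omega>" using stage_mass_add[of 0 "[]" \<omega> k] by (simp add: stage_mass_0)
  finally show ?thesis by (simp add: stage_mass_def)
qed

lemma stage_mass_le_integral:
  fixes g :: "real \<Rightarrow> real"
  assumes g: "continuous_on UNIV g" "\<And>x. 0 \<le> g x" "\<And>x. g x \<le> 1" "\<And>x. x \<in> ladic_interval l u \<Longrightarrow> g x = 1"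
    and u: "u \<in> words_of_length l n"
  shows "stage_mass k u \<omega> \<le> (\<integral>x. g x \<partial>cascade_approx l X (n + k) \<omega>)"
proof -
  have b: "\<bar>g x\<bar> \<le> 1" for x using g(2,3)[of x] by simp
  have sub: "(@) u ` words_of_length l k \<subseteq> words_of_length l (n + k)"
    using u by (auto simp: words_of_length_def)
  have inj: "inj_on ((@) u) (words_of_length l k)" by (simp add: inj_on_def)
  have desc: "ladic_interval l (u @ v) \<subseteq> ladic_interval l u" if "set v \<subseteq> {..<l}" for v
    using that
  proof (induction v rule: rev_induct)
    case (snoc j v)
    then show ?case using ladic_interval_snoc_subset[OF l_pos, of j "u @ v"] by auto
  qed simp
  have "stage_mass k u \<omega> = (\<Sum>v\<in>words_of_length l k. Q (u @ v) \<omega> * cylinder_integral (\<lambda>_. 1) (u @ v))"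
    using stage_mass_add[of 0 u \<omega> k] by (simp add: stage_mass_0)
  also have "\<dots> = (\<Sum>v\<in>words_of_length l k. Q (u @ v) \<omega> * cylinder_integral g (u @ v))"
  proof (intro sum.cong refl)
    fix v assume "v \<in> words_of_length l k"
    then have "ladic_interval l (u @ v) \<subseteq> ladic_interval l u" by (intro desc) (simp add: words_of_length_def)
    then have "indicator (ladic_interval l (u @ v)) x * (1::real) = indicator (ladic_interval l (u @ v)) x * g x" for x
      using g(4)[of x] by (auto simp: indicator_def)
    then have "cylinder_integral (\<lambda>_. 1) (u @ v) = cylinder_integral g (u @ v)"
      unfolding cylinder_integral_def by (intro Bochner_Integration.integral_cong refl)
    then show "Q (u @ v) \<omega> * cylinder_integral (\<lambda>_. 1) (u @ v) = Q (u @ v) \<omega> * cylinder_integral g (u @ v)" by simp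
  qed
  also have "\<dots> = (\<Sum>w\<in>(@) u ` words_of_length l k. Q w \<omega> * cylinder_integral g w)"
    by (simp add: sum.reindex[OF inj])
  also have "\<dots> \<le> (\<Sum>w\<in>words_of_length l (n + k). Q w \<omega> * cylinder_integral g w)"
  proof (intro sum_mono2 sub)
    fix w
    have "0 \<le> cylinder_integral g w" unfolding cylinder_integral_def
      using g(2) by (intro integral_nonneg_AE AE_I2 mult_nonneg_nonneg) auto
    then show "0 \<le> Q w \<omega> * cylinder_integral g w" using Q_pos[of w \<omega>] by simp
  qed simp
  also have "\<dots> = (\<integral>x. g x \<partial>cascade_approx l X (n + k) \<omega>)" by (rule cascade_approx_integral[OF g(1) b, symmetric])
  finally show ?thesis .
qed

lemma AE_weak: "AE \<omega> in M. converges_weakly_01 (\<lambda>n. cascade_approx l X n \<omega>) (m \<omega>)"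
  and m_finite: "\<omega> \<in> space M \<Longrightarrow> finite_measure (m \<omega>)"
  and m_sets: "\<omega> \<in> space M \<Longrightarrow> sets (m \<omega>) = sets (restrict_space borel {0..1})"
  and m_meas: "B \<in> sets (restrict_space borel {0..1}) \<Longrightarrow> (\<lambda>\<omega>. emeasure (m \<omega>) B) \<in> borel_measurable M"
  using cascade unfolding mandelbrot_cascade_def finite_random_measure_01_def by auto

lemma m_space: "\<omega> \<in> space M \<Longrightarrow> space (m \<omega>) = {0..1}"
  using sets_eq_imp_space_eq[OF m_sets, of \<omega>] by (simp add: space_restrict_space)

lemma m_borel:
  assumes "\<omega> \<in> space M" "(g :: real \<Rightarrow> real) \<in> borel_measurable borel"
  shows "g \<in> borel_measurable (m \<omega>)"
  using measurable_restrict_space1[OF assms(2), of "{0..1}"] measurable_cong_sets[OF m_sets[OF assms(1)] refl] by blast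

lemma m_set: "\<omega> \<in> space M \<Longrightarrow> A \<in> sets borel \<Longrightarrow> A \<subseteq> {0..1} \<Longrightarrow> A \<in> sets (m \<omega>)"
  by (simp add: m_sets sets_restrict_space_iff)

lemma m_integrable:
  fixes g :: "real \<Rightarrow> real"
  assumes "\<omega> \<in> space M" "continuous_on UNIV g" "\<And>x. \<bar>g x\<bar> \<le> B"
  shows "integrable (m \<omega>) g"
proof -
  interpret finite_measure "m \<omega>" by (rule m_finite[OF assms(1)])
  show ?thesis
    using m_borel[OF assms(1) borel_measurable_continuous_onI[OF assms(2)]] assms(3)
    by (intro integrable_const_bound[of _ B]) auto
qed

text \<open>
  A trapezoid, equal to \<open>1\<close> on \<open>[a, b]\<close> and falling off with slope \<open>s\<close> on both sides.
\<close>

definition tent :: "real \<Rightarrow> real \<Rightarrow> real \<Rightarrow> real \<Rightarrow> real" where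
  "tent a b s x = max 0 (1 - s * max 0 (max (a - x) (x - b)))"

lemma tent_continuous: "continuous_on UNIV (tent a b s)"
  unfolding tent_def[abs_def] by (intro continuous_intros)

lemma tent_bounds: "0 \<le> tent a b s x" "0 \<le> s \<Longrightarrow> tent a b s x \<le> 1" "0 \<le> s \<Longrightarrow> \<bar>tent a b s x\<bar> \<le> 1"
  by (auto simp: tent_def)

lemma tent_eq_1: "a \<le> x \<Longrightarrow> x \<le> b \<Longrightarrow> tent a b s x = 1"
  by (auto simp: tent_def)

lemma tent_eq_0:
  assumes "0 < s" "x \<le> a - 1 / s \<or> b + 1 / s \<le> x"
  shows "tent a b s x = 0"
proof -
  have "1 / s \<le> max 0 (max (a - x) (x - b))" using assms(2) by auto
  then have "1 \<le> s * max 0 (max (a - x) (x - b))" using assms(1) by (simp add: divide_le_eq mult.commute)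
  then show ?thesis by (simp add: tent_def)
qed

text \<open>
  Test the weak convergence against a tent at \<open>x\<close>. Each approximation has the mean density \<open>1\<close>, so the tent has mean
  integral at most \<open>2 / s\<close>, and Fatou's lemma passes this bound to the limit.
\<close>

lemma AE_no_atom:
  assumes "x \<in> {0..1}"
  shows "AE \<omega> in M. emeasure (m \<omega>) {x} = 0"
proof -
  have x: "{x} \<in> sets (restrict_space borel {0..1})" using assms by (simp add: sets_restrict_space_iff)
  have [measurable]: "(\<lambda>\<omega>. emeasure (m \<omega>) {x}) \<in> borel_measurable M" by (rule m_meas[OF x])
  have small: "(\<integral>\<^sup>+\<omega>. emeasure (m \<omega>) {x} \<partial>M) \<le> ennreal e" if "0 < e" for e
  proof -
    define s where "s = 2 / e"
    have s: "0 < s" using that by (simp add: s_def)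
    define g where "g = tent x x s"
    have gc: "continuous_on UNIV g" and g0: "\<And>y. 0 \<le> g y" and g1: "\<And>y. \<bar>g y\<bar> \<le> 1"
      using s tent_continuous tent_bounds by (auto simp: g_def)
    let ?I = "\<lambda>k \<omega>. \<Sum>v\<in>words_of_length l k. Q v \<omega> * cylinder_integral g v"
    have ci0: "0 \<le> cylinder_integral g v" for v unfolding cylinder_integral_def
      using g0 by (intro integral_nonneg_AE AE_I2 mult_nonneg_nonneg) auto
    have "(\<integral>\<^sup>+\<omega>. emeasure (m \<omega>) {x} \<partial>M) \<le> (\<integral>\<^sup>+\<omega>. liminf (\<lambda>k. ennreal (?I k \<omega>)) \<partial>M)"
    proof (rule nn_integral_mono_AE)
      show "AE \<omega> in M. emeasure (m \<omega>) {x} \<le> liminf (\<lambda>k. ennreal (?I k \<omega>))"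
        using AE_weak AE_space
      proof eventually_elim
        case (elim \<omega>)
        have "(\<lambda>k. \<integral>y. g y \<partial>cascade_approx l X k \<omega>) \<longlonglongrightarrow> (\<integral>y. g y \<partial>m \<omega>)"
          using elim(1) continuous_on_subset[OF gc] by (auto simp: converges_weakly_01_def)
        then have "(\<lambda>k. ?I k \<omega>) \<longlonglongrightarrow> (\<integral>y. g y \<partial>m \<omega>)" by (simp add: cascade_approx_integral[OF gc g1])
        then have lim: "(\<lambda>k. ennreal (?I k \<omega>)) \<longlonglongrightarrow> ennreal (\<integral>y. g y \<partial>m \<omega>)" by (rule tendsto_ennrealI)
        have "emeasure (m \<omega>) {x} = (\<integral>\<^sup>+y. indicator {x} y \<partial>m \<omega>)"
          using m_set[OF elim(2), of "{x}"] assms by simp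
        also have "\<dots> \<le> (\<integral>\<^sup>+y. ennreal (g y) \<partial>m \<omega>)"
          using tent_eq_1[of x x x s] by (intro nn_integral_mono) (auto simp: g_def indicator_def)
        also have "\<dots> = ennreal (\<integral>y. g y \<partial>m \<omega>)"
          using g0 by (intro nn_integral_eq_integral m_integrable[OF elim(2) gc g1]) auto
        also have "\<dots> = liminf (\<lambda>k. ennreal (?I k \<omega>))"
          by (rule lim_imp_Liminf[OF sequentially_bot lim, symmetric])
        finally show ?case .
      qed
    qed
    also have "\<dots> \<le> liminf (\<lambda>k. \<integral>\<^sup>+\<omega>. ennreal (?I k \<omega>) \<partial>M)" by (rule nn_integral_liminf) measurable
    also have "\<dots> \<le> liminf (\<lambda>k. ennreal e)"
    proof (rule Liminf_mono[OF always_eventually], rule allI)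
      fix k
      have "(\<integral>\<^sup>+\<omega>. ennreal (?I k \<omega>) \<partial>M) = (\<integral>\<^sup>+\<omega>. (\<Sum>v\<in>words_of_length l k. ennreal (cylinder_integral g v) * ennreal (Q v \<omega>)) \<partial>M)"
      proof (rule nn_integral_cong)
        fix \<omega>
        have "ennreal (cylinder_integral g v) * ennreal (Q v \<omega>) = ennreal (Q v \<omega> * cylinder_integral g v)" for v
          using ci0[of v] Q_pos[of v \<omega>] by (simp add: ennreal_mult[symmetric] mult.commute)
        then show "ennreal (?I k \<omega>) = (\<Sum>v\<in>words_of_length l k. ennreal (cylinder_integral g v) * ennreal (Q v \<omega>))"
          using ci0 Q_pos[of _ \<omega>] by (simp add: less_imp_le)
      qed
      also have "\<dots> = (\<Sum>v\<in>words_of_length l k. \<integral>\<^sup>+\<omega>. ennreal (cylinder_integral g v) * ennreal (Q v \<omega>) \<partial>M)"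
        by (rule nn_integral_sum) measurable
      also have "\<dots> = (\<Sum>v\<in>words_of_length l k. ennreal (cylinder_integral g v))"
      proof (intro sum.cong refl)
        fix v assume "v \<in> words_of_length l k"
        then have "is_word v" by (simp add: is_word_def words_of_length_def)
        then have "(\<integral>\<^sup>+\<omega>. ennreal (Q v \<omega>) \<partial>M) = 1"
          using nn_Q[of v 1] Q_pos[of v] unit_mean by (simp add: less_imp_le)
        then show "(\<integral>\<^sup>+\<omega>. ennreal (cylinder_integral g v) * ennreal (Q v \<omega>) \<partial>M) = ennreal (cylinder_integral g v)"
          by (subst nn_integral_cmult) auto
      qed
      also have "\<dots> = ennreal (\<Sum>v\<in>words_of_length l k. cylinder_integral g v)" using ci0 by simp
      also have "\<dots> \<le> ennreal e"
      proof (rule ennreal_leI)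
        have "(\<Sum>v\<in>words_of_length l k. cylinder_integral g v)
            = (\<integral>y. (\<Sum>v\<in>words_of_length l k. indicator (ladic_interval l v) y * g y) \<partial>lborel)"
          unfolding cylinder_integral_def
          by (rule Bochner_Integration.integral_sum[symmetric]) (rule cylinder_integrable[OF gc g1])
        also have "\<dots> \<le> (\<integral>y. indicator {x - 1 / s..x + 1 / s} y \<partial>lborel)"
        proof (rule integral_mono)
          show "integrable lborel (\<lambda>y. \<Sum>v\<in>words_of_length l k. indicator (ladic_interval l v) y * g y)"
            by (rule Bochner_Integration.integrable_sum) (rule cylinder_integrable[OF gc g1])
          show "integrable lborel (indicator {x - 1 / s..x + 1 / s} :: real \<Rightarrow> real)"
            by (simp add: integrable_indicator_iff emeasure_lborel_Icc_eq)
          fix y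
          have "(\<Sum>v\<in>words_of_length l k. indicator (ladic_interval l v) y) \<le> (1::real)"
          proof -
            have dj: "disjoint_family_on (ladic_interval l) (words_of_length l k)"
              unfolding disjoint_family_on_def using ladic_interval_unique[OF l_pos] by blast
            have "(\<Sum>v\<in>words_of_length l k. indicator (ladic_interval l v) y) = (indicator (\<Union>v\<in>words_of_length l k. ladic_interval l v) y :: real)"
              by (rule indicator_UN_disjoint[OF _ dj, symmetric]) simp
            then show ?thesis by (simp add: indicator_def)
          qed
          then have "(\<Sum>v\<in>words_of_length l k. indicator (ladic_interval l v) y * g y) \<le> 1 * g y"
            unfolding sum_distrib_right[symmetric] using g0[of y] by (rule mult_right_mono)
          also have "\<dots> \<le> indicator {x - 1 / s..x + 1 / s} y"
            using tent_eq_0[OF s, of y x x] g1[of y] by (auto simp: indicator_def g_def not_le)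
          finally show "(\<Sum>v\<in>words_of_length l k. indicator (ladic_interval l v) y * g y) \<le> indicator {x - 1 / s..x + 1 / s} y" .
        qed
        also have "\<dots> = 2 / s" using s by (simp add: field_simps)
        also have "2 / s = e" using that by (simp add: s_def)
        finally show "(\<Sum>v\<in>words_of_length l k. cylinder_integral g v) \<le> e" .
      qed
      finally show "(\<integral>\<^sup>+\<omega>. ennreal (?I k \<omega>) \<partial>M) \<le> ennreal e" .
    qed
    also have "\<dots> = ennreal e" by (simp add: Liminf_const)
    finally show ?thesis .
  qed
  have "(\<integral>\<^sup>+\<omega>. emeasure (m \<omega>) {x} \<partial>M) \<le> 0"
  proof (rule ennreal_le_epsilon)
    fix e :: real assume "0 < e"
    then show "(\<integral>\<^sup>+\<omega>. emeasure (m \<omega>) {x} \<partial>M) \<le> 0 + ennreal e" using small[of e] by simp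
  qed
  then have "(\<integral>\<^sup>+\<omega>. emeasure (m \<omega>) {x} \<partial>M) = 0" by simp
  then show ?thesis by (subst (asm) nn_integral_0_iff_AE) auto
qed

end

text \<open>
  Upper bounds for all the terms of a finite sum are also lower bounds if the sum itself converges to at least the sum
  of the bounds.
\<close>

lemma tendsto_of_upper_bounds:
  fixes f :: "nat \<Rightarrow> 'b \<Rightarrow> real"
  assumes R: "finite R" and up: "\<And>v e. v \<in> R \<Longrightarrow> 0 < e \<Longrightarrow> \<forall>\<^sub>F k in sequentially. f k v < \<mu> v + e"
    and sum: "(\<lambda>k. \<Sum>v\<in>R. f k v) \<longlonglongrightarrow> T" and T: "(\<Sum>v\<in>R. \<mu> v) \<le> T" and u: "u \<in> R"
  shows "(\<lambda>k. f k u) \<longlonglongrightarrow> \<mu> u"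
proof (rule LIMSEQ_I)
  fix r :: real assume r: "0 < r"
  define e where "e = r / (real (card R) + 1)"
  have e: "0 < e" using r by (simp add: e_def)
  have er: "(real (card R) + 1) * e = r" by (simp add: e_def)
  have ev: "\<forall>\<^sub>F k in sequentially. \<forall>v\<in>R. f k v < \<mu> v + e" using R up e by (simp add: eventually_ball_finite)
  have ev2: "\<forall>\<^sub>F k in sequentially. T - e < (\<Sum>v\<in>R. f k v)" by (rule order_tendstoD(1)[OF sum]) (use e in simp)
  have "\<forall>\<^sub>F k in sequentially. norm (f k u - \<mu> u) < r"
    using ev ev2
  proof eventually_elim
    case (elim k)
    have "(\<Sum>v\<in>R - {u}. f k v) \<le> (\<Sum>v\<in>R - {u}. \<mu> v + e)" using elim(1) by (intro sum_mono) (auto intro: less_imp_le)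
    also have "\<dots> = (\<Sum>v\<in>R - {u}. \<mu> v) + (real (card R) - 1) * e"
    proof -
      have "card (R - {u}) = card R - 1" "card R \<ge> 1" using R u by (auto simp: Suc_le_eq card_gt_0_iff)
      then show ?thesis by (simp add: sum.distrib of_nat_diff)
    qed
    finally have 1: "(\<Sum>v\<in>R - {u}. f k v) \<le> (\<Sum>v\<in>R - {u}. \<mu> v) + (real (card R) - 1) * e" .
    have 2: "(\<Sum>v\<in>R. f k v) = f k u + (\<Sum>v\<in>R - {u}. f k v)" "(\<Sum>v\<in>R. \<mu> v) = \<mu> u + (\<Sum>v\<in>R - {u}. \<mu> v)"
      using R u by (simp_all add: sum.remove)
    have 3: "(real (card R) - 1) * e + 2 * e = r" using er by (simp add: algebra_simps)
    have 4: "f k u < \<mu> u + e" using elim(1) u by blast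
    have "0 \<le> real (card R) * e" using e by simp
    then have "e \<le> r" using er unfolding distrib_right by linarith
    then show ?case using 1 2 3 4 elim(2) T e by (simp add: abs_less_iff)
  qed
  then show "\<exists>no. \<forall>n\<ge>no. norm (f n u - \<mu> u) < r" by (simp add: eventually_sequentially)
qed

context cascade_measure
begin

lemma words_of_length_iff: "u \<in> words_of_length l n \<longleftrightarrow> is_word u \<and> length u = n"
  by (auto simp: words_of_length_def is_word_def)

text \<open>
  Weak convergence gives only the upper bound, by testing against tents that shrink to the closed interval; the right
  endpoint has no mass. The convergence of the total mass turns it into equality on each level.
\<close>

lemma AE_stage_mass_limit:
  "AE \<omega> in M. (\<lambda>k. Y 1 k [] \<omega>) \<longlonglongrightarrow> measure (m \<omega>) {0..1} \<and>
     (\<forall>u. is_word u \<longrightarrow> (\<lambda>k. stage_mass k u \<omega>) \<longlonglongrightarrow> measure (m \<omega>) (ladic_interval l u))"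
proof -
  \<comment> \<open>All the endpoints of the intervals; there are countably many of them.\<close>
  define S where "S = {x \<in> {0..1}. x \<in> (\<lambda>(i, n). real i / real l ^ n) ` (UNIV :: (nat \<times> nat) set)}"
  have "countable S" unfolding S_def by (rule countable_subset[of _ "(\<lambda>(i, n). real i / real l ^ n) ` (UNIV :: (nat \<times> nat) set)"]) auto
  then have "AE \<omega> in M. \<forall>x\<in>S. emeasure (m \<omega>) {x} = 0"
    using AE_no_atom by (subst AE_ball_countable) (auto simp: S_def)
  with AE_weak AE_space show ?thesis
  proof eventually_elim
    case (elim \<omega>)
    interpret mm: finite_measure "m \<omega>" by (rule m_finite[OF elim(2)])
    have weak: "(\<lambda>k. \<integral>y. g y \<partial>cascade_approx l X k \<omega>) \<longlonglongrightarrow> (\<integral>y. g y \<partial>m \<omega>)" if "continuous_on UNIV g" for g :: "real \<Rightarrow> real"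
      using elim(1) continuous_on_subset[OF that] by (auto simp: converges_weakly_01_def)
    have tot: "(\<lambda>k. Y 1 k [] \<omega>) \<longlonglongrightarrow> measure (m \<omega>) {0..1}"
      using weak[OF continuous_on_const, of 1] unfolding cascade_approx_total by (simp add: m_space[OF elim(2)])
    have up: "\<forall>\<^sub>F k in sequentially. stage_mass k u \<omega> < measure (m \<omega>) (ladic_interval l u) + e"
      if u: "u \<in> words_of_length l n" and e: "0 < e" for u n e
    proof -
      define a where "a = real (word_index l u) / real l ^ length u"
      define b where "b = real (word_index l u + 1) / real l ^ length u"
      have Iu: "ladic_interval l u = {a..<b}" unfolding ladic_interval_eq[OF l_pos] a_def b_def by (simp add: add.commute)
      have sub: "{a..<b} \<subseteq> {0..<1}" using ladic_interval_subset_unit[OF l_pos u] Iu by simp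
      have ab: "a < b" unfolding a_def b_def using l_pos by (intro divide_strict_right_mono) auto
      have "b \<le> 1"
      proof (rule ccontr)
        assume "\<not> b \<le> 1"
        then have "max a 1 \<in> {a..<b}" using ab by auto
        then show False using sub by auto
      qed
      have "0 \<le> a" using sub ab by auto
      have "b \<in> range (\<lambda>(i, n). real i / real l ^ n)"
        by (rule range_eqI[of _ _ "(word_index l u + 1, length u)"]) (simp add: b_def)
      then have b: "b \<in> S" unfolding S_def using \<open>b \<le> 1\<close> \<open>0 \<le> a\<close> ab by simp
      have sets: "{a..b} \<in> sets (m \<omega>)" "{a..<b} \<in> sets (m \<omega>)" "{b} \<in> sets (m \<omega>)"
        using \<open>b \<le> 1\<close> \<open>0 \<le> a\<close> ab by (auto intro!: m_set[OF elim(2)])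
      have "measure (m \<omega>) {a..b} \<le> measure (m \<omega>) ({a..<b} \<union> {b})"
        using ab by (intro mm.finite_measure_mono sets.Un sets) auto
      also have "\<dots> \<le> measure (m \<omega>) {a..<b} + measure (m \<omega>) {b}"
        by (rule measure_Un_le[OF sets(2,3)])
      also have "measure (m \<omega>) {b} = 0" using elim(3) b by (simp add: measure_def)
      finally have ab_le: "measure (m \<omega>) {a..b} \<le> measure (m \<omega>) {a..<b}" by simp
      have "(\<lambda>i. \<integral>y. tent a b (real (Suc i)) y \<partial>m \<omega>) \<longlonglongrightarrow> (\<integral>y. indicator {a..b} y \<partial>m \<omega>)"
      proof (rule integral_dominated_convergence[where w="\<lambda>_. 1"])
        show "AE x in m \<omega>. (\<lambda>i. tent a b (real (Suc i)) x) \<longlonglongrightarrow> indicator {a..b} x"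
        proof (rule AE_I2)
          fix x
          show "(\<lambda>i. tent a b (real (Suc i)) x) \<longlonglongrightarrow> indicator {a..b} x"
          proof (cases "x \<in> {a..b}")
            case False
            define d where "d = max (a - x) (x - b)"
            have "0 < d" using False by (auto simp: d_def)
            then obtain j where j: "1 / real (Suc j) < d" using nat_approx_posE by blast
            have "tent a b (real (Suc i)) x = 0" if "j \<le> i" for i
            proof (rule tent_eq_0)
              have "1 / real (Suc i) \<le> 1 / real (Suc j)" using that by (intro divide_left_mono) auto
              then show "x \<le> a - 1 / real (Suc i) \<or> b + 1 / real (Suc i) \<le> x" using j by (auto simp: d_def max_def split: if_splits)
            qed simp
            then have "eventually (\<lambda>i. tent a b (real (Suc i)) x = 0) sequentially"
              unfolding eventually_sequentially by blast
            then show ?thesis using False by (simp add: tendsto_eventually)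
          qed (simp add: tent_eq_1)
        qed
        show "AE x in m \<omega>. norm (tent a b (real (Suc i)) x) \<le> 1" for i using tent_bounds(3)[of "real (Suc i)" a b] by simp
        show "tent a b (real (Suc i)) \<in> borel_measurable (m \<omega>)" for i
          by (rule m_borel[OF elim(2) borel_measurable_continuous_onI[OF tent_continuous]])
      qed (use sets in auto)
      also have "(\<integral>y. indicator {a..b} y \<partial>m \<omega>) = measure (m \<omega>) {a..b}" using sets by simp
      finally have "eventually (\<lambda>i. (\<integral>y. tent a b (real (Suc i)) y \<partial>m \<omega>) < measure (m \<omega>) {a..<b} + e) sequentially"
        by (rule order_tendstoD(2)) (use ab_le e in simp)
      then obtain i where i: "(\<integral>y. tent a b (real (Suc i)) y \<partial>m \<omega>) < measure (m \<omega>) {a..<b} + e"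
        by (auto simp: eventually_sequentially)
      have "(\<lambda>k. \<integral>y. tent a b (real (Suc i)) y \<partial>cascade_approx l X (k + n) \<omega>) \<longlonglongrightarrow> (\<integral>y. tent a b (real (Suc i)) y \<partial>m \<omega>)"
        by (rule LIMSEQ_ignore_initial_segment[OF weak[OF tent_continuous]])
      then have "\<forall>\<^sub>F k in sequentially. (\<integral>y. tent a b (real (Suc i)) y \<partial>cascade_approx l X (k + n) \<omega>) < measure (m \<omega>) {a..<b} + e"
        by (rule order_tendstoD(2)) (rule i)
      then show ?thesis
      proof eventually_elim
        case (elim k)
        have "stage_mass k u \<omega> \<le> (\<integral>y. tent a b (real (Suc i)) y \<partial>cascade_approx l X (n + k) \<omega>)"
          by (rule stage_mass_le_integral[OF tent_continuous _ _ _ u]) (auto simp: Iu tent_bounds tent_eq_1)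
        then show ?case using elim Iu by (simp add: add.commute)
      qed
    qed
    have "(\<lambda>k. stage_mass k u \<omega>) \<longlonglongrightarrow> measure (m \<omega>) (ladic_interval l u)" if u: "is_word u" for u
    proof (rule tendsto_of_upper_bounds[where R="words_of_length l (length u)"])
      have "stage_mass k [] \<omega> = Y 1 k [] \<omega>" for k by (simp add: stage_mass_def)
      then show "(\<lambda>k. \<Sum>v\<in>words_of_length l (length u). stage_mass k v \<omega>) \<longlonglongrightarrow> measure (m \<omega>) {0..1}"
        using stage_mass_add[of _ "[]" \<omega> "length u"] LIMSEQ_ignore_initial_segment[OF tot, of "length u"] by simp
      have dj: "disjoint_family_on (ladic_interval l) (words_of_length l (length u))"
        unfolding disjoint_family_on_def using ladic_interval_unique[OF l_pos] by blast
      have s: "ladic_interval l v \<in> sets (m \<omega>)" if "v \<in> words_of_length l (length u)" for v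
        using ladic_interval_subset_unit[OF l_pos that] by (intro m_set[OF elim(2)]) auto
      have "(\<Sum>v\<in>words_of_length l (length u). measure (m \<omega>) (ladic_interval l v))
         = measure (m \<omega>) (\<Union>v\<in>words_of_length l (length u). ladic_interval l v)"
        using s by (intro mm.finite_measure_finite_Union[symmetric] dj) auto
      also have "\<dots> \<le> measure (m \<omega>) {0..1}"
      proof (rule mm.finite_measure_mono)
        show "(\<Union>v\<in>words_of_length l (length u). ladic_interval l v) \<subseteq> {0..1}"
          using ladic_interval_subset_unit[OF l_pos] by fastforce
        show "{0..1} \<in> sets (m \<omega>)" using m_space[OF elim(2)] sets.top by metis
      qed
      finally show "(\<Sum>v\<in>words_of_length l (length u). measure (m \<omega>) (ladic_interval l v)) \<le> measure (m \<omega>) {0..1}" .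
    qed (use u up in \<open>auto simp: words_of_length_iff\<close>)
    then show ?case using tot by blast
  qed
qed

text \<open>
  The convergence of the masses of all subtrees is read off from the weak convergence of the approximations.
\<close>

lemma nondegenerate_1:
  assumes "\<not> (AE \<omega> in M. emeasure (m \<omega>) {0..1} = 0)"
  shows "nondegenerate 1"
  unfolding nondegenerate_def
proof (intro conjI allI impI notI)
  fix u assume u: "is_word u"
  show "AE \<omega> in M. convergent (\<lambda>k. Y 1 k u \<omega>)"
    using AE_stage_mass_limit
  proof eventually_elim
    case (elim \<omega>)
    define b where "b = real l ^ length u / Q u \<omega>"
    have "Y 1 k u \<omega> = b * stage_mass k u \<omega>" for k
      using Q_pos[of u \<omega>] l_pos by (simp add: stage_mass_def b_def)
    moreover have "(\<lambda>k. b * stage_mass k u \<omega>) \<longlonglongrightarrow> b * measure (m \<omega>) (ladic_interval l u)"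
      using elim u by (intro tendsto_mult tendsto_const) simp
    ultimately show ?case by (auto intro: convergentI)
  qed
next
  assume "AE \<omega> in M. (\<lambda>k. Y 1 k [] \<omega>) \<longlonglongrightarrow> 0"
  then have "AE \<omega> in M. emeasure (m \<omega>) {0..1} = 0"
    using AE_stage_mass_limit AE_space
  proof eventually_elim
    case (elim \<omega>)
    then have "measure (m \<omega>) {0..1} = 0" using LIMSEQ_unique by blast
    then show ?case using finite_measure.emeasure_eq_measure[OF m_finite[OF elim(3)], of "{0..1}"] by simp
  qed
  then show False using assms by simp
qed

lemma AE_measure_eq_mass:
  assumes "nondegenerate 1"
  shows "AE \<omega> in M. \<forall>u. is_word u \<longrightarrow> measure (m \<omega>) (ladic_interval l u) = mass 1 u \<omega>"
  using AE_stage_mass_limit Y_tendsto_Z[OF assms]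
proof eventually_elim
  case (elim \<omega>)
  show ?case
  proof (intro allI impI)
    fix u assume u: "is_word u"
    have "(\<lambda>k. stage_mass k u \<omega>) \<longlonglongrightarrow> Q u \<omega> / real l ^ length u * Z 1 u \<omega>"
      unfolding stage_mass_def using elim u by (intro tendsto_mult tendsto_const) simp
    moreover have "Q u \<omega> / real l ^ length u * Z 1 u \<omega> = mass 1 u \<omega>"
      using Q_pos[of u \<omega>] by (simp add: mass_def c_1)
    ultimately show "measure (m \<omega>) (ladic_interval l u) = mass 1 u \<omega>"
      using elim u LIMSEQ_unique by metis
  qed
qed

end

lemma level_set_iff:
  assumes l: "2 \<le> l" and x: "x \<in> {0..<1}"
    and U: "\<And>n. U n \<in> words_of_length l n" "\<And>n. x \<in> ladic_interval l (U n)"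
    and v: "\<And>n. measure \<nu> (ladic_interval l (U n)) = v n" "\<And>n. 0 < v n"
  shows "x \<in> level_set l \<nu> \<beta> \<longleftrightarrow> (\<lambda>n. ln (v n) / (- (real n * ln (real l)))) \<longlonglongrightarrow> \<beta>"
proof -
  have l0: "0 < l" using l by simp
  have at: "ladic_interval_at l n x = ladic_interval l (U n)" for n
    by (rule ladic_interval_at_eq[OF l0 U])
  have "ln (measure lborel (ladic_interval l (U n))) = - (real n * ln (real l))" for n
    using U(1)[of n] l0 by (simp add: measure_ladic_interval ln_div ln_realpow words_of_length_def)
  then show ?thesis unfolding level_set_def using x v by (simp add: at)
qed

context cascade_measure
begin

section \<open>Rates in terms of the structure function\<close>

definition T :: "real \<Rightarrow> real" where "T = structure_function M l (X [0])"

lemma T_eq: "T q = log (real l) (mom q) - (q - 1)"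
  by (simp add: T_def structure_function_def mom_def)

lemma T_1: "T 1 = 0" by (simp add: T_eq unit_mean)

lemma l_gt_1: "1 < real l" using l_ge_2 by simp

lemma c_eq: "c q = real l powr (T q + q)"
proof -
  have "T q + q = log (real l) (mom q) + 1" by (simp add: T_eq)
  then show ?thesis using l_gt_1 mom_pos[of q] by (simp add: powr_add c_def)
qed

lemma l_mom: "real l * mom q = real l powr (T q + q)" using c_eq by (simp add: c_def)

lemma contraction_rate: "real l * mom (q * r) / c q powr r = real l powr (T (q * r) - r * T q)"
  by (simp add: l_mom c_eq powr_powr powr_diff[symmetric] algebra_simps)

lemma level_rate: "real l * mom (q * a + b) / (c q powr a * c 1 powr b) = real l powr (T (q * a + b) - a * T q)"
  by (simp add: l_mom c_eq T_1 powr_powr powr_add[symmetric] powr_diff[symmetric] algebra_simps)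

lemma l_powr_less_1: "real l powr y < 1 \<longleftrightarrow> y < 0"
proof -
  have "real l powr y < real l powr 0 \<longleftrightarrow> y < 0" by (rule powr_less_cancel_iff[OF l_gt_1])
  then show ?thesis using l_gt_1 by simp
qed

end

locale cascade_exponent = cascade_measure +
  fixes T' :: "real \<Rightarrow> real" and q \<beta> :: real
  assumes T_smooth: "smooth_convex T T'"
    and slope: "T' q = - \<beta>" and q_in: "q \<in> q_range T"
    and nd1: "nondegenerate 1"
begin

sublocale sc: smooth_convex T T' by (rule T_smooth)

text \<open>
  The value of the Legendre transform at \<open>\<beta>\<close>, which is the dimension to be established.
\<close>

definition dm :: real where "dm = T q + q * \<beta>"

lemma dm_pos: "0 < dm"
  using q_in slope by (simp add: sc.q_range_iff dm_def)

text \<open>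
  The exponent that governs the contraction of the moments of order \<open>1 + p\<close> of the cascade of exponent \<open>q\<close> vanishes at
  \<open>p = 0\<close>, and its slope there is \<open>- dm\<close>. The term \<open>s * p\<close> accounts for the comparison of the flow with
  \<open>l powr (- n * s)\<close>, so that \<open>s < dm\<close> is what keeps the total exponent negative for small \<open>p\<close>.
\<close>

lemma scaled_slope: "((\<lambda>p. T (q * (1 + p)) - (1 + p) * T q + s * p) has_real_derivative (s - dm)) (at 0)"
proof -
  have "((\<lambda>p. T (q * (1 + p))) has_real_derivative (T' (q * (1 + 0)) * q)) (at 0)"
    by (rule DERIV_chain2[OF sc.t_deriv]) (auto intro!: derivative_eq_intros)
  then show ?thesis by (auto intro!: derivative_eq_intros simp: slope dm_def algebra_simps)
qed

lemma small_exponent: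
  assumes "s < dm"
  obtains e where "0 < e" "e \<le> 1" "T (q * (1 + e)) - (1 + e) * T q + s * e < 0"
proof -
  obtain d where d: "0 < d" "\<And>h. 0 < h \<Longrightarrow> h < d \<Longrightarrow> T (q * (1 + (0 + h))) - (1 + (0 + h)) * T q + s * (0 + h) < T (q * (1 + 0)) - (1 + 0) * T q + s * 0"
    using DERIV_neg_dec_right[OF scaled_slope, of s] assms by auto
  define e where "e = min 1 (d / 2)"
  have "0 < e" "e < d" using d(1) by (auto simp: e_def)
  then show ?thesis using d(2)[of e] by (intro that[of e]) (auto simp: e_def)
qed

lemma bounded_q:
  assumes "0 < e" "e \<le> 1" "T (q * (1 + e)) - (1 + e) * T q < 0"
  shows "bounded_moment q (1 + e)"
  by (rule bounded_moment_step[OF _ bounded_moment_le_1]) (use assms in \<open>auto simp: contraction_rate l_powr_less_1\<close>)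

lemma nd_q: "nondegenerate q"
proof -
  obtain e where e: "0 < e" "e \<le> 1" "T (q * (1 + e)) - (1 + e) * T q + 0 * e < 0"
    using small_exponent[OF dm_pos] by blast
  then show ?thesis
    by (intro nondegenerateI[of "1 + e"]) (auto simp: contraction_rate l_powr_less_1)
qed

lemma bounded_1_negative: "p < 0 \<Longrightarrow> bounded_moment 1 p"
  using bounded_negative_moment[OF nd1, of "- p / 2"] by simp

lemma bounded_1_q: "bounded_moment 1 q"
proof (cases "q < 0")
  case False
  show ?thesis
  proof (rule bounded_moment_iterate)
    fix r assume "1 < r" "r \<le> q"
    then have "T r < 0" using sc.negative_beyond_1[OF T_1 q_in] by blast
    then show "real l * mom (1 * r) / c 1 powr r < 1"
      using contraction_rate[of 1 r] by (simp add: T_1 l_powr_less_1)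
  qed (use False in simp)
qed (rule bounded_1_negative)

section \<open>Almost sure level sums\<close>

lemma l_powr_power: "(real l powr y) ^ n = real l powr (y * real n)"
  using l_gt_1 by (simp add: powr_powr flip: powr_realpow)

lemma AE_upper_sums:
  assumes "dm < s" "\<eta> < s - dm"
  shows "AE \<omega> in M. summable (\<lambda>n. \<Sum>u\<in>words_of_length l n. mass q u \<omega> powr 0 * mass 1 u \<omega> powr q * (real l powr (q * \<beta> + \<eta> - s)) ^ n)"
proof -
  obtain C where C: "0 \<le> C" "\<And>k u. is_word u \<Longrightarrow> (\<integral>\<^sup>+\<omega>. ennreal (Y 1 k u \<omega> powr q) \<partial>M) \<le> ennreal C"
    using bounded_1_q unfolding bounded_moment_def by blast
  show ?thesis
  proof (rule AE_summable_level_sums[OF nd_q nd1 C(1)])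
    show "(\<integral>\<^sup>+\<omega>. ennreal (Y q k u \<omega> powr 0 * Y 1 k u \<omega> powr q) \<partial>M) \<le> ennreal C" if "is_word u" for k u
      using C(2)[OF that, of k] Y_pos[of q k u] by (simp add: less_imp_neq[symmetric])
    have "real l powr (T (q * 0 + q) - 0 * T q) * real l powr (q * \<beta> + \<eta> - s) = real l powr (dm + \<eta> - s)"
      by (simp add: powr_add[symmetric] dm_def algebra_simps)
    then show "real l * mom (q * 0 + q) / (c q powr 0 * c 1 powr q) * real l powr (q * \<beta> + \<eta> - s) < 1"
      unfolding level_rate using assms by (simp add: l_powr_less_1)
  qed simp
qed

lemma AE_flow_sums:
  assumes "0 < e" "e \<le> 1" "0 \<le> s" "T (q * (1 + e)) - (1 + e) * T q + s * e < 0"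
  shows "AE \<omega> in M. summable (\<lambda>n. \<Sum>u\<in>words_of_length l n. mass q u \<omega> powr (1 + e) * mass 1 u \<omega> powr 0 * (real l powr (s * e)) ^ n)"
proof -
  have "0 \<le> s * e" using assms by simp
  then have "T (q * (1 + e)) - (1 + e) * T q < 0" using assms by linarith
  then have "bounded_moment q (1 + e)" by (rule bounded_q[OF assms(1,2)])
  then obtain C where C: "0 \<le> C" "\<And>k u. is_word u \<Longrightarrow> (\<integral>\<^sup>+\<omega>. ennreal (Y q k u \<omega> powr (1 + e)) \<partial>M) \<le> ennreal C"
    unfolding bounded_moment_def by blast
  show ?thesis
  proof (rule AE_summable_level_sums[OF nd_q nd1 C(1)])
    show "(\<integral>\<^sup>+\<omega>. ennreal (Y q k u \<omega> powr (1 + e) * Y 1 k u \<omega> powr 0) \<partial>M) \<le> ennreal C" if "is_word u" for k u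
      using C(2)[OF that, of k] Y_pos[of 1 k u] by (simp add: less_imp_neq[symmetric])
    have "real l powr (T (q * (1 + e) + 0) - (1 + e) * T q) * real l powr (s * e) = real l powr (T (q * (1 + e)) - (1 + e) * T q + s * e)"
      by (simp add: powr_add[symmetric])
    then show "real l * mom (q * (1 + e) + 0) / (c q powr (1 + e) * c 1 powr 0) * real l powr (s * e) < 1"
      unfolding level_rate using assms by (simp add: l_powr_less_1)
  qed simp
qed

text \<open>
  The masses of the two cascades at \<open>u\<close> are dependent; \<open>joint_moment\<close> separates them, at the cost of multiplying
  \<open>e\<close> by \<open>p / (p - 1)\<close>. The resulting moment is bounded for small positive and for all negative \<open>e\<close>.
\<close>

lemma AE_local_sums:
  assumes e: "T (q + e) - T q + \<gamma> * e < 0" and p: "1 < p" "bounded_moment q p" "e * (p / (p - 1)) \<le> 1" "e \<noteq> 0"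
  shows "AE \<omega> in M. summable (\<lambda>n. \<Sum>u\<in>words_of_length l n. mass q u \<omega> powr 1 * mass 1 u \<omega> powr e * (real l powr (\<gamma> * e)) ^ n)"
proof -
  have "bounded_moment 1 (e * (p / (p - 1)))"
  proof (cases "0 < e")
    case True
    then show ?thesis using p by (intro bounded_moment_le_1) auto
  next
    case False
    then have "e < 0" using p(4) by simp
    moreover have "0 < p / (p - 1)" using p(1) by simp
    ultimately show ?thesis by (intro bounded_1_negative mult_neg_pos)
  qed
  then obtain C where C: "0 \<le> C" "\<And>k u. is_word u \<Longrightarrow> (\<integral>\<^sup>+\<omega>. ennreal (Y q k u \<omega> powr 1 * Y 1 k u \<omega> powr e) \<partial>M) \<le> ennreal C"
    using joint_moment[OF p(1,2)] by blast
  show ?thesis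
  proof (rule AE_summable_level_sums[OF nd_q nd1 C])
    have "real l powr (T (q * 1 + e) - 1 * T q) * real l powr (\<gamma> * e) = real l powr (T (q + e) - T q + \<gamma> * e)"
      by (simp add: powr_add[symmetric])
    then show "real l * mom (q * 1 + e) / (c q powr 1 * c 1 powr e) * real l powr (\<gamma> * e) < 1"
      unfolding level_rate using e by (simp add: l_powr_less_1)
  qed simp_all
qed

text \<open>
  To first order in \<open>e\<close> the two exponents are \<open>- \<epsilon> * e\<close> and \<open>\<epsilon> * e'\<close>, since \<open>T\<close> has slope \<open>- \<beta>\<close> at \<open>q\<close>.
\<close>

lemma small_tilts:
  assumes \<epsilon>: "0 < \<epsilon>" and K: "0 < K"
  obtains e e' where "0 < e" "e * K \<le> 1" "T (q + e) - T q + (\<beta> - \<epsilon>) * e < 0"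
    "e' < 0" "T (q + e') - T q + (\<beta> + \<epsilon>) * e' < 0"
proof -
  have dv: "((\<lambda>h. T (q + h) - T q + \<gamma> * h) has_real_derivative (\<gamma> - \<beta>)) (at 0)" for \<gamma>
  proof -
    have "((\<lambda>h. T (q + h)) has_real_derivative (T' (q + 0) * 1)) (at 0)"
      by (rule DERIV_chain2[OF sc.t_deriv]) (auto intro!: derivative_eq_intros)
    then show ?thesis by (auto intro!: derivative_eq_intros simp: slope)
  qed
  obtain d where d: "0 < d" "\<And>h. 0 < h \<Longrightarrow> h < d \<Longrightarrow> T (q + (0 + h)) - T q + (\<beta> - \<epsilon>) * (0 + h) < T (q + 0) - T q + (\<beta> - \<epsilon>) * 0"
    using DERIV_neg_dec_right[OF dv, of "\<beta> - \<epsilon>"] \<epsilon> by auto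
  obtain d' where d': "0 < d'" "\<And>h. 0 < h \<Longrightarrow> h < d' \<Longrightarrow> T (q + (0 - h)) - T q + (\<beta> + \<epsilon>) * (0 - h) < T (q + 0) - T q + (\<beta> + \<epsilon>) * 0"
    using DERIV_pos_inc_left[OF dv, of "\<beta> + \<epsilon>"] \<epsilon> by auto
  define e where "e = min (1 / K) (d / 2)"
  have "0 < e" "e < d" "e \<le> 1 / K" using d(1) K by (auto simp: e_def)
  then have "e * K \<le> 1" using K by (simp add: le_divide_eq)
  then show ?thesis
    using that[of e "- (d' / 2)"] d(2)[OF \<open>0 < e\<close> \<open>e < d\<close>] d'(1) d'(2)[of "d' / 2"] \<open>0 < e\<close> by simp
qed

section \<open>Dimension bounds\<close>

lemma AE_good:
  "AE \<omega> in M. (\<forall>u. is_word u \<longrightarrow> 0 < mass q u \<omega> \<and> mass q u \<omega> = (\<Sum>j<l. mass q (u @ [j]) \<omega>)) \<and>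
     (\<forall>u. is_word u \<longrightarrow> 0 < mass 1 u \<omega>) \<and> (\<forall>u. is_word u \<longrightarrow> measure (m \<omega>) (ladic_interval l u) = mass 1 u \<omega>)"
  using AE_mass_flow[OF nd_q] AE_mass_flow[OF nd1] AE_measure_eq_mass[OF nd1]
  by eventually_elim blast

text \<open>
  \<open>G\<close> collects the words for which the \<open>q\<close>-th power of the mass has at least its typical size, up to \<open>\<eta>\<close>. Working with
  the \<open>q\<close>-th power treats both signs of \<open>q\<close> alike.
\<close>

lemma AE_hausdorff_measure_eq_0:
  assumes s: "dm < s"
  shows "AE \<omega> in M. hausdorff_measure s (level_set l (m \<omega>) \<beta>) = 0"
proof -
  define \<eta> where "\<eta> = (s - dm) / 2"
  have \<eta>: "0 < \<eta>" "\<eta> < s - dm" using s by (simp_all add: \<eta>_def)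
  show ?thesis
    using AE_upper_sums[OF s \<eta>(2)] AE_good
  proof eventually_elim
    case (elim \<omega>)
    define v where "v u = mass 1 u \<omega>" for u
    have v: "0 < v u" "measure (m \<omega>) (ladic_interval l u) = v u" if "is_word u" for u
      using elim(2) that by (auto simp: v_def)
    define G where "G = {u. is_word u \<and> real l powr (- (q * \<beta> + \<eta>) * real (length u)) \<le> v u powr q}"
    show ?case
    proof (rule hausdorff_measure_eq_0[OF l_ge_2, where G=G])
      show "0 < s" using s dm_pos by simp
      show "level_set l (m \<omega>) \<beta> \<subseteq> {0..<1}" by (auto simp: level_set_def)
      show "\<exists>n0. \<forall>n\<ge>n0. \<forall>u\<in>words_of_length l n. x \<in> ladic_interval l u \<longrightarrow> u \<in> G"
        if x: "x \<in> level_set l (m \<omega>) \<beta>" for x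
      proof -
        have x01: "x \<in> {0..<1}" using x by (auto simp: level_set_def)
        have "\<exists>u. u \<in> words_of_length l n \<and> x \<in> ladic_interval l u" for n
          using ladic_interval_exists[OF l_pos x01, of n] by blast
        then obtain U where U: "\<And>n. U n \<in> words_of_length l n" "\<And>n. x \<in> ladic_interval l (U n)" by metis
        have wU: "is_word (U n)" "length (U n) = n" for n using U(1)[of n] by (simp_all add: words_of_length_iff)
        have "(\<lambda>n. ln (v (U n)) / (- (real n * ln (real l)))) \<longlonglongrightarrow> \<beta>"
          using x level_set_iff[OF l_ge_2 x01 U, of "m \<omega>" "\<lambda>n. v (U n)"] v wU by auto
        then have "(\<lambda>n. q * (ln (v (U n)) / (- (real n * ln (real l))))) \<longlonglongrightarrow> q * \<beta>"
          by (intro tendsto_mult tendsto_const)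
        then have "eventually (\<lambda>n. q * (ln (v (U n)) / (- (real n * ln (real l)))) < q * \<beta> + \<eta>) sequentially"
          by (rule order_tendstoD(2)) (use \<eta> in simp)
        then obtain n0 where n0: "\<And>n. n \<ge> n0 \<Longrightarrow> q * (ln (v (U n)) / (- (real n * ln (real l)))) < q * \<beta> + \<eta>"
          by (auto simp: eventually_sequentially)
        show ?thesis
        proof (intro exI[of _ "max n0 1"] allI ballI impI)
          fix n u assume n: "max n0 1 \<le> n" and u: "u \<in> words_of_length l n" "x \<in> ladic_interval l u"
          have uU: "u = U n" by (rule ladic_interval_unique[OF l_pos u(1) U(1) u(2) U(2)])
          have nl: "0 < real n * ln (real l)" using n l_gt_1 by simp
          have "- (q * ln (v u)) / (real n * ln (real l)) < q * \<beta> + \<eta>" using n0[of n] n by (simp add: uU)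
          then have "- (q * ln (v u)) < (q * \<beta> + \<eta>) * (real n * ln (real l))" unfolding pos_divide_less_eq[OF nl] .
          then have "(- (q * \<beta> + \<eta>) * real n) * ln (real l) \<le> q * ln (v u)" by (simp add: algebra_simps)
          then have "real l powr (- (q * \<beta> + \<eta>) * real n) \<le> v u powr q"
            using l_gt_1 v(1)[of u] wU uU by (simp add: powr_def)
          then show "u \<in> G" using u(1) by (simp add: G_def words_of_length_iff)
        qed
      qed
      show "summable (\<lambda>n. \<Sum>u\<in>words_of_length l n \<inter> G. ((1 / real l) powr s) ^ n)"
      proof (rule summable_comparison_test'[where N=0])
        show "summable (\<lambda>n. \<Sum>u\<in>words_of_length l n. mass q u \<omega> powr 0 * mass 1 u \<omega> powr q * (real l powr (q * \<beta> + \<eta> - s)) ^ n)"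
          by (rule elim(1))
        fix n :: nat
        have "(\<Sum>u\<in>words_of_length l n \<inter> G. ((1 / real l) powr s) ^ n)
           \<le> (\<Sum>u\<in>words_of_length l n \<inter> G. mass q u \<omega> powr 0 * mass 1 u \<omega> powr q * (real l powr (q * \<beta> + \<eta> - s)) ^ n)"
        proof (rule sum_mono)
          fix u assume u: "u \<in> words_of_length l n \<inter> G"
          then have wu: "is_word u" "length u = n" by (auto simp: words_of_length_iff)
          have "((1 / real l) powr s) ^ n = real l powr (- (q * \<beta> + \<eta>) * real n) * real l powr ((q * \<beta> + \<eta> - s) * real n)"
          proof -
            have "(1 / real l) powr s = real l powr (- s)" by (simp add: powr_minus_divide powr_divide)
            then show ?thesis by (simp add: l_powr_power powr_add[symmetric] algebra_simps)
          qed
          also have "\<dots> \<le> v u powr q * real l powr ((q * \<beta> + \<eta> - s) * real n)"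
            using u wu by (intro mult_right_mono) (auto simp: G_def)
          finally have le: "((1 / real l) powr s) ^ n \<le> v u powr q * real l powr ((q * \<beta> + \<eta> - s) * real n)" .
          show "((1 / real l) powr s) ^ n \<le> mass q u \<omega> powr 0 * mass 1 u \<omega> powr q * (real l powr (q * \<beta> + \<eta> - s)) ^ n"
          proof -
            have "0 < mass q u \<omega>" using elim(2) wu(1) by blast
            then have "mass q u \<omega> powr 0 = 1" by simp
            then show ?thesis using le by (simp only: v_def l_powr_power mult_1)
          qed
        qed
        also have "\<dots> \<le> (\<Sum>u\<in>words_of_length l n. mass q u \<omega> powr 0 * mass 1 u \<omega> powr q * (real l powr (q * \<beta> + \<eta> - s)) ^ n)"
          by (intro sum_mono2) auto
        finally show "norm (\<Sum>u\<in>words_of_length l n \<inter> G. ((1 / real l) powr s) ^ n)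
           \<le> (\<Sum>u\<in>words_of_length l n. mass q u \<omega> powr 0 * mass 1 u \<omega> powr q * (real l powr (q * \<beta> + \<eta> - s)) ^ n)"
          by (simp add: sum_nonneg)
      qed
    qed
  qed
qed

text \<open>
  Markov's inequality on each level.
\<close>

lemma summable_on_bad:
  fixes f :: "nat list \<Rightarrow> real"
  assumes sm: "summable (\<lambda>n. \<Sum>u\<in>words_of_length l n. f u * g u * x ^ n)"
    and f: "\<And>u. is_word u \<Longrightarrow> 0 \<le> f u" and g: "\<And>u. 0 \<le> g u" and x: "0 \<le> x"
  shows "summable (\<lambda>n. \<Sum>u\<in>words_of_length l n \<inter> {u. is_word u \<and> 1 \<le> g u * x ^ length u}. f u)"
proof (rule summable_comparison_test'[where N=0, OF sm])
  fix n :: nat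
  let ?B = "{u. is_word u \<and> 1 \<le> g u * x ^ length u}"
  have "(\<Sum>u\<in>words_of_length l n \<inter> ?B. f u) \<le> (\<Sum>u\<in>words_of_length l n \<inter> ?B. f u * g u * x ^ n)"
  proof (rule sum_mono)
    fix u assume "u \<in> words_of_length l n \<inter> ?B"
    then have "0 \<le> f u" "1 \<le> g u * x ^ n" using f by (auto simp: words_of_length_iff)
    then show "f u \<le> f u * g u * x ^ n" using mult_left_mono[of 1 "g u * x ^ n" "f u"] by (simp add: mult.assoc)
  qed
  also have "\<dots> \<le> (\<Sum>u\<in>words_of_length l n. f u * g u * x ^ n)"
    using f g x by (intro sum_mono2) (auto simp: words_of_length_iff)
  moreover have "0 \<le> (\<Sum>u\<in>words_of_length l n \<inter> ?B. f u)" using f by (intro sum_nonneg) simp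
  ultimately show "norm (\<Sum>u\<in>words_of_length l n \<inter> ?B. f u) \<le> (\<Sum>u\<in>words_of_length l n. f u * g u * x ^ n)"
    by simp
qed

text \<open>
  The flow is the limit mass of the cascade of exponent \<open>q\<close>. \<open>B0\<close> contains the words that carry too much flow for
  dimension \<open>s\<close>, \<open>B1 i\<close> and \<open>B2 i\<close> those whose mass is too large or too small for the local dimension \<open>\<beta>\<close>, with
  tolerance \<open>1 / Suc i\<close>. A path that eventually avoids all of them has local dimension exactly \<open>\<beta>\<close>.
\<close>

lemma AE_hausdorff_measure_nonzero:
  assumes s: "0 < s" "s < dm"
  shows "AE \<omega> in M. \<forall>t. 0 \<le> t \<longrightarrow> t \<le> s \<longrightarrow> hausdorff_measure t (level_set l (m \<omega>) \<beta>) \<noteq> 0"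
proof -
  obtain a where a: "0 < a" "a \<le> 1" "T (q * (1 + a)) - (1 + a) * T q + s * a < 0"
    using small_exponent[OF s(2)] by blast
  obtain p where p: "1 < p" "bounded_moment q p"
  proof -
    have "0 \<le> s * a" using s a by simp
    then have "T (q * (1 + a)) - (1 + a) * T q < 0" using a by linarith
    then show ?thesis using that[of "1 + a"] bounded_q[OF a(1,2)] a(1) by simp
  qed
  define K where "K = p / (p - 1)"
  have K: "0 < K" using p by (simp add: K_def)
  have "\<exists>e e'. 0 < e \<and> e * K \<le> 1 \<and> T (q + e) - T q + (\<beta> - 1 / real (Suc i)) * e < 0 \<and>
    e' < 0 \<and> T (q + e') - T q + (\<beta> + 1 / real (Suc i)) * e' < 0" for i
    using small_tilts[of "1 / real (Suc i)" K] K by (metis zero_less_divide_1_iff of_nat_0_less_iff zero_less_Suc)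
  then obtain e e' where e: "\<And>i. 0 < e i" "\<And>i. e i * K \<le> 1" "\<And>i. T (q + e i) - T q + (\<beta> - 1 / real (Suc i)) * e i < 0"
    and e': "\<And>i. e' i < 0" "\<And>i. T (q + e' i) - T q + (\<beta> + 1 / real (Suc i)) * e' i < 0" by metis
  have e'K: "e' i * K \<le> 1" for i using mult_neg_pos[OF e'(1) K, of i] by simp
  have sums1: "AE \<omega> in M. \<forall>i. summable (\<lambda>n. \<Sum>u\<in>words_of_length l n. mass q u \<omega> powr 1 * mass 1 u \<omega> powr (e i) * (real l powr ((\<beta> - 1 / real (Suc i)) * e i)) ^ n)"
    unfolding AE_all_countable
    by (intro allI AE_local_sums[OF e(3) p]) (use e(1,2) in \<open>auto simp: K_def less_imp_neq[symmetric]\<close>)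
  have sums2: "AE \<omega> in M. \<forall>i. summable (\<lambda>n. \<Sum>u\<in>words_of_length l n. mass q u \<omega> powr 1 * mass 1 u \<omega> powr (e' i) * (real l powr ((\<beta> + 1 / real (Suc i)) * e' i)) ^ n)"
    unfolding AE_all_countable
    by (intro allI AE_local_sums[OF e'(2) p]) (use e'(1) e'K in \<open>auto simp: K_def less_imp_neq\<close>)
  show ?thesis
    using AE_flow_sums[OF a(1,2) less_imp_le[OF s(1)] a(3)] sums1 sums2 AE_good
  proof eventually_elim
    case (elim \<omega>)
    define v where "v u = mass 1 u \<omega>" for u
    define \<Theta> where "\<Theta> u = (if is_word u then mass q u \<omega> else 0)" for u
    have v: "0 < v u" "measure (m \<omega>) (ladic_interval l u) = v u" if "is_word u" for u
      using elim(4) that by (auto simp: v_def)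
    have mq: "0 < mass q u \<omega>" if "is_word u" for u using elim(4) that by blast
    have \<Theta>p: "0 < \<Theta> u" "\<Theta> u = mass q u \<omega>" if "is_word u" for u using mq[OF that] that by (simp_all add: \<Theta>_def)
    have \<Theta>0: "0 \<le> \<Theta> u" for u using \<Theta>p(1)[of u] by (cases "is_word u") (simp_all add: \<Theta>_def)
    define B0 where "B0 = {u. is_word u \<and> 1 \<le> \<Theta> u powr a * (real l powr (s * a)) ^ length u}"
    define B1 where "B1 i = {u. is_word u \<and> 1 \<le> v u powr e i * (real l powr ((\<beta> - 1 / real (Suc i)) * e i)) ^ length u}" for i
    define B2 where "B2 i = {u. is_word u \<and> 1 \<le> v u powr e' i * (real l powr ((\<beta> + 1 / real (Suc i)) * e' i)) ^ length u}" for i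
    define Bad where "Bad j = (if j = 0 then B0 else B1 (j - 1) \<union> B2 (j - 1))" for j
    have sm0: "summable (\<lambda>n. \<Sum>u\<in>words_of_length l n \<inter> B0. \<Theta> u)"
      unfolding B0_def
    proof (rule summable_on_bad)
      have "(\<Sum>u\<in>words_of_length l n. \<Theta> u * \<Theta> u powr a * (real l powr (s * a)) ^ n)
         = (\<Sum>u\<in>words_of_length l n. mass q u \<omega> powr (1 + a) * mass 1 u \<omega> powr 0 * (real l powr (s * a)) ^ n)" for n
      proof (intro sum.cong refl)
        fix u assume "u \<in> words_of_length l n"
        then have "is_word u" by (simp add: words_of_length_iff)
        then show "\<Theta> u * \<Theta> u powr a * (real l powr (s * a)) ^ n = mass q u \<omega> powr (1 + a) * mass 1 u \<omega> powr 0 * (real l powr (s * a)) ^ n"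
          using \<Theta>p[of u] v(1)[of u] by (simp add: v_def powr_add)
      qed
      then show "summable (\<lambda>n. \<Sum>u\<in>words_of_length l n. \<Theta> u * \<Theta> u powr a * (real l powr (s * a)) ^ n)"
        using elim(1) by simp
    qed (use \<Theta>0 in auto)
    have sm12: "summable (\<lambda>n. \<Sum>u\<in>words_of_length l n \<inter> {u. is_word u \<and> 1 \<le> v u powr b * (real l powr x) ^ length u}. \<Theta> u)"
      if "summable (\<lambda>n. \<Sum>u\<in>words_of_length l n. mass q u \<omega> powr 1 * mass 1 u \<omega> powr b * (real l powr x) ^ n)" for b x
    proof (rule summable_on_bad)
      have "(\<Sum>u\<in>words_of_length l n. \<Theta> u * v u powr b * (real l powr x) ^ n)
         = (\<Sum>u\<in>words_of_length l n. mass q u \<omega> powr 1 * mass 1 u \<omega> powr b * (real l powr x) ^ n)" for n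
      proof (intro sum.cong refl)
        fix u assume "u \<in> words_of_length l n"
        then have "is_word u" by (simp add: words_of_length_iff)
        then show "\<Theta> u * v u powr b * (real l powr x) ^ n = mass q u \<omega> powr 1 * mass 1 u \<omega> powr b * (real l powr x) ^ n"
          using \<Theta>p[of u] by (simp add: v_def)
      qed
      then show "summable (\<lambda>n. \<Sum>u\<in>words_of_length l n. \<Theta> u * v u powr b * (real l powr x) ^ n)"
        using that by simp
    qed (use \<Theta>0 in auto)
    have smB: "summable (\<lambda>n. \<Sum>u\<in>words_of_length l n \<inter> Bad j. \<Theta> u)" for j
    proof (cases "j = 0")
      case True
      then show ?thesis using sm0 by (simp add: Bad_def)
    next
      case False
      have "summable (\<lambda>n. (\<Sum>u\<in>words_of_length l n \<inter> B1 (j - 1). \<Theta> u) + (\<Sum>u\<in>words_of_length l n \<inter> B2 (j - 1). \<Theta> u))"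
        unfolding B1_def B2_def using elim(2,3) by (intro summable_add sm12) auto
      then show ?thesis
      proof (rule summable_comparison_test'[where N=0])
        fix n :: nat
        have "(\<Sum>u\<in>words_of_length l n \<inter> Bad j. \<Theta> u) = (\<Sum>u\<in>(words_of_length l n \<inter> B1 (j - 1)) \<union> (words_of_length l n \<inter> B2 (j - 1)). \<Theta> u)"
          using False by (intro sum.cong) (auto simp: Bad_def)
        also have "\<dots> \<le> (\<Sum>u\<in>words_of_length l n \<inter> B1 (j - 1). \<Theta> u) + (\<Sum>u\<in>words_of_length l n \<inter> B2 (j - 1). \<Theta> u)"
          using \<Theta>0 by (subst sum_Un) (auto intro!: sum_nonneg)
        finally show "norm (\<Sum>u\<in>words_of_length l n \<inter> Bad j. \<Theta> u) \<le> (\<Sum>u\<in>words_of_length l n \<inter> B1 (j - 1). \<Theta> u) + (\<Sum>u\<in>words_of_length l n \<inter> B2 (j - 1). \<Theta> u)"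
          using \<Theta>0 by (simp add: sum_nonneg)
      qed
    qed
    have good: "\<Theta> u \<le> ((1 / real l) powr s) ^ length u" if "set u \<subseteq> {..<l}" "u \<notin> Bad 0" for u
    proof -
      have wu: "is_word u" using that(1) by (simp add: is_word_def)
      let ?y = "real l powr (s * real (length u))"
      have "\<Theta> u powr a * (real l powr (s * a)) ^ length u = (\<Theta> u * ?y) powr a"
        using \<Theta>0[of u] by (simp add: powr_mult powr_powr l_powr_power mult_ac)
      moreover have "\<Theta> u powr a * (real l powr (s * a)) ^ length u < 1" using that(2) wu by (auto simp: Bad_def B0_def)
      ultimately have "\<not> 1 powr a \<le> (\<Theta> u * ?y) powr a" by simp
      then have "\<not> 1 \<le> \<Theta> u * ?y" using a(1) powr_mono2[of a 1 "\<Theta> u * ?y"] by auto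
      then have "\<Theta> u \<le> 1 / ?y" using l_gt_1 by (simp add: le_divide_eq)
      also have "1 / ?y = ((1 / real l) powr s) ^ length u"
      proof -
        have "(1 / real l) powr s = real l powr (- s)" by (simp add: powr_minus_divide powr_divide)
        then show ?thesis by (simp only: l_powr_power powr_minus_divide[symmetric] minus_mult_left)
      qed
      finally show ?thesis .
    qed
    have E: "x \<in> level_set l (m \<omega>) \<beta>"
      if x: "x \<in> {0..<1}" and ev: "\<And>j. \<exists>n0. \<forall>n\<ge>n0. \<forall>u\<in>words_of_length l n. x \<in> ladic_interval l u \<longrightarrow> u \<notin> Bad j" for x
    proof -
      have "\<exists>u. u \<in> words_of_length l n \<and> x \<in> ladic_interval l u" for n
        using ladic_interval_exists[OF l_pos x, of n] by blast
      then obtain U where U: "\<And>n. U n \<in> words_of_length l n" "\<And>n. x \<in> ladic_interval l (U n)" by metis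
      have wU: "is_word (U n)" "length (U n) = n" for n using U(1)[of n] by (simp_all add: words_of_length_iff)
      have "(\<lambda>n. ln (v (U n)) / (- (real n * ln (real l)))) \<longlonglongrightarrow> \<beta>"
      proof (rule LIMSEQ_I)
        fix r :: real assume "0 < r"
        then obtain i where i: "1 / real (Suc i) < r" using nat_approx_posE by blast
        obtain n0 where n0: "\<And>n. n \<ge> n0 \<Longrightarrow> U n \<notin> Bad (Suc i)" using ev[of "Suc i"] U by blast
        show "\<exists>no. \<forall>n\<ge>no. norm (ln (v (U n)) / (- (real n * ln (real l))) - \<beta>) < r"
        proof (intro exI[of _ "max n0 1"] allI impI)
          fix n assume n: "max n0 1 \<le> n"
          define L where "L = real n * ln (real l)"
          have L: "0 < L" using n l_gt_1 by (simp add: L_def)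
          have vn: "0 < v (U n)" using v(1) wU by blast
          have lnB: "ln (v (U n) powr b * (real l powr (\<gamma> * b)) ^ n) = b * (ln (v (U n)) + \<gamma> * L)" for b \<gamma>
            using vn l_gt_1 by (simp add: ln_mult ln_powr l_powr_power L_def algebra_simps)
          have posB: "0 < v (U n) powr b * (real l powr (\<gamma> * b)) ^ n" for b \<gamma> using vn l_gt_1 by simp
          have "v (U n) powr e i * (real l powr ((\<beta> - 1 / real (Suc i)) * e i)) ^ n < 1"
            using n0[of n] n wU[of n] by (auto simp: Bad_def B1_def)
          then have "e i * (ln (v (U n)) + (\<beta> - 1 / real (Suc i)) * L) < 0"
            using posB lnB ln_less_zero by metis
          then have 1: "ln (v (U n)) + (\<beta> - 1 / real (Suc i)) * L < 0" using e(1)[of i] by (simp add: mult_less_0_iff)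
          have "v (U n) powr e' i * (real l powr ((\<beta> + 1 / real (Suc i)) * e' i)) ^ n < 1"
            using n0[of n] n wU[of n] by (auto simp: Bad_def B2_def)
          then have "e' i * (ln (v (U n)) + (\<beta> + 1 / real (Suc i)) * L) < 0"
            using posB lnB ln_less_zero by metis
          then have 2: "0 < ln (v (U n)) + (\<beta> + 1 / real (Suc i)) * L" using e'(1)[of i] by (simp add: mult_less_0_iff)
          have "\<beta> - 1 / real (Suc i) < - ln (v (U n)) / L" unfolding pos_less_divide_eq[OF L] using 1 by linarith
          moreover have "- ln (v (U n)) / L < \<beta> + 1 / real (Suc i)" unfolding pos_divide_less_eq[OF L] using 2 by linarith
          ultimately have "\<bar>- ln (v (U n)) / L - \<beta>\<bar> < r" using i by linarith
          then show "norm (ln (v (U n)) / (- (real n * ln (real l))) - \<beta>) < r" by (simp add: L_def)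
        qed
      qed
      then show ?thesis using level_set_iff[OF l_ge_2 x U, of "m \<omega>" "\<lambda>n. v (U n)"] v wU by auto
    qed
    have flow: "\<Theta> u = (\<Sum>j<l. \<Theta> (u @ [j]))" if "set u \<subseteq> {..<l}" for u
      using elim(4) that by (simp add: \<Theta>_def is_word_def)
    have pos: "0 < \<Theta> []" by (rule \<Theta>p) simp
    show ?case
    proof (intro allI impI)
      fix t assume t: "0 \<le> t" "t \<le> s"
      show "hausdorff_measure t (level_set l (m \<omega>) \<beta>) \<noteq> 0"
      proof (rule flow_mass_distribution[where l=l and s=s and \<Theta>=\<Theta> and Bad=Bad and E="level_set l (m \<omega>) \<beta>"])
        show "\<Theta> u = (\<Sum>j<l. \<Theta> (u @ [j]))" if "set u \<subseteq> {..<l}" for u using that by (rule flow)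
        show "\<Theta> u \<le> ((1 / real l) powr s) ^ length u" if "set u \<subseteq> {..<l}" "u \<notin> Bad 0" for u
          using that by (rule good)
        show "x \<in> level_set l (m \<omega>) \<beta>" if "x \<in> {0..<1}"
          "\<And>j. \<exists>n0. \<forall>n\<ge>n0. \<forall>u\<in>words_of_length l n. x \<in> ladic_interval l u \<longrightarrow> u \<notin> Bad j" for x
          using that by (rule E)
        show "hausdorff_measure t (level_set l (m \<omega>) \<beta>) \<noteq> 0"
          if "0 < \<delta>" "\<delta> \<le> 1" "0 < \<kappa>" "\<And>U :: nat \<Rightarrow> real set. level_set l (m \<omega>) \<beta> \<subseteq> (\<Union>i. U i) \<Longrightarrow>
            (\<And>i. bounded (U i)) \<Longrightarrow> (\<And>i. diameter (U i) \<le> \<delta>) \<Longrightarrow> ennreal \<kappa> \<le> (\<Sum>i. hausdorff_size s (U i))" for \<delta> \<kappa>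
          using that by (rule hausdorff_measure_nonzero[OF t s(1)])
      qed (rule l_ge_2 s(1) \<Theta>0 pos smB)+
    qed
  qed
qed

lemma AE_hausdorff_dim: "AE \<omega> in M. hausdorff_dim (level_set l (m \<omega>) \<beta>) = ereal dm"
proof -
  have up: "AE \<omega> in M. \<forall>j. hausdorff_measure (dm + 1 / real (Suc j)) (level_set l (m \<omega>) \<beta>) = 0"
    unfolding AE_all_countable by (intro allI AE_hausdorff_measure_eq_0) simp
  have lo: "AE \<omega> in M. \<forall>j. \<forall>t. 0 \<le> t \<longrightarrow> t \<le> dm * (1 - 1 / real (j + 2)) \<longrightarrow> hausdorff_measure t (level_set l (m \<omega>) \<beta>) \<noteq> 0"
    unfolding AE_all_countable[of "\<lambda>j \<omega>. \<forall>t. 0 \<le> t \<longrightarrow> t \<le> dm * (1 - 1 / real (j + 2)) \<longrightarrow> hausdorff_measure t (level_set l (m \<omega>) \<beta>) \<noteq> 0"]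
  proof (intro allI AE_hausdorff_measure_nonzero)
    fix j :: nat
    have "0 < 1 / real (j + 2)" "1 / real (j + 2) < 1" by simp_all
    then show "0 < dm * (1 - 1 / real (j + 2))" "dm * (1 - 1 / real (j + 2)) < dm"
      using dm_pos by (simp_all add: mult_less_cancel_left1)
  qed
  show ?thesis
    using up lo
  proof eventually_elim
    case (elim \<omega>)
    let ?E = "level_set l (m \<omega>) \<beta>"
    show ?case
    proof (rule antisym)
      show "hausdorff_dim ?E \<le> ereal dm"
      proof (rule ereal_le_epsilon2)
        fix e :: real assume "0 < e"
        then obtain j where j: "1 / real (Suc j) < e" using nat_approx_posE by blast
        have "hausdorff_dim ?E \<le> ereal (dm + 1 / real (Suc j))"
          unfolding hausdorff_dim_def using elim(1) dm_pos by (intro INF_lower) (auto intro: add_nonneg_nonneg)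
        also have "\<dots> \<le> ereal dm + ereal e" using j by simp
        finally show "hausdorff_dim ?E \<le> ereal dm + ereal e" .
      qed
      show "ereal dm \<le> hausdorff_dim ?E"
        unfolding hausdorff_dim_def
      proof (rule INF_greatest)
        fix t assume "t \<in> {s. 0 \<le> s \<and> hausdorff_measure s ?E = 0}"
        then have t: "0 \<le> t" "hausdorff_measure t ?E = 0" by auto
        show "ereal dm \<le> ereal t"
        proof (rule ccontr)
          assume "\<not> ?thesis"
          then have "0 < (dm - t) / dm" using dm_pos by simp
          then obtain j where j: "1 / real (Suc j) < (dm - t) / dm" using nat_approx_posE by blast
          have "1 / real (j + 2) \<le> 1 / real (Suc j)" by (intro divide_left_mono) auto
          then have "dm * (1 / real (j + 2)) \<le> dm * ((dm - t) / dm)" using j dm_pos by (intro mult_left_mono) auto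
          moreover have "dm * ((dm - t) / dm) = dm - t" using dm_pos by simp
          ultimately have "t \<le> dm * (1 - 1 / real (j + 2))" unfolding right_diff_distrib by linarith
          then show False using elim(2) t by blast
        qed
      qed
    qed
  qed
qed

end

section \<open>The dimension of the level sets\<close>

theorem theorem8:
  fixes M :: "'a measure" and l :: nat
    and W :: "'a \<Rightarrow> real" and Ws :: "nat list \<Rightarrow> 'a \<Rightarrow> real"
    and m :: "'a \<Rightarrow> real measure" and \<beta> :: real
  assumes "prob_space M"
    and "l \<ge> 2"
    and "W \<in> borel_measurable M"
    and "AE \<omega> in M. 0 \<le> W \<omega>"
    and "prob_space.expectation M W = 1"
    and "prob_space.indep_vars M (\<lambda>_. borel) Ws (words l)"
    and "\<And>\<epsilon>. \<epsilon> \<in> words l \<Longrightarrow> distr M borel (Ws \<epsilon>) = distr M borel W"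
    and "mandelbrot_cascade M l Ws m"
    and nondegenerate: "\<not> (AE \<omega> in M. emeasure (m \<omega>) {0..1} = 0)"
    and "prob_space.prob M {\<omega> \<in> space M. W \<omega> = 0} = 0"
    and "\<And>q :: real. integrable M (\<lambda>\<omega>. W \<omega> powr q)"
    and "- deriv_ext (structure_function M l W) (q_max (structure_function M l W)) < ereal \<beta>"
    and "ereal \<beta> < - deriv_ext (structure_function M l W) (q_min (structure_function M l W))"
  shows "AE \<omega> in M. hausdorff_dim (level_set l (m \<omega>) \<beta>) = legendre (structure_function M l W) \<beta>"
proof -
  interpret prob_space M by fact
  note [measurable] = assms(3)
  have Ws_meas: "Ws u \<in> borel_measurable M" if "u \<in> words l" for u
    using assms(6) that by (simp add: indep_vars_def)
  have W_pos: "AE \<omega> in M. 0 < W \<omega>"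
  proof -
    have "AE \<omega> in M. \<omega> \<notin> {\<omega> \<in> space M. W \<omega> = 0}" using assms(10) by (subst (asm) prob_eq_0) auto
    then show ?thesis using assms(4) AE_space by eventually_elim auto
  qed
  have Ws_pos: "AE \<omega> in M. 0 < Ws u \<omega>" if u: "u \<in> words l" for u
  proof -
    have "AE x in distr M borel W. 0 < x" using W_pos by (subst AE_distr_iff) auto
    then have "AE x in distr M borel (Ws u). 0 < x" unfolding assms(7)[OF u] .
    then show ?thesis using Ws_meas[OF u] by (subst (asm) AE_distr_iff) auto
  qed
  \<comment> \<open>Replacing nonpositive weights by \<open>1\<close> changes nothing almost surely.\<close>
  define \<phi> :: "real \<Rightarrow> real" where "\<phi> x = (if 0 < x then x else 1)" for x
  have [measurable]: "\<phi> \<in> borel_measurable borel" unfolding \<phi>_def[abs_def] by measurable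
  define X where "X u \<omega> = (if u \<in> words l then \<phi> (Ws u \<omega>) else 1)" for u \<omega>
  have X_meas: "X u \<in> borel_measurable M" for u
  proof (cases "u \<in> words l")
    case True
    note [measurable] = Ws_meas[OF True]
    have "X u = (\<lambda>\<omega>. \<phi> (Ws u \<omega>))" using True by (simp add: X_def fun_eq_iff)
    then show ?thesis by simp
  next
    case False
    then have "X u = (\<lambda>_. 1)" by (simp add: X_def fun_eq_iff)
    then show ?thesis by simp
  qed
  have X_distr: "distr M borel (X u) = distr M borel (\<lambda>\<omega>. \<phi> (W \<omega>))" if u: "u \<in> words l" for u
  proof -
    have "distr M borel (X u) = distr M borel (\<phi> \<circ> Ws u)" using u by (simp add: X_def comp_def fun_eq_iff cong: distr_cong)
    also have "\<dots> = distr (distr M borel (Ws u)) borel \<phi>" by (rule distr_distr[symmetric]) (use Ws_meas[OF u] in auto)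
    also have "\<dots> = distr (distr M borel W) borel \<phi>" by (simp add: assms(7)[OF u])
    also have "\<dots> = distr M borel (\<phi> \<circ> W)" by (rule distr_distr) auto
    finally show ?thesis by (simp add: comp_def)
  qed
  have phi_W: "AE \<omega> in M. \<phi> (W \<omega>) powr q = W \<omega> powr q" for q
    using W_pos by eventually_elim (simp add: \<phi>_def)
  have X_int: "integrable M (\<lambda>\<omega>. X u \<omega> powr q)" if u: "u \<in> words l" for u q
  proof -
    have "integrable M (\<lambda>\<omega>. \<phi> (W \<omega>) powr q)"
      using assms(11)[of q] phi_W[of q] by (subst integrable_cong_AE) auto
    then have "integrable (distr M borel (\<lambda>\<omega>. \<phi> (W \<omega>))) (\<lambda>x. x powr q)" by (subst integrable_distr_eq) auto
    then have "integrable (distr M borel (X u)) (\<lambda>x. x powr q)" unfolding X_distr[OF u] .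
    then show ?thesis using X_meas[of u] by (subst (asm) integrable_distr_eq) auto
  qed
  have X_expect: "expectation (\<lambda>\<omega>. X u \<omega> powr q) = expectation (\<lambda>\<omega>. W \<omega> powr q)" if u: "u \<in> words l" for u q
  proof -
    have "expectation (\<lambda>\<omega>. X u \<omega> powr q) = (\<integral>x. x powr q \<partial>distr M borel (X u))"
      using X_meas[of u] by (subst integral_distr) auto
    also have "\<dots> = expectation (\<lambda>\<omega>. \<phi> (W \<omega>) powr q)" unfolding X_distr[OF u] by (subst integral_distr) auto
    also have "\<dots> = expectation (\<lambda>\<omega>. W \<omega> powr q)" using phi_W[of q] by (intro integral_cong_AE) auto
    finally show ?thesis .
  qed
  have "indep_vars (\<lambda>_. borel) X (words l) = indep_vars (\<lambda>_. borel) (\<lambda>u \<omega>. \<phi> (Ws u \<omega>)) (words l)"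
    by (rule indep_vars_cong) (auto simp: X_def fun_eq_iff)
  then have X_indep: "indep_vars (\<lambda>_. borel) X (words l)"
    using indep_vars_compose2[OF assms(6), of "\<lambda>_. \<phi>" "\<lambda>_. borel"] by simp
  interpret cascade_weights M l X
    by unfold_locales (use assms(2) X_meas X_indep X_distr X_int in \<open>auto simp: X_def \<phi>_def\<close>)
  have mom_W: "mom q = expectation (\<lambda>\<omega>. W \<omega> powr q)" for q
    unfolding mom_def by (rule X_expect[OF zero_word])
  have mom_1: "mom 1 = 1"
  proof -
    have "expectation (\<lambda>\<omega>. W \<omega> powr 1) = expectation W"
      using W_pos by (intro integral_cong_AE) (auto elim!: eventually_mono)
    then show ?thesis using assms(5) by (simp add: mom_W)
  qed
  have "mandelbrot_cascade M l X m"
    unfolding mandelbrot_cascade_def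
  proof (intro conjI)
    show "finite_random_measure_01 M m" using assms(8) by (simp add: mandelbrot_cascade_def)
    have "AE \<omega> in M. u \<in> words l \<longrightarrow> X u \<omega> = Ws u \<omega>" for u
    proof (cases "u \<in> words l")
      case True
      then show ?thesis using Ws_pos[OF True] by (auto elim!: eventually_mono simp: X_def \<phi>_def)
    qed simp
    then have "AE \<omega> in M. \<forall>u. u \<in> words l \<longrightarrow> X u \<omega> = Ws u \<omega>" by (simp add: AE_all_countable)
    moreover have "AE \<omega> in M. converges_weakly_01 (\<lambda>n. cascade_approx l Ws n \<omega>) (m \<omega>)"
      using assms(8) by (simp add: mandelbrot_cascade_def)
    ultimately show "AE \<omega> in M. converges_weakly_01 (\<lambda>n. cascade_approx l X n \<omega>) (m \<omega>)"
    proof eventually_elim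
      case (elim \<omega>)
      have "cascade_density l X n \<omega> = cascade_density l Ws n \<omega>" for n
      proof
        fix x
        have "X (take k v) \<omega> = Ws (take k v) \<omega>" if "v \<in> words_of_length l n" "k \<in> {1..n}" for v k
        proof -
          have "take k v \<noteq> []" "set (take k v) \<subseteq> {..<l}"
            using that set_take_subset[of k v] by (auto simp: words_of_length_def)
          then show ?thesis using elim(1) by (simp add: words_iff is_word_def)
        qed
        then show "cascade_density l X n \<omega> x = cascade_density l Ws n \<omega> x"
          unfolding cascade_density_def by (intro sum.cong prod.cong refl arg_cong2[where f="(*)"])
      qed
      then show ?case using elim(2) by (simp add: cascade_approx_def)
    qed
  qed
  then interpret cascade_measure M l X m by unfold_locales (rule mom_1)
  have T: "structure_function M l W = T"
    by (simp add: T_def structure_function_def X_expect[OF zero_word] fun_eq_iff)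
  obtain T' where T': "smooth_convex T T'"
    using root.structure_function_smooth_convex[OF assms(2)] unfolding T_def by blast
  interpret sc: smooth_convex T T' by (rule T')
  obtain q where q: "T' q = - \<beta>" "q \<in> q_range T" "legendre T \<beta> = ereal (T q + q * \<beta>)"
    using sc.slope_attained[of \<beta>] assms(12,13) unfolding T by blast
  interpret cascade_exponent M l X m T' q \<beta>
    by unfold_locales (use q T' nondegenerate_1[OF nondegenerate] in auto)
  show ?thesis using AE_hausdorff_dim unfolding T q(3) dm_def .
qed

end
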